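(* Let $G$ be a Lie group with a smooth exponential function and let $(\pi,\mathcal H)$ be a smooth unitary representation of $G$. Then the momentum set $I_\pi\subseteq\mathfrak g'$ is equicontinuous (i.e., $\pi$ is bounded) if and only if $\pi\colon G\to U(\mathcal H)$ is a morphism of Lie groups (a smooth group homomorphism), where the unitary group $U(\mathcal H)$ carries its natural Banach–Lie group structure (given by the operator norm).
   Context: Lie groups are smooth manifolds modelled on Hausdorff locally convex spaces with smooth group operations (smoothness in the Michal–Bastiani sense). $\mathfrak g$ is the Lie algebra of $G$ and $\mathfrak g'$ its topological dual with the weak-$*$-topology. A smooth exponential function is a smooth map $\exp_G\colon\mathfrak g\to G$ such that each $t\mapsto \exp_G(tx)$ is a one-parameter group with derivative $x$ at $t=0$. For a unitary representation $(\pi,\mathcal H)$ of $G$ on a complex Hilbert space, $\mathcal H^\infty$ is the space of all $v\in\mathcal H$ for which the orbit map $g\mapsto\pi(g)v$ is smooth; $\pi$ is called smooth if $\mathcal H^\infty$ is dense in $\mathcal H$. Put $\mathrm d\pi(x)v=\frac{d}{dt}\big|_{t=0}\pi(\exp_G(tx))v$ for $x\in\mathfrak g$, $v\in\mathcal H^\infty$. The momentum map is $$\Phi_\pi\colon\mathbb P(\mathcal H^\infty)\to\mathfrak g',\qquad \Phi_\pi([v])(x)=\frac1i\frac{\langle \mathrm d\pi(x)v,v\rangle}{\langle v,v\rangle},\quad [v]=\mathbb Cv,$$ and the momentum set $I_\pi\subseteq\mathfrak g'$ is the weak-$*$-closed convex hull of its image. The representation is called bounded if $I_\pi$ is an equicontinuous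 set of linear functionals on $\mathfrak g$, i.e., if $x\mapsto\sup_{\alpha\in I_\pi}|\alpha(x)|$ is bounded on some $0$-neighborhood of $\mathfrak g$. *)

theory Defs
  imports "HOL-Analysis.Analysis" "HOL-Algebra.Group"
begin

section \<open>Hausdorff locally convex spaces\<close>

class topological_real_vector = real_vector + topological_ab_group_add +
  assumes tendsto_scaleR_Pair:
    "LIM p (nhds r \<times>\<^sub>F nhds a). fst p *\<^sub>R snd p :> nhds (r *\<^sub>R a)"

class locally_convex_space = topological_real_vector + t2_space +
  assumes convex_nhds_zero_raw:
    "open U \<Longrightarrow> 0 \<in> U \<Longrightarrow> \<exists>V. open V \<and> 0 \<in> V \<and> V \<subseteq> U \<and>
      (\<forall>x\<in>V. \<forall>y\<in>V. \<forall>s\<ge>0. \<forall>t\<ge>0. s + t = 1 \<longrightarrow> s *\<^sub>R x + t *\<^sub>R y \<in> V)"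

lemma convex_nhds_zero:
  fixes U :: "'a::locally_convex_space set"
  assumes "open U" "0 \<in> U"
  shows "\<exists>V. open V \<and> 0 \<in> V \<and> V \<subseteq> U \<and> convex V"
  using convex_nhds_zero_raw[OF assms] unfolding convex_def .

instance real_normed_vector \<subseteq> locally_convex_space
proof
  fix r :: real and a :: 'a
  show "LIM p (nhds r \<times>\<^sub>F nhds a). fst p *\<^sub>R snd p :> nhds (r *\<^sub>R a)"
    by (intro tendsto_scaleR filterlim_fst filterlim_snd)
next
  fix U :: "'a set"
  assume "open U" "0 \<in> U"
  then obtain e where "e > 0" "ball 0 e \<subseteq> U"
    by (auto simp: open_contains_ball)
  then have "\<exists>V. open V \<and> 0 \<in> V \<and> V \<subseteq> U \<and> convex V"
    by (intro exI[of _ "ball 0 e"]) auto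
  then show "\<exists>V. open V \<and> 0 \<in> V \<and> V \<subseteq> U \<and>
      (\<forall>x\<in>V. \<forall>y\<in>V. \<forall>s\<ge>0. \<forall>t\<ge>0. s + t = 1 \<longrightarrow> s *\<^sub>R x + t *\<^sub>R y \<in> V)"
    unfolding convex_def .
qed

instance prod :: (locally_convex_space, locally_convex_space) topological_monoid_add
proof
  fix a b :: "'a \<times> 'b"
  have 1: "((\<lambda>p. fst (fst p)) \<longlongrightarrow> fst a) (nhds a \<times>\<^sub>F nhds b)"
    "((\<lambda>p. snd (fst p)) \<longlongrightarrow> snd a) (nhds a \<times>\<^sub>F nhds b)"
    "((\<lambda>p. fst (snd p)) \<longlongrightarrow> fst b) (nhds a \<times>\<^sub>F nhds b)"
    "((\<lambda>p. snd (snd p)) \<longlongrightarrow> snd b) (nhds a \<times>\<^sub>F nhds b)"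
    by (intro tendsto_fst tendsto_snd filterlim_fst filterlim_snd)+
  show "LIM x (nhds a \<times>\<^sub>F nhds b). fst x + snd x :> nhds (a + b)"
    unfolding plus_prod_def by (intro tendsto_Pair tendsto_add 1)
qed

instance prod :: (locally_convex_space, locally_convex_space) topological_comm_monoid_add ..

instance prod :: (locally_convex_space, locally_convex_space) topological_group_add
proof
  fix a :: "'a \<times> 'b"
  have 1: "((\<lambda>p. fst p) \<longlongrightarrow> fst a) (nhds a)" "((\<lambda>p. snd p) \<longlongrightarrow> snd a) (nhds a)"
    by (intro tendsto_fst tendsto_snd filterlim_ident)+
  show "(uminus \<longlongrightarrow> - a) (nhds a)"
    unfolding uminus_prod_def[abs_def] by (intro tendsto_Pair tendsto_minus 1)
qed

instance prod :: (locally_convex_space, locally_convex_space) topological_ab_group_add ..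

instance prod :: (locally_convex_space, locally_convex_space) topological_real_vector
proof
  fix r :: real and a :: "'a \<times> 'b"
  have *: "((\<lambda>p. fst p *\<^sub>R f (snd p)) \<longlongrightarrow> r *\<^sub>R f a) (nhds r \<times>\<^sub>F nhds a)"
    if "(f \<longlongrightarrow> f a) (nhds a)" for f :: "'a \<times> 'b \<Rightarrow> 'c :: locally_convex_space"
  proof -
    have "LIM p (nhds r \<times>\<^sub>F nhds a). (fst p, f (snd p)) :> nhds r \<times>\<^sub>F nhds (f a)"
      by (intro filterlim_Pair filterlim_fst filterlim_compose[OF that filterlim_snd])
    from filterlim_compose[OF tendsto_scaleR_Pair this] show ?thesis by simp
  qed
  have "(fst \<longlongrightarrow> fst a) (nhds a)" "(snd \<longlongrightarrow> snd a) (nhds a)"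
    using tendsto_fst[OF filterlim_ident, of a] tendsto_snd[OF filterlim_ident, of a] by auto
  then show "LIM p (nhds r \<times>\<^sub>F nhds a). fst p *\<^sub>R snd p :> nhds (r *\<^sub>R a)"
    unfolding scaleR_prod_def by (intro tendsto_Pair *)
qed

instance prod :: (locally_convex_space, locally_convex_space) locally_convex_space
proof
  fix U :: "('a \<times> 'b) set"
  assume "open U" "0 \<in> U"
  then obtain A B where AB: "open A" "open B" "0 \<in> A \<times> B" "A \<times> B \<subseteq> U"
    by (rule open_prod_elim)
  then have "0 \<in> A" "0 \<in> B" by (auto simp: zero_prod_def)
  obtain V where V: "open V" "convex V" "0 \<in> V" "V \<subseteq> A"
    using convex_nhds_zero[OF AB(1) \<open>0 \<in> A\<close>] by blast
  obtain W where W: "open W" "convex W" "0 \<in> W" "W \<subseteq> B"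
    using convex_nhds_zero[OF AB(2) \<open>0 \<in> B\<close>] by blast
  have "V \<times> W \<subseteq> U" using V(4) W(4) AB(4) by blast
  with V W have "\<exists>V. open V \<and> 0 \<in> V \<and> V \<subseteq> U \<and> convex V"
    by (intro exI[of _ "V \<times> W"]) (auto simp: open_Times convex_Times zero_prod_def)
  then show "\<exists>V. open V \<and> 0 \<in> V \<and> V \<subseteq> U \<and>
      (\<forall>x\<in>V. \<forall>y\<in>V. \<forall>s\<ge>0. \<forall>t\<ge>0. s + t = 1 \<longrightarrow> s *\<^sub>R x + t *\<^sub>R y \<in> V)"
    unfolding convex_def .
qed


section \<open>Smooth maps in the Michal--Bastiani sense\<close>

definition has_dir_deriv ::
  "('e::locally_convex_space \<Rightarrow> 'f::locally_convex_space) \<Rightarrow> 'e \<Rightarrow> 'e \<Rightarrow> 'f \<Rightarrow> bool" where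
  "has_dir_deriv f x h l \<longleftrightarrow>
     ((\<lambda>t::real. (f (x + t *\<^sub>R h) - f x) /\<^sub>R t) \<longlongrightarrow> l) (at 0)"

definition dir_deriv ::
  "('e::locally_convex_space \<Rightarrow> 'f::locally_convex_space) \<Rightarrow> 'e \<Rightarrow> 'e \<Rightarrow> 'f" where
  "dir_deriv f x h = (THE l. has_dir_deriv f x h l)"

text \<open>
  \<open>iter_dir_deriv k f h x\<close> is the \<open>k\<close>-th derivative of \<open>f\<close> at \<open>x\<close> in the directions
  \<open>h 0, \<dots>, h (k - 1)\<close>; the remaining entries of the sequence \<open>h\<close> are ignored.
\<close>

primrec iter_dir_deriv ::
  "nat \<Rightarrow> ('e::locally_convex_space \<Rightarrow> 'f::locally_convex_space) \<Rightarrow> (nat \<Rightarrow> 'e) \<Rightarrow> 'e \<Rightarrow> 'f" where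
  "iter_dir_deriv 0 f h = f"
| "iter_dir_deriv (Suc k) f h = (\<lambda>x. dir_deriv (iter_dir_deriv k f h) x (h k))"

text \<open>
  All iterated directional derivatives exist on the open set \<open>U\<close> and depend continuously on the
  base point and the directions. Since the \<open>k\<close>-th one only involves \<open>h 0, \<dots>, h (k - 1)\<close>,
  continuity in \<open>h\<close> for the product topology on \<^typ>\<open>nat \<Rightarrow> 'e\<close> is continuity on the \<open>k\<close>-fold
  product of the space.
\<close>

definition mb_smooth_on ::
  "'e::locally_convex_space set \<Rightarrow> ('e \<Rightarrow> 'f::locally_convex_space) \<Rightarrow> bool" where
  "mb_smooth_on U f \<longleftrightarrow> open U \<and>
     (\<forall>k. (\<forall>h. \<forall>x\<in>U. \<exists>l. has_dir_deriv (iter_dir_deriv k f h) x (h k) l) \<and>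
          continuous_on (U \<times> UNIV) (\<lambda>(x, h). iter_dir_deriv k f h x))"


section \<open>Manifolds and Lie groups\<close>

type_synonym ('m, 'e) chart = "'m set \<times> ('m \<Rightarrow> 'e)"

abbreviation chart_dom :: "('m, 'e) chart \<Rightarrow> 'm set" where
  "chart_dom \<equiv> fst"

abbreviation chart_map :: "('m, 'e) chart \<Rightarrow> 'm \<Rightarrow> 'e" where
  "chart_map \<equiv> snd"

definition chart_inv :: "('m, 'e) chart \<Rightarrow> 'e \<Rightarrow> 'm" where
  "chart_inv c = inv_into (chart_dom c) (chart_map c)"

definition is_chart :: "'m topology \<Rightarrow> ('m, 'e::locally_convex_space) chart \<Rightarrow> bool" where
  "is_chart T c \<longleftrightarrow> openin T (chart_dom c) \<and> open (chart_map c ` chart_dom c) \<and>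
     homeomorphic_map (subtopology T (chart_dom c))
       (top_of_set (chart_map c ` chart_dom c)) (chart_map c)"

locale lc_manifold =
  fixes T :: "'m topology" and A :: "('m, 'e::locally_convex_space) chart set"
  assumes Hausdorff: "Hausdorff_space T"
    and charts: "c \<in> A \<Longrightarrow> is_chart T c"
    and charts_cover: "(\<Union>c\<in>A. chart_dom c) = topspace T"
    and charts_compatible: "c \<in> A \<Longrightarrow> d \<in> A \<Longrightarrow>
      mb_smooth_on (chart_map c ` (chart_dom c \<inter> chart_dom d)) (chart_map d \<circ> chart_inv c)"

definition smooth_map ::
  "'m topology \<Rightarrow> ('m, 'e::locally_convex_space) chart set \<Rightarrow>
   'n topology \<Rightarrow> ('n, 'f::locally_convex_space) chart set \<Rightarrow> ('m \<Rightarrow> 'n) \<Rightarrow> bool" where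
  "smooth_map T A S B f \<longleftrightarrow> continuous_map T S f \<and>
     (\<forall>c\<in>A. \<forall>d\<in>B. mb_smooth_on (chart_map c ` {p \<in> chart_dom c. f p \<in> chart_dom d})
        (chart_map d \<circ> f \<circ> chart_inv c))"

text \<open>The atlas of a locally convex space, regarded as a manifold with topology \<^term>\<open>euclidean\<close>.\<close>

definition space_atlas :: "('e, 'e::locally_convex_space) chart set" where
  "space_atlas = {(UNIV, id)}"

definition prod_atlas ::
  "('m, 'e) chart set \<Rightarrow> ('n, 'f) chart set \<Rightarrow> ('m \<times> 'n, 'e \<times> 'f) chart set" where
  "prod_atlas A B =
     {(chart_dom c \<times> chart_dom d, map_prod (chart_map c) (chart_map d)) | c d. c \<in> A \<and> d \<in> B}"

locale lie_group = group G + lc_manifold T A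
  for G :: "('g, 'b) monoid_scheme" (structure)
    and T :: "'g topology" and A :: "('g, 'e::locally_convex_space) chart set" +
  assumes topspace_carrier: "topspace T = carrier G"
    and smooth_mult:
      "smooth_map (prod_topology T T) (prod_atlas A A) T A (\<lambda>(x, y). x \<otimes> y)"
    and smooth_inv: "smooth_map T A T A (\<lambda>x. inv x)"

definition lie_group_morphism ::
  "('g, 'b) monoid_scheme \<Rightarrow> 'g topology \<Rightarrow> ('g, 'e::locally_convex_space) chart set \<Rightarrow>
   ('k, 'c) monoid_scheme \<Rightarrow> 'k topology \<Rightarrow> ('k, 'f::locally_convex_space) chart set \<Rightarrow>
   ('g \<Rightarrow> 'k) \<Rightarrow> bool" where
  "lie_group_morphism G T A H S B f \<longleftrightarrow> f \<in> hom G H \<and> smooth_map T A S B f"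

text \<open>
  The Lie algebra (the tangent space at the identity) is identified with the model space \<^typ>\<open>'e\<close>
  by the differential of a chart \<open>c\<close> around the identity; this is how it gets its topology. So
  the derivative at \<open>0\<close> of a curve through the identity is computed in the chart \<open>c\<close>.
\<close>

definition smooth_exponential ::
  "('g, 'b) monoid_scheme \<Rightarrow> 'g topology \<Rightarrow> ('g, 'e::locally_convex_space) chart set \<Rightarrow>
   ('g, 'e) chart \<Rightarrow> ('e \<Rightarrow> 'g) \<Rightarrow> bool" where
  "smooth_exponential G T A c expG \<longleftrightarrow>
     c \<in> A \<and> \<one>\<^bsub>G\<^esub> \<in> chart_dom c \<and>
     smooth_map euclidean space_atlas T A expG \<and>
     (\<forall>x. \<forall>s t. expG ((s + t) *\<^sub>R x) = expG (s *\<^sub>R x) \<otimes>\<^bsub>G\<^esub> expG (t *\<^sub>R x)) \<and>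
     (\<forall>x. ((\<lambda>t. (chart_map c (expG (t *\<^sub>R x)) - chart_map c \<one>\<^bsub>G\<^esub>) /\<^sub>R t) \<longlongrightarrow> x) (at 0))"


section \<open>Complex Hilbert spaces and the unitary group\<close>

text \<open>The inner product is linear in the first argument.\<close>

class complex_hilbert_space = banach +
  fixes scaleC :: "complex \<Rightarrow> 'a \<Rightarrow> 'a" (infixr "*\<^sub>C" 75)
    and cinner :: "'a \<Rightarrow> 'a \<Rightarrow> complex"
  assumes scaleC_add_right: "a *\<^sub>C (x + y) = a *\<^sub>C x + a *\<^sub>C y"
    and scaleC_add_left: "(a + b) *\<^sub>C x = a *\<^sub>C x + b *\<^sub>C x"
    and scaleC_scaleC: "a *\<^sub>C (b *\<^sub>C x) = (a * b) *\<^sub>C x"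
    and scaleC_of_real: "complex_of_real r *\<^sub>C x = r *\<^sub>R x"
    and cinner_add_left: "cinner (x + y) z = cinner x z + cinner y z"
    and cinner_scaleC_left: "cinner (a *\<^sub>C x) y = a * cinner x y"
    and cinner_commute: "cinner y x = cnj (cinner x y)"
    and norm_eq_sqrt_cinner: "norm x = sqrt (Re (cinner x x))"

definition complex_linear ::
  "('h::complex_hilbert_space \<Rightarrow>\<^sub>L 'h) \<Rightarrow> bool" where
  "complex_linear X \<longleftrightarrow> (\<forall>a v. X (a *\<^sub>C v) = a *\<^sub>C X v)"

definition unitary_op :: "('h::complex_hilbert_space \<Rightarrow>\<^sub>L 'h) \<Rightarrow> bool" where
  "unitary_op u \<longleftrightarrow> complex_linear u \<and> surj (blinfun_apply u) \<and>
     (\<forall>v w. cinner (u v) (u w) = cinner v w)"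

definition unitary_group :: "('h::complex_hilbert_space \<Rightarrow>\<^sub>L 'h) monoid" where
  "unitary_group = \<lparr>carrier = {u. unitary_op u}, mult = (o\<^sub>L), one = id_blinfun\<rparr>"

definition unitary_topology :: "('h::complex_hilbert_space \<Rightarrow>\<^sub>L 'h) topology" where
  "unitary_topology = top_of_set {u. unitary_op u}"

text \<open>The Banach space of skew-hermitian operators, the Lie algebra of the unitary group.\<close>

typedef (overloaded) 'h skew_op =
  "{X :: 'h::complex_hilbert_space \<Rightarrow>\<^sub>L 'h. complex_linear X \<and>
     (\<forall>v w. cinner (X v) w = - cinner v (X w))}"
  morphisms skew_apply Skew
proof -
  have "cinner 0 w = 0" "cinner v 0 = 0" for v w :: 'h
    using cinner_add_left[of 0 0 w] cinner_add_left[of 0 0 v] cinner_commute[of 0 v] by auto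
  moreover have "a *\<^sub>C (0::'h) = 0" for a
    using scaleC_add_right[of a 0 "0::'h"] by auto
  ultimately show ?thesis
    by (intro exI[of _ 0]) (auto simp: complex_linear_def)
qed

setup_lifting type_definition_skew_op

instantiation skew_op :: (complex_hilbert_space) real_normed_vector
begin

lemma skew_aux:
  fixes x y z :: "'a"
  shows "cinner 0 y = 0" "cinner x 0 = 0"
    "cinner (- x) y = - cinner x y" "cinner x (- y) = - cinner x y"
    "cinner x (y + z) = cinner x y + cinner x z"
    "cinner (x - z) y = cinner x y - cinner z y" "cinner x (y - z) = cinner x y - cinner x z"
    "cinner (r *\<^sub>R x) y = of_real r * cinner x y" "cinner x (r *\<^sub>R y) = of_real r * cinner x y"
    "a *\<^sub>C (0::'a) = 0" "a *\<^sub>C (- x) = - (a *\<^sub>C x)" "a *\<^sub>C (x - y) = a *\<^sub>C x - a *\<^sub>C y"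
    "a *\<^sub>C (r *\<^sub>R x) = r *\<^sub>R (a *\<^sub>C x)"
proof -
  show z: "cinner 0 y = 0" for y :: 'a using cinner_add_left[of 0 0 y] by auto
  show zr: "cinner x 0 = 0" for x :: 'a using z[of x] cinner_commute[of 0 x] by auto
  show m: "cinner (- x) y = - cinner x y" for x y :: 'a
    using cinner_add_left[of x "- x" y] z[of y] by (auto simp: eq_neg_iff_add_eq_0 add.commute)
  show mr: "cinner x (- y) = - cinner x y" for x y :: 'a
    by (metis m cinner_commute complex_cnj_minus)
  show ar: "cinner x (y + z) = cinner x y + cinner x z" for x y z :: 'a
    by (metis cinner_add_left cinner_commute complex_cnj_add)
  show "cinner (x - z) y = cinner x y - cinner z y"
    using cinner_add_left[of x "- z" y] m by simp
  show "cinner x (y - z) = cinner x y - cinner x z"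
    using ar[of x y "- z"] mr by simp
  show s: "cinner (r *\<^sub>R x) y = of_real r * cinner x y" for x y :: 'a
    using cinner_scaleC_left[of "of_real r" x y] by (simp add: scaleC_of_real)
  show "cinner x (r *\<^sub>R y) = of_real r * cinner x y"
    by (metis s cinner_commute complex_cnj_mult complex_cnj_complex_of_real)
  show c0: "a *\<^sub>C (0::'a) = 0" using scaleC_add_right[of a 0 "0::'a"] by auto
  show cm: "a *\<^sub>C (- x) = - (a *\<^sub>C x)" for x :: 'a
    using scaleC_add_right[of a x "- x"] c0 by (auto simp: eq_neg_iff_add_eq_0 add.commute)
  show "a *\<^sub>C (x - y) = a *\<^sub>C x - a *\<^sub>C y"
    using scaleC_add_right[of a x "- y"] cm by simp
  show "a *\<^sub>C (r *\<^sub>R x) = r *\<^sub>R (a *\<^sub>C x)"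
    by (simp add: scaleC_of_real[symmetric] scaleC_scaleC mult.commute)
qed

lift_definition zero_skew_op :: "'a skew_op" is 0
  by (auto simp: complex_linear_def skew_aux)

lift_definition plus_skew_op :: "'a skew_op \<Rightarrow> 'a skew_op \<Rightarrow> 'a skew_op" is "(+)"
  by (auto simp: complex_linear_def skew_aux blinfun.bilinear_simps scaleC_add_right cinner_add_left)

lift_definition minus_skew_op :: "'a skew_op \<Rightarrow> 'a skew_op \<Rightarrow> 'a skew_op" is "(-)"
  by (auto simp: complex_linear_def skew_aux blinfun.bilinear_simps)

lift_definition uminus_skew_op :: "'a skew_op \<Rightarrow> 'a skew_op" is uminus
  by (auto simp: complex_linear_def skew_aux blinfun.bilinear_simps)

lift_definition scaleR_skew_op :: "real \<Rightarrow> 'a skew_op \<Rightarrow> 'a skew_op" is scaleR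
  by (auto simp: complex_linear_def skew_aux blinfun.bilinear_simps)

lift_definition norm_skew_op :: "'a skew_op \<Rightarrow> real" is norm .

definition "sgn_skew_op (X :: 'a skew_op) = scaleR (inverse (norm X)) X"
definition "dist_skew_op (X :: 'a skew_op) Y = norm (X - Y)"
definition [code del]:
  "(uniformity :: ('a skew_op \<times> 'a skew_op) filter) = (INF e\<in>{0<..}. principal {(x, y). dist x y < e})"
definition [code del]: "open (U :: 'a skew_op set) \<longleftrightarrow>
  (\<forall>x\<in>U. eventually (\<lambda>(x', y). x' = x \<longrightarrow> y \<in> U) uniformity)"

instance
proof
  fix x y z :: "'a skew_op" and a b :: real and U :: "'a skew_op set"
  show "x + y + z = x + (y + z)" by transfer (simp add: add.assoc)
  show "x + y = y + x" by transfer (simp add: add.commute)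
  show "0 + x = x" by transfer simp
  show "- x + x = 0" by transfer simp
  show "x - y = x + - y" by transfer simp
  show "a *\<^sub>R (x + y) = a *\<^sub>R x + a *\<^sub>R y" by transfer (simp add: scaleR_add_right)
  show "(a + b) *\<^sub>R x = a *\<^sub>R x + b *\<^sub>R x" by transfer (simp add: scaleR_add_left)
  show "a *\<^sub>R b *\<^sub>R x = (a * b) *\<^sub>R x" by transfer simp
  show "1 *\<^sub>R x = x" by transfer simp
  show "(norm x = 0) = (x = 0)" by transfer simp
  show "norm (x + y) \<le> norm x + norm y" by transfer (simp add: norm_triangle_ineq)
  show "norm (a *\<^sub>R x) = \<bar>a\<bar> * norm x" by transfer simp
  show "sgn x = inverse (norm x) *\<^sub>R x" by (simp add: sgn_skew_op_def)
  show "dist x y = norm (x - y)" by (simp add: dist_skew_op_def)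
qed (rule uniformity_skew_op_def open_skew_op_def)+

end

definition invertible_op :: "('h::real_normed_vector \<Rightarrow>\<^sub>L 'h) \<Rightarrow> bool" where
  "invertible_op X \<longleftrightarrow> (\<exists>Y. X o\<^sub>L Y = id_blinfun \<and> Y o\<^sub>L X = id_blinfun)"

definition inverse_op :: "('h::real_normed_vector \<Rightarrow>\<^sub>L 'h) \<Rightarrow> ('h \<Rightarrow>\<^sub>L 'h)" where
  "inverse_op X = (THE Y. X o\<^sub>L Y = id_blinfun \<and> Y o\<^sub>L X = id_blinfun)"

text \<open>
  The Banach--Lie group structure is given by the Cayley charts. In the chart centred at the
  unitary \<open>g\<close>, the skew-hermitian operator \<open>X\<close> parametrizes \<open>u = g (1 + X) (1 - X)\<^sup>-\<^sup>1\<close>,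
  that is, \<open>X = (u + g)\<^sup>-\<^sup>1 (u - g)\<close>. For small \<open>X\<close> we have
  \<open>(1 + X) (1 - X)\<^sup>-\<^sup>1 = exp (2 artanh X)\<close>, so these charts are analytically compatible with the
  exponential ones \<open>X \<mapsto> g exp X\<close>.
\<close>

definition cayley_chart ::
  "('h::complex_hilbert_space \<Rightarrow>\<^sub>L 'h) \<Rightarrow> ('h \<Rightarrow>\<^sub>L 'h, 'h skew_op) chart" where
  "cayley_chart g =
     ({u. unitary_op u \<and> invertible_op (u + g)}, \<lambda>u. Skew (inverse_op (u + g) o\<^sub>L (u - g)))"

definition unitary_atlas :: "('h::complex_hilbert_space \<Rightarrow>\<^sub>L 'h, 'h skew_op) chart set" where
  "unitary_atlas = cayley_chart ` {g. unitary_op g}"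


section \<open>Unitary representations and their momentum sets\<close>

definition unitary_rep ::
  "('g, 'b) monoid_scheme \<Rightarrow> ('g \<Rightarrow> ('h::complex_hilbert_space \<Rightarrow>\<^sub>L 'h)) \<Rightarrow> bool" where
  "unitary_rep G \<pi> \<longleftrightarrow> \<pi> \<in> hom G unitary_group"

definition smooth_vectors ::
  "'g topology \<Rightarrow> ('g, 'e::locally_convex_space) chart set \<Rightarrow>
   ('g \<Rightarrow> ('h::complex_hilbert_space \<Rightarrow>\<^sub>L 'h)) \<Rightarrow> 'h set" where
  "smooth_vectors T A \<pi> = {v. smooth_map T A euclidean space_atlas (\<lambda>g. \<pi> g v)}"

definition smooth_unitary_rep ::
  "('g, 'b) monoid_scheme \<Rightarrow> 'g topology \<Rightarrow> ('g, 'e::locally_convex_space) chart set \<Rightarrow>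
   ('g \<Rightarrow> ('h::complex_hilbert_space \<Rightarrow>\<^sub>L 'h)) \<Rightarrow> bool" where
  "smooth_unitary_rep G T A \<pi> \<longleftrightarrow> unitary_rep G \<pi> \<and> closure (smooth_vectors T A \<pi>) = UNIV"

definition derived_rep ::
  "('e::locally_convex_space \<Rightarrow> 'g) \<Rightarrow> ('g \<Rightarrow> ('h::complex_hilbert_space \<Rightarrow>\<^sub>L 'h)) \<Rightarrow> 'e \<Rightarrow> 'h \<Rightarrow> 'h" where
  "derived_rep expG \<pi> x v = vector_derivative (\<lambda>t. \<pi> (expG (t *\<^sub>R x)) v) (at 0)"

definition complex_line :: "'h::complex_hilbert_space \<Rightarrow> 'h set" where
  "complex_line v = range (\<lambda>a. a *\<^sub>C v)"

definition projective_space :: "'h::complex_hilbert_space set \<Rightarrow> 'h set set" where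
  "projective_space V = complex_line ` (V - {0})"

text \<open>
  The quotient is real for smooth \<open>v\<close> and does not depend on the choice of \<open>v \<noteq> 0\<close> on the line,
  so the description below is definite on the projective space of the smooth vectors.
\<close>

definition momentum_map ::
  "('e::locally_convex_space \<Rightarrow> 'g) \<Rightarrow> ('g \<Rightarrow> ('h::complex_hilbert_space \<Rightarrow>\<^sub>L 'h)) \<Rightarrow>
   'h set \<Rightarrow> 'e \<Rightarrow> real" where
  "momentum_map expG \<pi> L x = (THE r. \<forall>v\<in>L - {0}.
     complex_of_real r = (1 / \<i>) * (cinner (derived_rep expG \<pi> x v) v / cinner v v))"

definition topological_dual :: "('e::locally_convex_space \<Rightarrow> real) set" where
  "topological_dual = {\<alpha>. linear \<alpha> \<and> continuous_on UNIV \<alpha>}"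

text \<open>\<^typ>\<open>'e \<Rightarrow> real\<close> carries the topology of pointwise convergence.\<close>

definition weak_star_topology :: "('e::locally_convex_space \<Rightarrow> real) topology" where
  "weak_star_topology = top_of_set topological_dual"

definition convex_functionals :: "('e \<Rightarrow> real) set \<Rightarrow> bool" where
  "convex_functionals C \<longleftrightarrow> (\<forall>\<alpha>\<in>C. \<forall>\<beta>\<in>C. \<forall>s\<ge>0. \<forall>t\<ge>0. s + t = 1 \<longrightarrow>
     (\<lambda>x. s * \<alpha> x + t * \<beta> x) \<in> C)"

definition momentum_set ::
  "'g topology \<Rightarrow> ('g, 'e::locally_convex_space) chart set \<Rightarrow> ('e \<Rightarrow> 'g) \<Rightarrow>
   ('g \<Rightarrow> ('h::complex_hilbert_space \<Rightarrow>\<^sub>L 'h)) \<Rightarrow> ('e \<Rightarrow> real) set" where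
  "momentum_set T A expG \<pi> =
     (\<lambda>C. closedin weak_star_topology C \<and> convex_functionals C) hull
       (momentum_map expG \<pi> ` projective_space (smooth_vectors T A \<pi>))"

definition equicontinuous_functionals :: "('e::locally_convex_space \<Rightarrow> real) set \<Rightarrow> bool" where
  "equicontinuous_functionals I \<longleftrightarrow>
     (\<exists>U M. open U \<and> 0 \<in> U \<and> (\<forall>x\<in>U. \<forall>\<alpha>\<in>I. \<bar>\<alpha> x\<bar> \<le> M))"

end

(*
  If the momentum set is equicontinuous, the skew-symmetric operators d\<pi>(x) extend to bounded operators
  B(x), depending continuously and linearly on x (polarization bounds the norm by the numerical radius).
  In a chart, \<Pi>(y) = \<pi>(p_y) satisfies d\<Pi>(y)(h) = \<Pi>(y) B(\<kappa>(y, h)) on smooth vectors, where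
  \<kappa>(y, h) = d\<mu>(\<iota>(y), y)(0, h) is the logarithmic derivative built from the multiplication \<mu> and
  the inversion \<iota> in charts. The mean value inequality, uniform on the unit ball of the dense space of
  smooth vectors, turns this into a derivative in operator norm; since B o \<kappa> is smooth, the differential
  equation bootstraps to smoothness of \<Pi>, and Cayley charts only add an inverse.
  Conversely, if Z(y) is the Cayley transform of \<Pi>(y), then \<Pi> - 1 = (\<Pi> + 1) Z gives
  d\<pi>(x) = 2 dZ(x), which is bounded for x near 0.
*)

theory Submission
  imports Defs
begin

text \<open>The model space carries no norm, so the chain rule is derived from the mean value
  inequality on segments in convex neighbourhoods. This measures only the values of the outer map,
  which must lie in a normed space. The multiplication in charts violates this, so \<open>B\<close>
  is composed with \<open>\<mu>\<close> before differentiating.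

  Additivity of d\<pi>(x) in x is not visible on one-parameter groups. It holds because d\<pi>(x)v
  is the differential at the identity of the orbit map of v in the chart \<open>c\<close>, computed
  by any curve with velocity x. Only the curves exp(tx) are used, never exponential coordinates,
  which can fail to exist in this generality.

  Smooth orbit maps make \<pi> differentiable only in the strong sense. The step to the operator
  norm works because the derivative is a unitary times a bounded operator that is norm continuous in
  base point and direction.

  A bound on the momentum map passes to the momentum set since a bound at a point is a weak-* closed
  convex condition.\<close>

lemma tendsto_scaleR_lcs:
  fixes g :: "'a \<Rightarrow> 'e::topological_real_vector"
  assumes "(f \<longlongrightarrow> r) F" "(g \<longlongrightarrow> a) F"
  shows "((\<lambda>t. f t *\<^sub>R g t) \<longlongrightarrow> r *\<^sub>R a) F"
  using filterlim_compose[OF tendsto_scaleR_Pair filterlim_Pair[OF assms]] by simp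

lemma tendsto_fun_coordinatewise:
  fixes f :: "'a \<Rightarrow> 'i \<Rightarrow> 'b::topological_space"
  assumes "\<And>i. ((\<lambda>t. f t i) \<longlongrightarrow> l i) F"
  shows "(f \<longlongrightarrow> l) F"
proof -
  have "limitin (product_topology (\<lambda>i. euclidean) UNIV) f l F"
    using assms by (simp add: limitin_componentwise)
  then show ?thesis
    by (simp add: euclidean_product_topology)
qed

lemma continuous_on_open_tendsto_nhds:
  assumes "continuous_on S f" "open S" "x \<in> S"
  shows "(f \<longlongrightarrow> f x) (nhds x)"
  using assms at_within_open[OF assms(3,2)] tendsto_at_iff_tendsto_nhds[of f x]
  by (auto simp: continuous_on_def)

lemma eventually_line_in_open:
  fixes x h :: "'e::topological_real_vector"
  assumes "open U" "x \<in> U"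
  shows "eventually (\<lambda>t. x + t *\<^sub>R h \<in> U) (at (0::real))"
proof -
  have "((\<lambda>t. x + t *\<^sub>R h) \<longlongrightarrow> x + 0 *\<^sub>R h) (at (0::real))"
    by (intro tendsto_add tendsto_const tendsto_scaleR_lcs tendsto_ident_at)
  then show ?thesis
    using assms by (auto dest: topological_tendstoD)
qed

text \<open>Differentiability implies continuity without any norm: away from 0, \<open>X t\<close>
  is \<open>x\<close> plus \<open>t\<close> times the quotient, and scalar multiplication is jointly
  continuous.\<close>

lemma tendsto_base_of_difference_quotient:
  fixes X :: "real \<Rightarrow> 'e::topological_real_vector"
  assumes "((\<lambda>t. (X t - x) /\<^sub>R t) \<longlongrightarrow> d) (at 0)"
  shows "(X \<longlongrightarrow> x) (at 0)"
proof -
  have "((\<lambda>t. x + t *\<^sub>R ((X t - x) /\<^sub>R t)) \<longlongrightarrow> x + 0 *\<^sub>R d) (at 0)"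
    by (intro tendsto_add tendsto_const tendsto_scaleR_lcs tendsto_ident_at assms)
  then have "((\<lambda>t. x + t *\<^sub>R ((X t - x) /\<^sub>R t)) \<longlongrightarrow> x) (at 0)" by simp
  then show ?thesis
    by (rule Lim_transform_eventually) (simp add: eventually_at_filter)
qed

section \<open>Directional derivatives\<close>

lemma has_dir_deriv_unique:
  "has_dir_deriv f x h l \<Longrightarrow> has_dir_deriv f x h l' \<Longrightarrow> l = l'"
  unfolding has_dir_deriv_def by (rule tendsto_unique[rotated]) auto

lemma dir_deriv_eqI: "has_dir_deriv f x h l \<Longrightarrow> dir_deriv f x h = l"
  unfolding dir_deriv_def by (rule the_equality) (auto dest: has_dir_deriv_unique)

lemma has_dir_deriv_transform:
  assumes "open U" "x \<in> U" "\<And>y. y \<in> U \<Longrightarrow> f y = g y" "has_dir_deriv f x h l"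
  shows "has_dir_deriv g x h l"
  using assms(4) unfolding has_dir_deriv_def
  by (rule Lim_transform_eventually)
    (use eventually_line_in_open[OF assms(1,2), of h] assms(2,3) in \<open>auto elim!: eventually_mono\<close>)

lemma has_dir_deriv_const: "has_dir_deriv (\<lambda>x. a) x h 0"
  by (simp add: has_dir_deriv_def)

lemma has_dir_deriv_id: "has_dir_deriv (\<lambda>x. x) x h h"
  unfolding has_dir_deriv_def
  by (rule Lim_transform_eventually[OF tendsto_const]) (simp add: eventually_at_filter)

lemma has_dir_deriv_add:
  "has_dir_deriv f x h l \<Longrightarrow> has_dir_deriv g x h m \<Longrightarrow> has_dir_deriv (\<lambda>x. f x + g x) x h (l + m)"
  unfolding has_dir_deriv_def
  by (drule (1) tendsto_add) (simp add: algebra_simps)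

lemma has_dir_deriv_Pair:
  "has_dir_deriv f x h l \<Longrightarrow> has_dir_deriv g x h m \<Longrightarrow> has_dir_deriv (\<lambda>x. (f x, g x)) x h (l, m)"
  unfolding has_dir_deriv_def
  by (drule (1) tendsto_Pair) simp

lemma has_dir_deriv_continuous_linear:
  assumes "linear L" "continuous_on UNIV L" "has_dir_deriv f x h l"
  shows "has_dir_deriv (\<lambda>x. L (f x)) x h (L l)"
proof -
  have "(L \<longlongrightarrow> L l) (nhds l)"
    by (rule continuous_on_open_tendsto_nhds[OF assms(2)]) auto
  from filterlim_compose[OF this assms(3)[unfolded has_dir_deriv_def]]
  show ?thesis
    by (simp add: has_dir_deriv_def linear_diff[OF assms(1)] linear_scale[OF assms(1)])
qed

lemma has_dir_deriv_scale_direction: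
  assumes "has_dir_deriv f x h l"
  shows "has_dir_deriv f x (r *\<^sub>R h) (r *\<^sub>R l)"
proof (cases "r = 0")
  case True
  then show ?thesis by (simp add: has_dir_deriv_def)
next
  case False
  have "filterlim (\<lambda>t. t * r) (at 0) (at 0)"
    unfolding filterlim_at using False
    by (auto intro!: tendsto_eq_intros simp: eventually_at_filter)
  from filterlim_compose[OF assms[unfolded has_dir_deriv_def] this]
  have "((\<lambda>t. r *\<^sub>R ((f (x + (t * r) *\<^sub>R h) - f x) /\<^sub>R (t * r))) \<longlongrightarrow> r *\<^sub>R l) (at 0)"
    by (intro tendsto_scaleR_lcs tendsto_const)
  then show ?thesis
    unfolding has_dir_deriv_def
    by (rule Lim_transform_eventually) (use False in \<open>simp add: field_simps eventually_at_filter\<close>)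
qed

section \<open>Curves in normed spaces and the mean value inequality\<close>

lemma has_vector_derivative_at_iff_difference_quotient:
  fixes g :: "real \<Rightarrow> 'b::real_normed_vector"
  shows "(g has_vector_derivative d) (at s) \<longleftrightarrow> ((\<lambda>t. (g (s + t) - g s) /\<^sub>R t) \<longlongrightarrow> d) (at 0)"
proof -
  have "norm (g (s + t) - g s - t *\<^sub>R d) / norm t = norm ((g (s + t) - g s) /\<^sub>R t - d)" if "t \<noteq> 0" for t
  proof -
    have "(g (s + t) - g s) /\<^sub>R t - d = (g (s + t) - g s - t *\<^sub>R d) /\<^sub>R t"
      using that by (simp add: scaleR_diff_right)
    then show ?thesis by (simp add: divide_inverse mult.commute)
  qed
  then have *: "eventually (\<lambda>t. norm (g (s + t) - g s - t *\<^sub>R d) / norm t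
      = norm ((g (s + t) - g s) /\<^sub>R t - d)) (at 0)"
    by (simp add: eventually_at_filter)
  have "(g has_vector_derivative d) (at s) \<longleftrightarrow>
      ((\<lambda>t. norm (g (s + t) - g s - t *\<^sub>R d) / norm t) \<longlongrightarrow> 0) (at 0)"
    by (simp add: has_vector_derivative_def has_derivative_at bounded_linear_scaleR_left)
  also have "\<dots> \<longleftrightarrow> ((\<lambda>t. norm ((g (s + t) - g s) /\<^sub>R t - d)) \<longlongrightarrow> 0) (at 0)"
    by (rule tendsto_cong[OF *])
  also have "\<dots> \<longleftrightarrow> ((\<lambda>t. (g (s + t) - g s) /\<^sub>R t) \<longlongrightarrow> d) (at 0)"
    by (simp only: tendsto_norm_zero_iff LIM_zero_iff)
  finally show ?thesis .
qed

lemma has_vector_derivative_along_line: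
  fixes f :: "'e::locally_convex_space \<Rightarrow> 'b::real_normed_vector"
  assumes "has_dir_deriv f (x + s *\<^sub>R h) h l"
  shows "((\<lambda>s. f (x + s *\<^sub>R h)) has_vector_derivative l) (at s)"
  using assms unfolding has_dir_deriv_def has_vector_derivative_at_iff_difference_quotient
  by (simp add: algebra_simps)

text \<open>The mean value inequality is applied to \<open>g s - s *\<^sub>R l\<close>, whose
  velocity is the deviation of \<open>g'\<close> from \<open>l\<close>. The segment form covers
  negative \<open>t\<close>.\<close>

lemma increment_bound:
  fixes g :: "real \<Rightarrow> 'b::real_normed_vector"
  assumes "\<And>s. s \<in> closed_segment 0 t \<Longrightarrow> (g has_vector_derivative g' s) (at s)"
    and "\<And>s. s \<in> closed_segment 0 t \<Longrightarrow> norm (g' s - l) \<le> e"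
  shows "norm (g t - g 0 - t *\<^sub>R l) \<le> e * \<bar>t\<bar>"
proof -
  have "norm ((g t - t *\<^sub>R l) - (g 0 - 0 *\<^sub>R l)) \<le> e * norm (t - 0)"
  proof (rule differentiable_bound[where S = "closed_segment 0 t" and f' = "\<lambda>s h. h *\<^sub>R (g' s - l)"
        and f = "\<lambda>s. g s - s *\<^sub>R l"])
    fix s assume s: "s \<in> closed_segment 0 t"
    have "((\<lambda>s. g s - s *\<^sub>R l) has_vector_derivative g' s - l) (at s)"
      by (auto intro!: derivative_eq_intros assms(1)[OF s])
    then show "((\<lambda>s. g s - s *\<^sub>R l) has_derivative (\<lambda>h. h *\<^sub>R (g' s - l))) (at s within closed_segment 0 t)"
      by (simp add: has_vector_derivative_def has_derivative_at_withinI)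
    show "onorm (\<lambda>h. h *\<^sub>R (g' s - l)) \<le> e"
      by (rule onorm_le) (use assms(2)[OF s] in \<open>simp add: mult.commute[of e] mult_left_mono\<close>)
  qed auto
  then show ?thesis by (simp add: algebra_simps)
qed

section \<open>Michal-Bastiani smooth maps: strict derivatives and multilinearity\<close>

lemma mb_smooth_onD:
  assumes "mb_smooth_on U f"
  shows "open U"
    "x \<in> U \<Longrightarrow> has_dir_deriv (iter_dir_deriv k f h) x (h k) (iter_dir_deriv (Suc k) f h x)"
    "continuous_on (U \<times> UNIV) (\<lambda>(x, h). iter_dir_deriv k f h x)"
proof -
  show "open U" "continuous_on (U \<times> UNIV) (\<lambda>(x, h). iter_dir_deriv k f h x)"
    using assms by (auto simp: mb_smooth_on_def)
  assume "x \<in> U"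
  then obtain l where "has_dir_deriv (iter_dir_deriv k f h) x (h k) l"
    using assms unfolding mb_smooth_on_def by blast
  with dir_deriv_eqI[OF this]
  show "has_dir_deriv (iter_dir_deriv k f h) x (h k) (iter_dir_deriv (Suc k) f h x)" by simp
qed

lemma iter_dir_deriv_cong_directions:
  "(\<And>i. i < k \<Longrightarrow> h i = h' i) \<Longrightarrow> iter_dir_deriv k f h = iter_dir_deriv k f h'"
proof (induction k)
  case (Suc k)
  have "iter_dir_deriv k f h = iter_dir_deriv k f h'" using Suc by auto
  then show ?case using Suc.prems[of k] by simp
qed simp

text \<open>The k-th derivative does not involve entry \<open>k\<close> of the sequence, so this
  entry can be overwritten by an arbitrary direction \<open>d\<close>.\<close>

lemma mb_smooth_on_has_dir_deriv:
  assumes "mb_smooth_on U f" "x \<in> U"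
  shows "has_dir_deriv (iter_dir_deriv k f h) x d (iter_dir_deriv (Suc k) f (h(k := d)) x)"
proof -
  have "iter_dir_deriv k f (h(k := d)) = iter_dir_deriv k f h"
    by (rule iter_dir_deriv_cong_directions) simp
  with mb_smooth_onD(2)[OF assms, of k "h(k := d)"] show ?thesis by simp
qed

lemma tendsto_iter_dir_deriv:
  assumes "mb_smooth_on U f" "x \<in> U" "(X \<longlongrightarrow> x) F" "\<And>i. ((\<lambda>t. \<eta> t i) \<longlongrightarrow> h i) F"
  shows "((\<lambda>t. iter_dir_deriv k f (\<eta> t) (X t)) \<longlongrightarrow> iter_dir_deriv k f h x) F"
proof -
  note U = mb_smooth_onD(1)[OF assms(1)]
  have "((\<lambda>(x, h). iter_dir_deriv k f h x) \<longlongrightarrow> iter_dir_deriv k f h x) (nhds (x, h))"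
    using continuous_on_open_tendsto_nhds[OF mb_smooth_onD(3)[OF assms(1), of k], of "(x, h)"] assms(2) U
    by (auto simp: open_Times)
  moreover have "((\<lambda>t. (X t, \<eta> t)) \<longlongrightarrow> (x, h)) F"
    by (intro tendsto_Pair assms(3) tendsto_fun_coordinatewise assms(4))
  ultimately show ?thesis
    using filterlim_compose by fastforce
qed

text \<open>By the mean value inequality along the segment from \<open>X t\<close> to \<open>X t + t \<eta> t k\<close>.\<close>

lemma strict_iter_dir_deriv:
  fixes f :: "'e::locally_convex_space \<Rightarrow> 'b::real_normed_vector"
  assumes f: "mb_smooth_on U f" and x: "x \<in> U" and X: "(X \<longlongrightarrow> x) (at 0)"
    and \<eta>: "\<And>i. ((\<lambda>t. \<eta> t i) \<longlongrightarrow> h i) (at (0::real))"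
  shows "((\<lambda>t. (iter_dir_deriv k f (\<eta> t) (X t + t *\<^sub>R \<eta> t k) - iter_dir_deriv k f (\<eta> t) (X t)) /\<^sub>R t)
    \<longlongrightarrow> iter_dir_deriv (Suc k) f h x) (at 0)"
proof (rule tendstoI)
  fix e :: real assume e: "e > 0"
  let ?D = "iter_dir_deriv (Suc k) f"
  note U = mb_smooth_onD(1)[OF f]
  have "((\<lambda>(x, h). ?D h x) \<longlongrightarrow> ?D h x) (nhds (x, h))"
    using continuous_on_open_tendsto_nhds[OF mb_smooth_onD(3)[OF f, of "Suc k"], of "(x, h)"] x U
    by (auto simp: open_Times simp del: iter_dir_deriv.simps)
  then have "eventually (\<lambda>p. dist (case p of (x, h) \<Rightarrow> ?D h x) (?D h x) < e / 2) (nhds (x, h))"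
    using e by (intro tendstoD) auto
  then obtain S where S: "open S" "(x, h) \<in> S" "\<And>y g. (y, g) \<in> S \<Longrightarrow> dist (?D g y) (?D h x) < e / 2"
    unfolding eventually_nhds by force
  obtain V N where VN: "open V" "open N" "(x, h) \<in> V \<times> N" "V \<times> N \<subseteq> S"
    using open_prod_elim[OF S(1,2)] .
  \<comment> \<open>Local convexity enters here: with \<open>W\<close> convex, the whole segment
    from \<open>X t\<close> to \<open>X t + t *\<^sub>R \<eta> t k\<close> stays in \<open>U\<close>
    and \<open>V\<close> as soon as its endpoints lie in the translate of \<open>W\<close>.\<close>
  have "open ((\<lambda>y. y + x) -` (U \<inter> V))"
    using U VN(1) by (intro open_vimage open_Int continuous_intros)
  then obtain W where W: "open W" "0 \<in> W" "W \<subseteq> (\<lambda>y. y + x) -` (U \<inter> V)" "convex W"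
    using convex_nhds_zero[of "(\<lambda>y. y + x) -` (U \<inter> V)"] x VN(3) by auto
  have WUV: "y - x \<in> W \<Longrightarrow> y \<in> U \<and> y \<in> V" for y
    using W(3) by auto
  have "((\<lambda>t. X t - x) \<longlongrightarrow> x - x) (at 0)"
    by (intro tendsto_diff X tendsto_const)
  then have 1: "eventually (\<lambda>t. X t - x \<in> W) (at 0)"
    using W by (auto dest: topological_tendstoD)
  have "((\<lambda>t. X t + t *\<^sub>R \<eta> t k - x) \<longlongrightarrow> x + 0 *\<^sub>R h k - x) (at 0)"
    by (intro tendsto_diff tendsto_add tendsto_scaleR_lcs \<eta> X tendsto_const tendsto_ident_at)
  then have 2: "eventually (\<lambda>t. X t + t *\<^sub>R \<eta> t k - x \<in> W) (at 0)"
    using W by (auto dest: topological_tendstoD)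
  have 3: "eventually (\<lambda>t. \<eta> t \<in> N) (at 0)"
    using tendsto_fun_coordinatewise[of \<eta> h, OF \<eta>] VN by (auto dest: topological_tendstoD)
  show "eventually (\<lambda>t. dist ((iter_dir_deriv k f (\<eta> t) (X t + t *\<^sub>R \<eta> t k)
      - iter_dir_deriv k f (\<eta> t) (X t)) /\<^sub>R t) (?D h x) < e) (at 0)"
    using 1 2 3 eventually_neq_at_within[of 0 0 UNIV]
  proof eventually_elim
    fix t assume t: "X t - x \<in> W" "X t + t *\<^sub>R \<eta> t k - x \<in> W" "\<eta> t \<in> N" "t \<noteq> (0::real)"
    let ?g = "\<lambda>s. iter_dir_deriv k f (\<eta> t) (X t + s *\<^sub>R \<eta> t k)"
    have inW: "X t + s *\<^sub>R \<eta> t k - x \<in> W" if s: "s \<in> closed_segment 0 t" for s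
    proof -
      obtain u where u: "0 \<le> u" "u \<le> 1" "s = u * t" using s by (auto simp: in_segment)
      have "(1 - u) *\<^sub>R (X t - x) + u *\<^sub>R (X t + t *\<^sub>R \<eta> t k - x) \<in> W"
        using convexD[OF W(4) t(1,2), of "1 - u" u] u by auto
      then show ?thesis using u(3) by (simp add: algebra_simps)
    qed
    have "norm (?g t - ?g 0 - t *\<^sub>R ?D h x) \<le> e / 2 * \<bar>t\<bar>"
    proof (rule increment_bound)
      fix s assume s: "s \<in> closed_segment 0 t"
      have "X t + s *\<^sub>R \<eta> t k \<in> U" using inW[OF s] WUV by blast
      then show "(?g has_vector_derivative ?D (\<eta> t) (X t + s *\<^sub>R \<eta> t k)) (at s)"
        by (intro has_vector_derivative_along_line mb_smooth_onD(2)[OF f])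
      have "(X t + s *\<^sub>R \<eta> t k, \<eta> t) \<in> S" using inW[OF s] WUV t(3) VN(4) by blast
      then show "norm (?D (\<eta> t) (X t + s *\<^sub>R \<eta> t k) - ?D h x) \<le> e / 2"
        using S(3) by (force simp: dist_norm)
    qed
    moreover have "dist ((?g t - ?g 0) /\<^sub>R t) (?D h x) = norm (?g t - ?g 0 - t *\<^sub>R ?D h x) / \<bar>t\<bar>"
    proof -
      have "(?g t - ?g 0) /\<^sub>R t - ?D h x = (?g t - ?g 0 - t *\<^sub>R ?D h x) /\<^sub>R t"
        using t(4) by (simp add: scaleR_diff_right)
      then show ?thesis by (simp add: dist_norm divide_inverse mult.commute del: iter_dir_deriv.simps)
    qed
    ultimately have "dist ((?g t - ?g 0) /\<^sub>R t) (?D h x) \<le> e / 2"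
      using t(4) by (simp add: divide_le_eq del: iter_dir_deriv.simps)
    then show "dist ((iter_dir_deriv k f (\<eta> t) (X t + t *\<^sub>R \<eta> t k)
        - iter_dir_deriv k f (\<eta> t) (X t)) /\<^sub>R t) (?D h x) < e"
      using e by (simp del: iter_dir_deriv.simps)
  qed
qed

text \<open>First-order chain rule along a curve: if the difference quotient of \<open>X\<close>
  itself serves as the moving direction, the step from \<open>x\<close> ends exactly at
  \<open>X t\<close>.\<close>

lemma mb_smooth_on_curve_derivative:
  fixes f :: "'e::locally_convex_space \<Rightarrow> 'b::real_normed_vector"
  assumes f: "mb_smooth_on U f" "x \<in> U" and X: "((\<lambda>t. (X t - x) /\<^sub>R t) \<longlongrightarrow> d) (at 0)"
  shows "((\<lambda>t. (f (X t) - f x) /\<^sub>R t) \<longlongrightarrow> dir_deriv f x d) (at 0)"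
  using strict_iter_dir_deriv[OF f tendsto_const, of "\<lambda>t i. (X t - x) /\<^sub>R t" "\<lambda>i. d" 0] X
  by (auto elim!: Lim_transform_eventually simp: eventually_at_filter)

lemma mb_smooth_on_dir_deriv:
  assumes "mb_smooth_on U f" "x \<in> U"
  shows "has_dir_deriv f x d (dir_deriv f x d)"
  using mb_smooth_onD(2)[OF assms, of 0 "\<lambda>_. d"] by simp

text \<open>In the last slot, the step along \<open>a + b\<close> splits into a step along
  \<open>a\<close> and a step along \<open>b\<close> from the moving point
  \<open>x + t *\<^sub>R a\<close>; the second quotient converges by strict differentiability.
  Earlier slots inherit additivity by differentiating the identity, which holds on all of the open
  set \<open>U\<close>.\<close>

lemma iter_dir_deriv_add:
  fixes f :: "'e::locally_convex_space \<Rightarrow> 'b::real_normed_vector"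
  assumes f: "mb_smooth_on U f"
  shows "i < k \<Longrightarrow> x \<in> U \<Longrightarrow> iter_dir_deriv k f (h(i := a + b)) x =
    iter_dir_deriv k f (h(i := a)) x + iter_dir_deriv k f (h(i := b)) x"
proof (induction k arbitrary: x)
  case (Suc k)
  note U = mb_smooth_onD(1)[OF f]
  show ?case
  proof (cases "i = k")
    case True
    let ?F = "iter_dir_deriv k f h"
    have *: "iter_dir_deriv k f (h(k := d)) = ?F" for d
      by (rule iter_dir_deriv_cong_directions) simp
    have 1: "((\<lambda>t. (?F (x + t *\<^sub>R a) - ?F x) /\<^sub>R t) \<longlongrightarrow> iter_dir_deriv (Suc k) f (h(k := a)) x) (at 0)"
      using mb_smooth_on_has_dir_deriv[OF f Suc.prems(2), of k h a] by (simp add: has_dir_deriv_def)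
    have "((\<lambda>t. x + t *\<^sub>R a) \<longlongrightarrow> x + 0 *\<^sub>R a) (at (0::real))"
      by (intro tendsto_add tendsto_const tendsto_scaleR_lcs tendsto_ident_at)
    from strict_iter_dir_deriv[OF f Suc.prems(2) this[simplified], of "\<lambda>_. h(k := b)" "h(k := b)" k]
    have 2: "((\<lambda>t. (?F (x + t *\<^sub>R a + t *\<^sub>R b) - ?F (x + t *\<^sub>R a)) /\<^sub>R t)
        \<longlongrightarrow> iter_dir_deriv (Suc k) f (h(k := b)) x) (at 0)"
      by (simp add: * del: iter_dir_deriv.simps)
    have "has_dir_deriv ?F x (a + b)
        (iter_dir_deriv (Suc k) f (h(k := a)) x + iter_dir_deriv (Suc k) f (h(k := b)) x)"
      using tendsto_add[OF 1 2] unfolding has_dir_deriv_def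
      by (simp add: algebra_simps del: iter_dir_deriv.simps)
    from has_dir_deriv_unique[OF mb_smooth_on_has_dir_deriv[OF f Suc.prems(2)] this]
    show ?thesis unfolding True .
  next
    case False
    then have i: "i < k" using Suc.prems by simp
    have "has_dir_deriv (\<lambda>x. iter_dir_deriv k f (h(i := a)) x + iter_dir_deriv k f (h(i := b)) x) x (h k)
        (iter_dir_deriv (Suc k) f (h(i := a)) x + iter_dir_deriv (Suc k) f (h(i := b)) x)"
      using mb_smooth_onD(2)[OF f Suc.prems(2), of k "h(i := a)"] mb_smooth_onD(2)[OF f Suc.prems(2), of k "h(i := b)"] i
      by (intro has_dir_deriv_add) auto
    then have "has_dir_deriv (iter_dir_deriv k f (h(i := a + b))) x (h k)
        (iter_dir_deriv (Suc k) f (h(i := a)) x + iter_dir_deriv (Suc k) f (h(i := b)) x)"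
      by (rule has_dir_deriv_transform[OF U Suc.prems(2), rotated]) (simp add: Suc.IH[OF i] del: fun_upd_apply)
    from dir_deriv_eqI[OF this] show ?thesis using i by (simp add: fun_upd_other del: fun_upd_apply)
  qed
qed simp

lemma iter_dir_deriv_scaleR:
  fixes f :: "'e::locally_convex_space \<Rightarrow> 'b::real_normed_vector"
  assumes f: "mb_smooth_on U f"
  shows "i < k \<Longrightarrow> x \<in> U \<Longrightarrow> iter_dir_deriv k f (h(i := r *\<^sub>R a)) x = r *\<^sub>R iter_dir_deriv k f (h(i := a)) x"
proof (induction k arbitrary: x)
  case (Suc k)
  note U = mb_smooth_onD(1)[OF f]
  show ?case
  proof (cases "i = k")
    case True
    show ?thesis unfolding True
      using has_dir_deriv_unique mb_smooth_on_has_dir_deriv[OF f Suc.prems(2)]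
        has_dir_deriv_scale_direction by metis
  next
    case False
    then have i: "i < k" using Suc.prems by simp
    have "has_dir_deriv (\<lambda>x. r *\<^sub>R iter_dir_deriv k f (h(i := a)) x) x (h k)
        (r *\<^sub>R iter_dir_deriv (Suc k) f (h(i := a)) x)"
      using mb_smooth_onD(2)[OF f Suc.prems(2), of k "h(i := a)"] i
      by (intro has_dir_deriv_continuous_linear[where L = "\<lambda>y. r *\<^sub>R y"]) (auto intro!: continuous_intros linearI simp: scaleR_add_right)
    then have "has_dir_deriv (iter_dir_deriv k f (h(i := r *\<^sub>R a))) x (h k)
        (r *\<^sub>R iter_dir_deriv (Suc k) f (h(i := a)) x)"
      by (rule has_dir_deriv_transform[OF U Suc.prems(2), rotated]) (simp add: Suc.IH[OF i] del: fun_upd_apply)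
    from dir_deriv_eqI[OF this] show ?thesis using i by (simp add: fun_upd_other del: fun_upd_apply)
  qed
qed simp

lemma linear_dir_deriv:
  fixes f :: "'e::locally_convex_space \<Rightarrow> 'b::real_normed_vector"
  assumes f: "mb_smooth_on U f" "x \<in> U"
  shows "linear (dir_deriv f x)"
  using iter_dir_deriv_add[OF f(1) _ f(2), of 0 1 "\<lambda>_. 0"] iter_dir_deriv_scaleR[OF f(1) _ f(2), of 0 1 "\<lambda>_. 0"]
  by (intro linearI) auto

lemma iter_dir_deriv_diff:
  fixes f :: "'e::locally_convex_space \<Rightarrow> 'b::real_normed_vector"
  assumes f: "mb_smooth_on U f" "i < k" "x \<in> U"
  shows "iter_dir_deriv k f (h(i := a)) x - iter_dir_deriv k f (h(i := b)) x = iter_dir_deriv k f (h(i := a - b)) x"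
  using iter_dir_deriv_add[OF f, of h "a - b" b] by simp

text \<open>By multilinearity of \<open>d\<^sup>kf\<close>, replacing the directions one at a time.\<close>

lemma iter_dir_deriv_curve_derivative:
  fixes f :: "'e::locally_convex_space \<Rightarrow> 'b::real_normed_vector"
  assumes f: "mb_smooth_on U f" and x: "x \<in> U" and X: "((\<lambda>t. (X t - x) /\<^sub>R t) \<longlongrightarrow> d) (at 0)"
    and \<eta>: "\<And>i. ((\<lambda>t. (\<eta> t i - h i) /\<^sub>R t) \<longlongrightarrow> h' i) (at (0::real))"
  shows "((\<lambda>t. (iter_dir_deriv k f (\<eta> t) (X t) - iter_dir_deriv k f h x) /\<^sub>R t) \<longlongrightarrow>
     iter_dir_deriv (Suc k) f (h(k := d)) x + (\<Sum>i<k. iter_dir_deriv k f (h(i := h' i)) x)) (at 0)"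
proof -
  let ?f = "iter_dir_deriv k f"
  have \<eta>0: "((\<lambda>t. \<eta> t i) \<longlongrightarrow> h i) (at 0)" for i
    by (rule tendsto_base_of_difference_quotient[OF \<eta>])
  \<comment> \<open>Slot \<open>k\<close> is free in the k-th derivative, so it can carry the
    difference quotient of \<open>X\<close>; the strict derivative then compares the values at
    \<open>X t\<close> and at \<open>x\<close>.\<close>
  let ?\<eta> = "\<lambda>t. (\<eta> t)(k := (X t - x) /\<^sub>R t)"
  have "((\<lambda>t. ?\<eta> t i) \<longlongrightarrow> (h(k := d)) i) (at 0)" for i
    using X \<eta>0 by auto
  from strict_iter_dir_deriv[OF f x tendsto_const this, of k]
  have "((\<lambda>t. (?f (?\<eta> t) (x + t *\<^sub>R ?\<eta> t k) - ?f (?\<eta> t) x) /\<^sub>R t)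
       \<longlongrightarrow> iter_dir_deriv (Suc k) f (h(k := d)) x) (at 0)" .
  moreover have "?f (?\<eta> t) = ?f (\<eta> t)" for t
    by (rule iter_dir_deriv_cong_directions) simp
  ultimately have 1: "((\<lambda>t. (?f (\<eta> t) (X t) - ?f (\<eta> t) x) /\<^sub>R t)
       \<longlongrightarrow> iter_dir_deriv (Suc k) f (h(k := d)) x) (at 0)"
    by (auto elim!: Lim_transform_eventually simp: eventually_at_filter simp del: iter_dir_deriv.simps)
  define mix where "mix m t = (\<lambda>i. if i < m then \<eta> t i else h i)" for m t
  have 2: "((\<lambda>t. (?f (mix m t) x - ?f h x) /\<^sub>R t) \<longlongrightarrow> (\<Sum>i<m. ?f (h(i := h' i)) x)) (at 0)" if "m \<le> k" for m
    using that
  proof (induction m)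
    case 0
    then show ?case by (simp add: mix_def)
  next
    case (Suc m)
    have eq: "mix (Suc m) t = (mix m t)(m := \<eta> t m)" "mix m t = (mix m t)(m := h m)" for t
      by (auto simp: mix_def fun_eq_iff)
    have "(?f (mix (Suc m) t) x - ?f (mix m t) x) /\<^sub>R t = ?f ((mix m t)(m := (\<eta> t m - h m) /\<^sub>R t)) x" for t
    proof -
      have "?f (mix (Suc m) t) x - ?f (mix m t) x = ?f ((mix m t)(m := \<eta> t m)) x - ?f ((mix m t)(m := h m)) x"
        using eq by metis
      then show ?thesis
        using iter_dir_deriv_diff[OF f _ x, of m k "mix m t"] iter_dir_deriv_scaleR[OF f _ x, of m k "mix m t"] Suc.prems
        by simp
    qed
    moreover have "((\<lambda>t. ?f ((mix m t)(m := (\<eta> t m - h m) /\<^sub>R t)) x) \<longlongrightarrow> ?f (h(m := h' m)) x) (at 0)"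
      proof (rule tendsto_iter_dir_deriv[OF f x tendsto_const])
      show "((\<lambda>t. ((mix m t)(m := (\<eta> t m - h m) /\<^sub>R t)) i) \<longlongrightarrow> (h(m := h' m)) i) (at 0)" for i
        using \<eta>[of m] \<eta>0[of i] by (cases "i = m"; cases "i < m") (simp_all add: mix_def)
    qed
    ultimately have "((\<lambda>t. (?f (mix (Suc m) t) x - ?f (mix m t) x) /\<^sub>R t) \<longlongrightarrow> ?f (h(m := h' m)) x) (at 0)"
      by simp
    from tendsto_add[OF Suc.IH this] Suc.prems show ?case
      by (simp flip: scaleR_add_right del: fun_upd_apply)
  qed
  have "?f (mix k t) = ?f (\<eta> t)" for t
    by (rule iter_dir_deriv_cong_directions) (simp add: mix_def)
  with 2[of k] have "((\<lambda>t. (?f (\<eta> t) x - ?f h x) /\<^sub>R t) \<longlongrightarrow> (\<Sum>i<k. ?f (h(i := h' i)) x)) (at 0)"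
    by simp
  from tendsto_add[OF 1 this] show ?thesis
    by (simp flip: scaleR_add_right del: iter_dir_deriv.simps)
qed

section \<open>Differentiability of finite order, as a recursion\<close>

text \<open>
  A function of a base point and a sequence of directions, differentiated in the base point only, and
  only along entries of the same sequence. Unlike iterated tangent maps, the derivative has the same
  type, so that \<open>n\<close>-fold differentiability can be defined by recursion.
\<close>

primrec smooth_family ::
  "nat \<Rightarrow> 'e::locally_convex_space set \<Rightarrow> ('e \<Rightarrow> (nat \<Rightarrow> 'e) \<Rightarrow> 'f::locally_convex_space) \<Rightarrow> bool" where
  "smooth_family 0 U \<Phi> \<longleftrightarrow> continuous_on (U \<times> UNIV) (\<lambda>p. \<Phi> (fst p) (snd p))"
| "smooth_family (Suc n) U \<Phi> \<longleftrightarrow> continuous_on (U \<times> UNIV) (\<lambda>p. \<Phi> (fst p) (snd p)) \<and>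
     (\<forall>j. \<exists>\<Psi>. smooth_family n U \<Psi> \<and> (\<forall>h. \<forall>x\<in>U. has_dir_deriv (\<lambda>x. \<Phi> x h) x (h j) (\<Psi> x h)))"

lemma smooth_family_continuous:
  "smooth_family n U \<Phi> \<Longrightarrow> continuous_on (U \<times> UNIV) (\<lambda>p. \<Phi> (fst p) (snd p))"
  by (cases n) auto

lemma smooth_family_derivative:
  assumes "smooth_family (Suc n) U \<Phi>"
  shows "\<exists>\<Psi>. smooth_family n U \<Psi> \<and> (\<forall>h. \<forall>x\<in>U. has_dir_deriv (\<lambda>x. \<Phi> x h) x (h j) (\<Psi> x h))"
  using assms by simp

lemma smooth_family_SucI:
  assumes "continuous_on (U \<times> UNIV) (\<lambda>p. \<Phi> (fst p) (snd p))"
    and "\<And>j. \<exists>\<Psi>. smooth_family n U \<Psi> \<and> (\<forall>h. \<forall>x\<in>U. has_dir_deriv (\<lambda>x. \<Phi> x h) x (h j) (\<Psi> x h))"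
  shows "smooth_family (Suc n) U \<Phi>"
  using assms by simp

lemma smooth_family_Suc_imp: "smooth_family (Suc n) U \<Phi> \<Longrightarrow> smooth_family n U \<Phi>"
proof (induction n arbitrary: \<Phi>)
  case (Suc n)
  show ?case
  proof (rule smooth_family_SucI)
    fix j
    obtain \<Psi> where "smooth_family (Suc n) U \<Psi>" "\<And>h x. x \<in> U \<Longrightarrow> has_dir_deriv (\<lambda>x. \<Phi> x h) x (h j) (\<Psi> x h)"
      using smooth_family_derivative[OF Suc.prems, of j] by blast
    then show "\<exists>\<Psi>. smooth_family n U \<Psi> \<and> (\<forall>h. \<forall>x\<in>U. has_dir_deriv (\<lambda>x. \<Phi> x h) x (h j) (\<Psi> x h))"
      using Suc.IH by blast
  qed (rule smooth_family_continuous[OF Suc.prems])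
qed simp

lemma smooth_family_subset:
  "smooth_family n U \<Phi> \<Longrightarrow> V \<subseteq> U \<Longrightarrow> smooth_family n V \<Phi>"
proof (induction n arbitrary: \<Phi>)
  case (Suc n)
  show ?case
  proof (rule smooth_family_SucI)
    fix j
    obtain \<Psi> where "smooth_family n U \<Psi>" "\<And>h x. x \<in> U \<Longrightarrow> has_dir_deriv (\<lambda>x. \<Phi> x h) x (h j) (\<Psi> x h)"
      using smooth_family_derivative[OF Suc.prems(1), of j] by blast
    then show "\<exists>\<Psi>. smooth_family n V \<Psi> \<and> (\<forall>h. \<forall>x\<in>V. has_dir_deriv (\<lambda>x. \<Phi> x h) x (h j) (\<Psi> x h))"
      using Suc.IH Suc.prems(2) by blast
  next
    show "continuous_on (V \<times> UNIV) (\<lambda>p. \<Phi> (fst p) (snd p))"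
      by (rule continuous_on_subset[OF smooth_family_continuous[OF Suc.prems(1)]]) (use Suc.prems(2) in auto)
  qed
qed (auto elim!: continuous_on_subset)

lemma smooth_family_cong:
  assumes "open U" "\<And>x h. x \<in> U \<Longrightarrow> \<Phi> x h = \<Phi>' x h" "smooth_family n U \<Phi>"
  shows "smooth_family n U \<Phi>'"
proof -
  have c: "continuous_on (U \<times> UNIV) (\<lambda>p. \<Phi>' (fst p) (snd p))"
    using smooth_family_continuous[OF assms(3)]
    by (rule continuous_on_eq) (use assms(2) in auto)
  show ?thesis
  proof (cases n)
    case 0
    then show ?thesis using c by simp
  next
    case (Suc m)
    show ?thesis unfolding Suc
    proof (rule smooth_family_SucI[OF c])
      fix j
      obtain \<Psi> where "smooth_family m U \<Psi>" "\<And>h x. x \<in> U \<Longrightarrow> has_dir_deriv (\<lambda>x. \<Phi> x h) x (h j) (\<Psi> x h)"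
        using smooth_family_derivative[OF assms(3)[unfolded Suc], of j] by blast
      moreover from this(2) have "has_dir_deriv (\<lambda>x. \<Phi>' x h) x (h j) (\<Psi> x h)" if "x \<in> U" for h x
        using that by (intro has_dir_deriv_transform[OF assms(1) that assms(2)])
      ultimately show "\<exists>\<Psi>. smooth_family m U \<Psi> \<and> (\<forall>h. \<forall>x\<in>U. has_dir_deriv (\<lambda>x. \<Phi>' x h) x (h j) (\<Psi> x h))"
        by blast
    qed
  qed
qed

lemma smooth_family_const: "smooth_family n U (\<lambda>x h. a)"
proof (induction n arbitrary: a)
  case (Suc n)
  show ?case
  proof (rule smooth_family_SucI)
    show "\<exists>\<Psi>. smooth_family n U \<Psi> \<and> (\<forall>h. \<forall>x\<in>U. has_dir_deriv (\<lambda>x. a) x (h j) (\<Psi> x h))" for j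
      using Suc has_dir_deriv_const by blast
  qed simp
qed simp

lemma smooth_family_direction: "smooth_family n U (\<lambda>x h. h i)"
proof -
  have c: "continuous_on (U \<times> UNIV) (\<lambda>p. snd p i)"
    by (rule continuous_on_product_then_coordinatewise[OF continuous_on_snd[OF continuous_on_id]])
  show ?thesis
  proof (cases n)
    case (Suc m)
    show ?thesis unfolding Suc
      by (rule smooth_family_SucI[OF c]) (use smooth_family_const[of m U 0] has_dir_deriv_const in blast)
  qed (use c in simp)
qed

lemma smooth_family_base: "smooth_family n U (\<lambda>x h. x)"
proof (cases n)
  case (Suc m)
  show ?thesis unfolding Suc
  proof (rule smooth_family_SucI)
    show "\<exists>\<Psi>. smooth_family m U \<Psi> \<and> (\<forall>h. \<forall>x\<in>U. has_dir_deriv (\<lambda>x. x) x (h j) (\<Psi> x h))" for j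
      using smooth_family_direction[of m U j] has_dir_deriv_id by blast
  qed (intro continuous_intros)
qed (simp add: continuous_on_fst)

lemma smooth_family_add:
  "smooth_family n U \<Phi> \<Longrightarrow> smooth_family n U \<Psi> \<Longrightarrow> smooth_family n U (\<lambda>x h. \<Phi> x h + \<Psi> x h)"
proof (induction n arbitrary: \<Phi> \<Psi>)
  case 0
  then show ?case by (simp add: continuous_on_add)
next
  case (Suc n)
  show ?case
  proof (rule smooth_family_SucI)
    fix j
    obtain \<Phi>' where "smooth_family n U \<Phi>'" "\<And>h x. x \<in> U \<Longrightarrow> has_dir_deriv (\<lambda>x. \<Phi> x h) x (h j) (\<Phi>' x h)"
      using smooth_family_derivative[OF Suc.prems(1), of j] by blast
    moreover obtain \<Psi>' where "smooth_family n U \<Psi>'" "\<And>h x. x \<in> U \<Longrightarrow> has_dir_deriv (\<lambda>x. \<Psi> x h) x (h j) (\<Psi>' x h)"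
      using smooth_family_derivative[OF Suc.prems(2), of j] by blast
    ultimately show "\<exists>\<Theta>. smooth_family n U \<Theta> \<and>
        (\<forall>h. \<forall>x\<in>U. has_dir_deriv (\<lambda>x. \<Phi> x h + \<Psi> x h) x (h j) (\<Theta> x h))"
      by (intro exI[of _ "\<lambda>x h. \<Phi>' x h + \<Psi>' x h"]) (simp add: Suc.IH has_dir_deriv_add)
  qed (intro continuous_on_add smooth_family_continuous[OF Suc.prems(1)] smooth_family_continuous[OF Suc.prems(2)])
qed

lemma smooth_family_sum:
  "(\<And>i. i \<in> I \<Longrightarrow> smooth_family n U (\<Phi> i)) \<Longrightarrow> smooth_family n U (\<lambda>x h. \<Sum>i\<in>I. \<Phi> i x h)"
  by (induction I rule: infinite_finite_induct) (auto simp: smooth_family_const smooth_family_add)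

lemma smooth_family_Pair:
  "smooth_family n U \<Phi> \<Longrightarrow> smooth_family n U \<Psi> \<Longrightarrow> smooth_family n U (\<lambda>x h. (\<Phi> x h, \<Psi> x h))"
proof (induction n arbitrary: \<Phi> \<Psi>)
  case 0
  then show ?case by (simp add: continuous_on_Pair)
next
  case (Suc n)
  show ?case
  proof (rule smooth_family_SucI)
    fix j
    obtain \<Phi>' where "smooth_family n U \<Phi>'" "\<And>h x. x \<in> U \<Longrightarrow> has_dir_deriv (\<lambda>x. \<Phi> x h) x (h j) (\<Phi>' x h)"
      using smooth_family_derivative[OF Suc.prems(1), of j] by blast
    moreover obtain \<Psi>' where "smooth_family n U \<Psi>'" "\<And>h x. x \<in> U \<Longrightarrow> has_dir_deriv (\<lambda>x. \<Psi> x h) x (h j) (\<Psi>' x h)"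
      using smooth_family_derivative[OF Suc.prems(2), of j] by blast
    ultimately show "\<exists>\<Theta>. smooth_family n U \<Theta> \<and>
        (\<forall>h. \<forall>x\<in>U. has_dir_deriv (\<lambda>x. (\<Phi> x h, \<Psi> x h)) x (h j) (\<Theta> x h))"
      by (intro exI[of _ "\<lambda>x h. (\<Phi>' x h, \<Psi>' x h)"]) (simp add: Suc.IH has_dir_deriv_Pair)
  qed (intro continuous_on_Pair smooth_family_continuous[OF Suc.prems(1)] smooth_family_continuous[OF Suc.prems(2)])
qed

lemma smooth_family_continuous_linear:
  assumes L: "linear L" "continuous_on UNIV L"
  shows "smooth_family n U \<Phi> \<Longrightarrow> smooth_family n U (\<lambda>x h. L (\<Phi> x h))"
proof (induction n arbitrary: \<Phi>)
  case 0
  then show ?case using continuous_on_compose2[OF L(2)] by auto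
next
  case (Suc n)
  show ?case
  proof (rule smooth_family_SucI)
    fix j
    obtain \<Phi>' where "smooth_family n U \<Phi>'" "\<And>h x. x \<in> U \<Longrightarrow> has_dir_deriv (\<lambda>x. \<Phi> x h) x (h j) (\<Phi>' x h)"
      using smooth_family_derivative[OF Suc.prems, of j] by blast
    then show "\<exists>\<Theta>. smooth_family n U \<Theta> \<and> (\<forall>h. \<forall>x\<in>U. has_dir_deriv (\<lambda>x. L (\<Phi> x h)) x (h j) (\<Theta> x h))"
      by (intro exI[of _ "\<lambda>x h. L (\<Phi>' x h)"]) (simp add: Suc.IH has_dir_deriv_continuous_linear[OF L])
  qed (rule continuous_on_compose2[OF L(2) smooth_family_continuous[OF Suc.prems]], simp)
qed

lemma has_dir_deriv_bilinear:
  fixes f :: "'e::locally_convex_space \<Rightarrow> 'b::real_normed_vector" and g :: "'e \<Rightarrow> 'c::real_normed_vector"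
  assumes "bounded_bilinear prd" "has_dir_deriv f x h l" "has_dir_deriv g x h m"
  shows "has_dir_deriv (\<lambda>x. prd (f x) (g x)) x h (prd (f x) m + prd l (g x))"
proof -
  interpret bounded_bilinear prd by fact
  have "((\<lambda>t. f (x + t *\<^sub>R h)) \<longlongrightarrow> f x) (at 0)"
    by (rule tendsto_base_of_difference_quotient[where d = l]) (use assms(2) in \<open>simp add: has_dir_deriv_def\<close>)
  from tendsto_add[OF tendsto[OF this assms(3)[unfolded has_dir_deriv_def]]
      tendsto[OF assms(2)[unfolded has_dir_deriv_def] tendsto_const[of "g x"]]]
  show ?thesis
    unfolding has_dir_deriv_def
    by (simp add: scaleR_right scaleR_left diff_left diff_right flip: scaleR_add_right)
qed

lemma smooth_family_bilinear:
  fixes \<Phi> :: "'e::locally_convex_space \<Rightarrow> (nat \<Rightarrow> 'e) \<Rightarrow> 'b::real_normed_vector"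
    and \<Psi> :: "'e::locally_convex_space \<Rightarrow> (nat \<Rightarrow> 'e) \<Rightarrow> 'c::real_normed_vector"
  assumes prd: "bounded_bilinear prd"
  shows "smooth_family n U \<Phi> \<Longrightarrow> smooth_family n U \<Psi> \<Longrightarrow> smooth_family n U (\<lambda>x h. prd (\<Phi> x h) (\<Psi> x h))"
proof (induction n arbitrary: \<Phi> \<Psi>)
  case 0
  then show ?case by (simp add: bounded_bilinear.continuous_on[OF prd])
next
  case (Suc n)
  show ?case
  proof (rule smooth_family_SucI)
    fix j
    obtain \<Phi>' where \<Phi>': "smooth_family n U \<Phi>'" "\<And>h x. x \<in> U \<Longrightarrow> has_dir_deriv (\<lambda>x. \<Phi> x h) x (h j) (\<Phi>' x h)"
      using smooth_family_derivative[OF Suc.prems(1), of j] by blast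
    obtain \<Psi>' where \<Psi>': "smooth_family n U \<Psi>'" "\<And>h x. x \<in> U \<Longrightarrow> has_dir_deriv (\<lambda>x. \<Psi> x h) x (h j) (\<Psi>' x h)"
      using smooth_family_derivative[OF Suc.prems(2), of j] by blast
    have "smooth_family n U (\<lambda>x h. prd (\<Phi> x h) (\<Psi>' x h) + prd (\<Phi>' x h) (\<Psi> x h))"
      by (intro smooth_family_add Suc.IH \<Phi>' \<Psi>' smooth_family_Suc_imp[OF Suc.prems(1)]
          smooth_family_Suc_imp[OF Suc.prems(2)])
    then show "\<exists>\<Theta>. smooth_family n U \<Theta> \<and>
        (\<forall>h. \<forall>x\<in>U. has_dir_deriv (\<lambda>x. prd (\<Phi> x h) (\<Psi> x h)) x (h j) (\<Theta> x h))"
      by (intro exI[of _ "\<lambda>x h. prd (\<Phi> x h) (\<Psi>' x h) + prd (\<Phi>' x h) (\<Psi> x h)"] conjI allI ballI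
          has_dir_deriv_bilinear[OF prd] \<Phi>'(2) \<Psi>'(2))
  qed (intro bounded_bilinear.continuous_on[OF prd] smooth_family_continuous[OF Suc.prems(1)]
      smooth_family_continuous[OF Suc.prems(2)])
qed

lemma mb_smooth_on_iff_smooth_family:
  "mb_smooth_on U f \<longleftrightarrow> open U \<and> (\<forall>n. smooth_family n U (\<lambda>x h. f x))"
proof safe
  assume f: "mb_smooth_on U f"
  show "open U" by (rule mb_smooth_onD(1)[OF f])
  \<comment> \<open>Differentiating along \<open>h j\<close> fills slot \<open>k\<close> with entry
    \<open>j\<close> of the same sequence, so slots and entries cease to match. The relabelling
    \<open>\<sigma>\<close> records which entry sits in which slot.\<close>
  have "smooth_family n U (\<lambda>x h. iter_dir_deriv k f (\<lambda>i. h (\<sigma> i)) x)" for k \<sigma> n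
  proof (induction n arbitrary: k \<sigma>)
    case (Suc n)
    show ?case
    proof (rule smooth_family_SucI)
      fix j
      have "has_dir_deriv (iter_dir_deriv k f (\<lambda>i. h (\<sigma> i))) x (h j)
          (iter_dir_deriv (Suc k) f (\<lambda>i. h ((\<sigma>(k := j)) i)) x)" if "x \<in> U" for h x
      proof -
        have "(\<lambda>i. h ((\<sigma>(k := j)) i)) = (\<lambda>i. h (\<sigma> i))(k := h j)" by auto
        with mb_smooth_on_has_dir_deriv[OF f that, of k "\<lambda>i. h (\<sigma> i)" "h j"] show ?thesis
          by (simp del: iter_dir_deriv.simps)
      qed
      with Suc.IH[of "Suc k" "\<sigma>(k := j)"]
      show "\<exists>\<Psi>. smooth_family n U \<Psi> \<and> (\<forall>h. \<forall>x\<in>U.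
          has_dir_deriv (iter_dir_deriv k f (\<lambda>i. h (\<sigma> i))) x (h j) (\<Psi> x h))"
        by (intro exI[of _ "\<lambda>x h. iter_dir_deriv (Suc k) f (\<lambda>i. h ((\<sigma>(k := j)) i)) x"] conjI allI ballI)
    qed (rule smooth_family_continuous[OF Suc.IH])
  next
    case 0
    have "continuous_on (U \<times> UNIV) (\<lambda>p. (fst p, \<lambda>i. snd p (\<sigma> i)))"
      by (intro continuous_on_Pair continuous_intros continuous_on_coordinatewise_then_product
          continuous_on_product_then_coordinatewise)
    from continuous_on_compose2[OF mb_smooth_onD(3)[OF f, of k] this] show ?case
      by (simp add: image_subset_iff)
  qed
  from this[of _ 0 id] show "smooth_family n U (\<lambda>x h. f x)" for n by simp
next
  assume U: "open U" and f: "\<forall>n. smooth_family n U (\<lambda>x h. f x)"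
  \<comment> \<open>Each derivative costs one order, so \<open>n\<close> stays arbitrary in the
    induction on \<open>k\<close>: order \<open>Suc n\<close> for \<open>k\<close> serves order
    \<open>n\<close> for \<open>Suc k\<close>.\<close>
  have *: "\<exists>\<Psi>. smooth_family n U \<Psi> \<and> (\<forall>x\<in>U. \<forall>h. iter_dir_deriv k f h x = \<Psi> x h)" for k n
  proof (induction k arbitrary: n)
    case 0
    then show ?case using f by auto
  next
    case (Suc k)
    obtain \<Phi> where \<Phi>: "smooth_family (Suc n) U \<Phi>" "\<And>x h. x \<in> U \<Longrightarrow> iter_dir_deriv k f h x = \<Phi> x h"
      using Suc[of "Suc n"] by auto
    obtain \<Psi> where \<Psi>: "smooth_family n U \<Psi>" "\<And>h x. x \<in> U \<Longrightarrow> has_dir_deriv (\<lambda>x. \<Phi> x h) x (h k) (\<Psi> x h)"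
      using smooth_family_derivative[OF \<Phi>(1), of k] by blast
    have "has_dir_deriv (iter_dir_deriv k f h) x (h k) (\<Psi> x h)" if "x \<in> U" for x h
      by (rule has_dir_deriv_transform[OF U that _ \<Psi>(2)[OF that]]) (simp add: \<Phi>(2))
    with \<Psi>(1) show ?case
      by (intro exI[of _ \<Psi>]) (simp add: dir_deriv_eqI)
  qed
  show "mb_smooth_on U f"
    unfolding mb_smooth_on_def
  proof (intro conjI allI ballI U)
    fix k
    obtain \<Phi> where \<Phi>: "smooth_family (Suc 0) U \<Phi>" "\<And>x h. x \<in> U \<Longrightarrow> iter_dir_deriv k f h x = \<Phi> x h"
      using *[of "Suc 0" k] by blast
    have "continuous_on (U \<times> UNIV) (\<lambda>p. \<Phi> (fst p) (snd p))" by (rule smooth_family_continuous[OF \<Phi>(1)])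
    then show "continuous_on (U \<times> UNIV) (\<lambda>(x, h). iter_dir_deriv k f h x)"
      by (rule continuous_on_eq) (use \<Phi>(2) in auto)
    fix h x assume x: "x \<in> U"
    obtain \<Psi> where \<Psi>: "smooth_family 0 U \<Psi>" "\<And>h x. x \<in> U \<Longrightarrow> has_dir_deriv (\<lambda>x. \<Phi> x h) x (h k) (\<Psi> x h)"
      using smooth_family_derivative[OF \<Phi>(1), of k] by blast
    have "has_dir_deriv (iter_dir_deriv k f h) x (h k) (\<Psi> x h)"
      by (rule has_dir_deriv_transform[OF U x _ \<Psi>(2)[OF x]]) (simp add: \<Phi>(2))
    then show "\<exists>l. has_dir_deriv (iter_dir_deriv k f h) x (h k) l" ..
  qed
qed

lemma continuous_on_iter_dir_deriv_compose:
  fixes F :: "'e2::locally_convex_space \<Rightarrow> 'b::real_normed_vector"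
  assumes F: "mb_smooth_on V F"
    and "smooth_family n U g\<^sub>0" "\<And>i. smooth_family n U (g i)" "\<And>x h. x \<in> U \<Longrightarrow> g\<^sub>0 x h \<in> V"
  shows "continuous_on (U \<times> UNIV) (\<lambda>p. iter_dir_deriv k F (\<lambda>i. g i (fst p) (snd p)) (g\<^sub>0 (fst p) (snd p)))"
proof -
  have "continuous_on (U \<times> UNIV) (\<lambda>p. (g\<^sub>0 (fst p) (snd p), \<lambda>i. g i (fst p) (snd p)))"
    by (intro continuous_on_Pair continuous_on_coordinatewise_then_product
        smooth_family_continuous[OF assms(2)] smooth_family_continuous[OF assms(3)])
  from continuous_on_compose2[OF mb_smooth_onD(3)[OF F, of k] this] assms(4) show ?thesis
    by (simp add: image_subset_iff)
qed

text \<open>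
  Including all \<open>d\<^sup>kF\<close> makes the class of functions closed under differentiation: every term of the
  derivative is again of this form, with one \<open>g i\<close> replaced or one direction added.
\<close>

lemma smooth_family_compose:
  fixes F :: "'e2::locally_convex_space \<Rightarrow> 'b::real_normed_vector"
  assumes F: "mb_smooth_on V F"
  shows "smooth_family n U g\<^sub>0 \<Longrightarrow> (\<And>i. smooth_family n U (g i)) \<Longrightarrow> (\<And>x h. x \<in> U \<Longrightarrow> g\<^sub>0 x h \<in> V) \<Longrightarrow>
    smooth_family n U (\<lambda>x h. iter_dir_deriv k F (\<lambda>i. g i x h) (g\<^sub>0 x h))"
proof (induction n arbitrary: k g\<^sub>0 g)
  case (0 k g\<^sub>0 g)
  show ?case using continuous_on_iter_dir_deriv_compose[OF F 0] by simp
next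
  case (Suc n k g\<^sub>0 g)
  show ?case
  proof (rule smooth_family_SucI)
    fix j
    obtain g\<^sub>0' where g0': "smooth_family n U g\<^sub>0'" "\<And>h x. x \<in> U \<Longrightarrow> has_dir_deriv (\<lambda>x. g\<^sub>0 x h) x (h j) (g\<^sub>0' x h)"
      using smooth_family_derivative[OF Suc.prems(1), of j] by blast
    have "\<forall>i. \<exists>g'. smooth_family n U g' \<and> (\<forall>h. \<forall>x\<in>U. has_dir_deriv (\<lambda>x. g i x h) x (h j) (g' x h))"
      using Suc.prems(2) by simp
    from choice[OF this] obtain g' where g': "\<And>i. smooth_family n U (g' i)"
      "\<And>i h x. x \<in> U \<Longrightarrow> has_dir_deriv (\<lambda>x. g i x h) x (h j) (g' i x h)"
      by blast
    let ?\<Theta> = "\<lambda>x h. iter_dir_deriv (Suc k) F (\<lambda>i. (g(k := g\<^sub>0')) i x h) (g\<^sub>0 x h) +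
      (\<Sum>m<k. iter_dir_deriv k F (\<lambda>i. (g(m := g' m)) i x h) (g\<^sub>0 x h))"
    have "smooth_family n U ?\<Theta>"
      by (intro smooth_family_add smooth_family_sum Suc.IH Suc.prems(3) smooth_family_Suc_imp[OF Suc.prems(1)])
        (auto simp: g0' g' smooth_family_Suc_imp[OF Suc.prems(2)])
    moreover have "has_dir_deriv (\<lambda>x. iter_dir_deriv k F (\<lambda>i. g i x h) (g\<^sub>0 x h)) x (h j) (?\<Theta> x h)" if x: "x \<in> U" for h x
    proof -
      have "((\<lambda>t. (iter_dir_deriv k F (\<lambda>i. g i (x + t *\<^sub>R h j) h) (g\<^sub>0 (x + t *\<^sub>R h j) h)
          - iter_dir_deriv k F (\<lambda>i. g i x h) (g\<^sub>0 x h)) /\<^sub>R t) \<longlongrightarrow>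
        iter_dir_deriv (Suc k) F ((\<lambda>i. g i x h)(k := g\<^sub>0' x h)) (g\<^sub>0 x h) +
          (\<Sum>m<k. iter_dir_deriv k F ((\<lambda>i. g i x h)(m := g' m x h)) (g\<^sub>0 x h))) (at 0)"
        by (rule iter_dir_deriv_curve_derivative[OF F Suc.prems(3)[OF x]])
          (use g0'(2)[OF x] g'(2)[OF x] in \<open>auto simp: has_dir_deriv_def\<close>)
      moreover have "(\<lambda>i. g i x h)(m := a x h) = (\<lambda>i. (g(m := a)) i x h)" for m a
        by auto
      ultimately show ?thesis by (simp add: has_dir_deriv_def del: iter_dir_deriv.simps fun_upd_apply)
    qed
    ultimately show "\<exists>\<Theta>. smooth_family n U \<Theta> \<and>
        (\<forall>h. \<forall>x\<in>U. has_dir_deriv (\<lambda>x. iter_dir_deriv k F (\<lambda>i. g i x h) (g\<^sub>0 x h)) x (h j) (\<Theta> x h))"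
      by (intro exI[of _ ?\<Theta>] conjI allI ballI)
  qed (rule continuous_on_iter_dir_deriv_compose[OF F Suc.prems])
qed

lemma mb_smooth_on_local:
  assumes "\<And>x. x \<in> U \<Longrightarrow> \<exists>W. x \<in> W \<and> mb_smooth_on W f" "open U"
  shows "mb_smooth_on U f"
proof -
  define \<W> where "\<W> = {W. mb_smooth_on W f}"
  have \<W>: "open W" "mb_smooth_on W f" if "W \<in> \<W>" for W
    using that mb_smooth_onD(1) by (auto simp: \<W>_def)
  have U: "U \<subseteq> \<Union>\<W>" using assms(1) by (auto simp: \<W>_def)
  show ?thesis
    unfolding mb_smooth_on_def
  proof (intro conjI allI ballI assms(2))
    fix k
    have "continuous_on (\<Union>W\<in>\<W>. W \<times> UNIV) (\<lambda>(x, h). iter_dir_deriv k f h x)"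
      by (rule continuous_on_open_UN) (auto simp: \<W> open_Times mb_smooth_onD(3)[OF \<W>(2)])
    then show "continuous_on (U \<times> UNIV) (\<lambda>(x, h). iter_dir_deriv k f h x)"
      by (rule continuous_on_subset) (use U in auto)
    fix h x assume "x \<in> U"
    then show "\<exists>l. has_dir_deriv (iter_dir_deriv k f h) x (h k) l"
      using assms(1) mb_smooth_onD(2) by blast
  qed
qed

section \<open>Operators on a complex Hilbert space\<close>

lemma cinner_self: "cinner x x = complex_of_real ((norm x)\<^sup>2)"
proof -
  have "Im (cinner x x) = - Im (cinner x x)"
    using arg_cong[OF cinner_commute[of x x], of Im] by simp
  moreover have "Re (cinner x x) = (norm x)\<^sup>2"
  proof -
    \<comment> \<open>Positivity of the inner product comes from the norm: \<open>sqrt\<close> is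
      negative on negative reals, so a nonnegative value forces a nonnegative argument.\<close>
    have "0 \<le> sqrt (Re (cinner x x))" using norm_ge_zero[of x] norm_eq_sqrt_cinner[of x] by metis
    then show ?thesis using norm_eq_sqrt_cinner[of x] by simp
  qed
  ultimately show ?thesis by (simp add: complex_eq_iff)
qed

lemma cinner_scaleC_right: "cinner x (a *\<^sub>C y) = cnj a * cinner x y"
  using cinner_commute[of x "a *\<^sub>C y"] cinner_commute[of x y] by (simp add: cinner_scaleC_left)

lemma norm_scaleC: "norm (a *\<^sub>C x) = cmod a * norm x"
proof -
  have "complex_of_real ((norm (a *\<^sub>C x))\<^sup>2) = complex_of_real ((cmod a * norm x)\<^sup>2)"
    unfolding cinner_self[symmetric] cinner_scaleC_left cinner_scaleC_right power_mult_distrib of_real_mult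
      complex_norm_square by simp
  then have "(norm (a *\<^sub>C x))\<^sup>2 = (cmod a * norm x)\<^sup>2" by (simp only: of_real_eq_iff)
  then show ?thesis by (simp add: power2_eq_iff_nonneg)
qed

text \<open>Cauchy-Schwarz, from the nonnegative squared norm of \<open>x\<close> minus its
  orthogonal projection \<open>a *\<^sub>C y\<close> onto the line of \<open>y\<close>.\<close>

lemma norm_cinner_le: "cmod (cinner x y) \<le> norm x * norm y"
proof (cases "y = 0")
  case True
  then show ?thesis by (simp add: skew_aux)
next
  case False
  define n where "n = (norm y)\<^sup>2"
  have n: "n > 0" using False by (simp add: n_def)
  define a where "a = cinner x y / complex_of_real n"
  have ca: "cnj a = cinner y x / complex_of_real n"
    using cinner_commute[of x y] by (simp add: a_def)
  have "cinner (x - a *\<^sub>C y) (x - a *\<^sub>C y) = cinner x x - cnj a * cinner x y - a * cinner y x + a * cnj a * complex_of_real n"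
    unfolding n_def cinner_self[symmetric]
    by (simp only: skew_aux cinner_scaleC_left cinner_scaleC_right) (simp add: algebra_simps)
  also have "\<dots> = cinner x x - cinner x y * cnj (cinner x y) / complex_of_real n"
    using n by (simp add: a_def ca cinner_commute[of y x] field_simps)
  finally have "complex_of_real ((norm (x - a *\<^sub>C y))\<^sup>2) = complex_of_real ((norm x)\<^sup>2 - (cmod (cinner x y))\<^sup>2 / n)"
    by (simp add: cinner_self flip: complex_norm_square)
  then have "(norm (x - a *\<^sub>C y))\<^sup>2 = (norm x)\<^sup>2 - (cmod (cinner x y))\<^sup>2 / n"
    by (simp only: of_real_eq_iff)
  then have "(cmod (cinner x y))\<^sup>2 / n \<le> (norm x)\<^sup>2"
    by (smt (verit) zero_le_power2)
  then have "(cmod (cinner x y))\<^sup>2 \<le> (norm x * norm y)\<^sup>2"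
    using n by (simp add: n_def field_simps power_mult_distrib)
  then show ?thesis by (rule power2_le_imp_le) simp
qed

lemma bounded_bilinear_cinner: "bounded_bilinear cinner"
  by (rule bounded_bilinear.intro)
    (auto simp: cinner_add_left skew_aux scaleR_conv_of_real intro!: exI[of _ 1] norm_cinner_le)

lemma bounded_linear_scaleC: "bounded_linear (\<lambda>x. a *\<^sub>C x)"
  by (rule bounded_linear_intro[where K = "cmod a"])
    (auto simp: scaleC_add_right skew_aux norm_scaleC mult.commute)

section \<open>Operators controlled on a dense subspace\<close>

lemma closure_UNIV_induct:
  assumes "closure D = UNIV" "closed {v. P v}" "\<And>v. v \<in> D \<Longrightarrow> P v"
  shows "P v"
  using closure_minimal[of D "{v. P v}"] assms by blast

lemma norm_blinfun_le_dense:
  assumes "closure D = UNIV" "0 \<le> M" "\<And>v. v \<in> D \<Longrightarrow> norm (blinfun_apply X v) \<le> M * norm v"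
  shows "norm X \<le> M"
proof (rule norm_blinfun_bound[OF assms(2)])
  show "norm (X v) \<le> M * norm v" for v
    by (rule closure_UNIV_induct[OF assms(1) _ assms(3)]) (intro closed_Collect_le continuous_intros)
qed

text \<open>By polarization and the parallelogram law.\<close>

lemma norm_le_of_numerical_range:
  fixes L :: "'h::complex_hilbert_space \<Rightarrow> 'h"
  assumes D: "subspace D" "closure D = UNIV"
    and add: "\<And>v w. v \<in> D \<Longrightarrow> w \<in> D \<Longrightarrow> L (v + w) = L v + L w"
    and scale: "\<And>r v. v \<in> D \<Longrightarrow> L (r *\<^sub>R v) = r *\<^sub>R L v"
    and skew: "\<And>v w. v \<in> D \<Longrightarrow> w \<in> D \<Longrightarrow> cinner (L v) w = - cinner v (L w)"
    and M: "\<And>v. v \<in> D \<Longrightarrow> \<bar>Im (cinner (L v) v)\<bar> \<le> M * (norm v)\<^sup>2"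
    and v: "v \<in> D"
  shows "norm (L v) \<le> M * norm v"
proof (cases "v = 0 \<or> L v = 0")
  case True
  then show ?thesis
  proof
    assume "v = 0"
    then show ?thesis using scale[OF v, of 0] by simp
  next
    assume L: "L v = 0"
    have "0 \<le> M * (norm v)\<^sup>2" using M[OF v] by linarith
    then have "0 \<le> M * norm v" by (cases "v = 0") (auto simp: zero_le_mult_iff)
    then show ?thesis using L by simp
  qed
next
  case False
  \<comment> \<open>This is the real part of the form of the hermitian operator \<open>-i L\<close>,
    hence a symmetric real bilinear form whose quadratic form is bounded by hypothesis.\<close>
  define b where "b x y = Im (cinner (L x) y)" for x y
  have b_sym: "b y x = b x y" if "x \<in> D" "y \<in> D" for x y
    using skew[OF that(2,1)] cinner_commute[of "L x" y] by (simp add: b_def)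
  have L_diff: "L (x - y) = L x - L y" if "x \<in> D" "y \<in> D" for x y
    using add[of x "- y"] scale[of y "- 1"] that subspace_neg[OF D(1)] by simp
  have polar: "4 * b x y \<le> 2 * M * ((norm x)\<^sup>2 + (norm y)\<^sup>2)" if xy: "x \<in> D" "y \<in> D" for x y
  proof -
    have "b (x + y) (x + y) - b (x - y) (x - y) = 4 * b x y"
      using b_sym[OF xy] by (simp add: b_def add[OF xy] L_diff[OF xy] skew_aux cinner_add_left)
    moreover have "b (x + y) (x + y) \<le> M * (norm (x + y))\<^sup>2" "- b (x - y) (x - y) \<le> M * (norm (x - y))\<^sup>2"
      using M[of "x + y"] M[of "x - y"] xy D(1) by (auto simp: b_def subspace_add subspace_diff abs_le_iff)
    moreover have "(norm (x + y))\<^sup>2 + (norm (x - y))\<^sup>2 = 2 * ((norm x)\<^sup>2 + (norm y)\<^sup>2)"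
    proof -
      have "complex_of_real ((norm (x + y))\<^sup>2 + (norm (x - y))\<^sup>2) = complex_of_real (2 * ((norm x)\<^sup>2 + (norm y)\<^sup>2))"
        unfolding of_real_add of_real_mult cinner_self[symmetric] by (simp add: skew_aux cinner_add_left)
      then show ?thesis by (simp only: of_real_eq_iff)
    qed
    ultimately have "4 * b x y \<le> M * (2 * ((norm x)\<^sup>2 + (norm y)\<^sup>2))"
      by (smt (verit) distrib_left)
    then show ?thesis by (simp add: algebra_simps)
  qed
  have bound: "b v w \<le> M * norm v * norm w" if w: "w \<in> D" for w
  proof (cases "w = 0")
    case True
    then show ?thesis by (simp add: b_def skew_aux)
  next
    case w0: False
    \<comment> \<open>Rescaling \<open>w\<close> to the norm of \<open>v\<close> balances the two
      squares in \<open>polar\<close>, turning their sum into a product of norms.\<close>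
    define r where "r = norm v / norm w"
    have r: "r > 0" using False w0 by (simp add: r_def)
    have "4 * (r * b v w) \<le> 2 * M * ((norm v)\<^sup>2 + (norm v)\<^sup>2)"
      using polar[OF v subspace_scale[OF D(1) w, of r]] r w0 by (simp add: b_def skew_aux r_def)
    then have "r * b v w \<le> M * (norm v)\<^sup>2" by simp
    also have "\<dots> = r * (M * norm v * norm w)" using w0 by (simp add: r_def power2_eq_square)
    finally show ?thesis using r by simp
  qed
  \<comment> \<open>The decisive test vector \<open>-i L v\<close> may lie outside \<open>D\<close>,
    so the second argument is first freed by density. At that vector \<open>b\<close> takes the
    value \<open>(norm (L v))^2\<close>.\<close>
  have "b v w \<le> M * norm v * norm w" for w
    unfolding b_def
    by (rule closure_UNIV_induct[OF D(2) _ bound[unfolded b_def]])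
      (intro closed_Collect_le continuous_intros continuous_on_Im bounded_bilinear.continuous_on[OF bounded_bilinear_cinner])
  from this[of "(- \<i>) *\<^sub>C L v"] have "(norm (L v))\<^sup>2 \<le> M * norm v * norm (L v)"
    by (simp add: b_def cinner_scaleC_right cinner_self norm_scaleC)
  then show ?thesis using False by (simp add: power2_eq_square)
qed

lemma bounded_linear_dense_extension:
  fixes L :: "'h::real_normed_vector \<Rightarrow> 'k::banach"
  assumes D: "subspace D" "closure D = UNIV"
    and add: "\<And>v w. v \<in> D \<Longrightarrow> w \<in> D \<Longrightarrow> L (v + w) = L v + L w"
    and scale: "\<And>r v. v \<in> D \<Longrightarrow> L (r *\<^sub>R v) = r *\<^sub>R L v"
    and bound: "\<And>v. v \<in> D \<Longrightarrow> norm (L v) \<le> C * norm v"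
  shows "\<exists>B :: 'h \<Rightarrow>\<^sub>L 'k. \<forall>v\<in>D. blinfun_apply B v = L v"
proof -
  \<comment> \<open>\<open>C\<close> may be zero or negative; a positive majorant is needed as a
    divisor.\<close>
  define C' where "C' = max C 0 + 1"
  have C': "C' > 0" "C \<le> C'" by (auto simp: C'_def)
  have "uniformly_continuous_on D L"
    unfolding uniformly_continuous_on_def
  proof (intro allI impI)
    fix e :: real assume e: "e > 0"
    have "dist (L w) (L v) < e" if "v \<in> D" "w \<in> D" "dist w v < e / C'" for v w
    proof -
      have "L (w - v) = L w - L v"
        using add[of w "- v"] scale[of v "- 1"] that subspace_neg[OF D(1)] by simp
      then have "dist (L w) (L v) \<le> C * norm (w - v)"
        using bound[of "w - v"] that D(1) by (simp add: dist_norm subspace_diff)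
      also have "\<dots> \<le> C' * norm (w - v)" using C' by (intro mult_right_mono) auto
      also have "\<dots> < e" using that(3) C' by (simp add: dist_norm field_simps)
      finally show ?thesis .
    qed
    then show "\<exists>d>0. \<forall>v\<in>D. \<forall>w\<in>D. dist w v < d \<longrightarrow> dist (L w) (L v) < e"
      using e C' by (intro exI[of _ "e / C'"]) auto
  qed
  from uniformly_continuous_on_extension_on_closure[OF this] obtain g
    where "uniformly_continuous_on (closure D) g" and g: "\<And>x. x \<in> D \<Longrightarrow> L x = g x"
    by metis
  then have c: "continuous_on UNIV g"
    using D(2) uniformly_continuous_imp_continuous by metis
  have cc: "continuous_on UNIV (\<lambda>v. g (f v))" if "continuous_on UNIV f" for f :: "'h \<Rightarrow> 'h"
    using continuous_on_compose2[OF c that] by auto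
  \<comment> \<open>Additivity is extended one variable at a time, since density is available
    separately in each argument.\<close>
  have g1: "g (v + w) = g v + g w" if "v \<in> D" for v w
    by (rule closure_UNIV_induct[OF D(2), where v = w])
      (auto intro!: closed_Collect_eq continuous_intros cc c simp: g[symmetric] add that subspace_add[OF D(1)])
  have g2: "g (v + w) = g v + g w" for v w
    by (rule closure_UNIV_induct[OF D(2), where v = v])
      (auto intro!: closed_Collect_eq continuous_intros cc c simp: g1)
  have g3: "g (r *\<^sub>R v) = r *\<^sub>R g v" for r v
    by (rule closure_UNIV_induct[OF D(2), where v = v])
      (auto intro!: closed_Collect_eq continuous_intros cc c simp: g[symmetric] scale subspace_scale[OF D(1)])
  have g4: "norm (g v) \<le> norm v * C'" for v
  proof (rule closure_UNIV_induct[OF D(2), where v = v])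
    show "closed {v. norm (g v) \<le> norm v * C'}"
      by (intro closed_Collect_le continuous_intros c)
    fix v assume "v \<in> D"
    then have "norm (g v) \<le> C * norm v" using bound g by metis
    also have "\<dots> \<le> C' * norm v" using C' by (intro mult_right_mono) auto
    finally show "norm (g v) \<le> norm v * C'" by (simp add: mult.commute)
  qed
  have "bounded_linear g"
    by (rule bounded_linear_intro[OF g2 g3 g4])
  then show ?thesis
    by (intro exI[of _ "Blinfun g"]) (simp add: bounded_linear_Blinfun_apply g)
qed

text \<open>With no norm on the source, scaling replaces the operator norm: \<open>y - x\<close> in
  \<open>r U\<close> forces \<open>norm (L y - L x) \<le> M * r\<close>.\<close>

lemma linear_continuous_of_bounded_nhd:
  fixes L :: "'e::locally_convex_space \<Rightarrow> 'b::real_normed_vector"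
  assumes L: "linear L" and U: "open U" "0 \<in> U" and M: "\<And>x. x \<in> U \<Longrightarrow> norm (L x) \<le> M"
  shows "continuous_on UNIV L"
  unfolding continuous_on_def
proof (intro ballI tendstoI)
  fix x :: 'e and e :: real assume e: "e > 0"
  define r where "r = e / (\<bar>M\<bar> + 1)"
  have r: "r > 0" using e by (simp add: r_def)
  have "((\<lambda>y. (1 / r) *\<^sub>R (y - x)) \<longlongrightarrow> (1 / r) *\<^sub>R (x - x)) (at x)"
    by (intro tendsto_scaleR_lcs tendsto_diff tendsto_const tendsto_ident_at)
  then have "eventually (\<lambda>y. (1 / r) *\<^sub>R (y - x) \<in> U) (at x)"
    using U by (auto dest: topological_tendstoD)
  then show "eventually (\<lambda>y. dist (L y) (L x) < e) (at x)"
  proof eventually_elim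
    fix y assume "(1 / r) *\<^sub>R (y - x) \<in> U"
    then have "norm ((1 / r) *\<^sub>R (L y - L x)) \<le> M"
      using M[of "(1 / r) *\<^sub>R (y - x)"] by (simp only: linear_diff[OF L] linear_scale[OF L])
    then have "norm (L y - L x) \<le> M * r"
      unfolding norm_scaleR using r by (simp add: divide_le_eq)
    also have "\<dots> \<le> \<bar>M\<bar> * r" using r by (intro mult_right_mono) auto
    also have "\<dots> < e" using e by (simp add: r_def field_simps)
    finally show "dist (L y) (L x) < e" by (simp add: dist_norm)
  qed
qed

section \<open>Unitary operators and operator inversion\<close>

lemma unitary_opD:
  assumes "unitary_op u"
  shows "blinfun_apply u (a *\<^sub>C v) = a *\<^sub>C blinfun_apply u v"
    "cinner (blinfun_apply u v) (blinfun_apply u w) = cinner v w"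
    "norm (blinfun_apply u v) = norm v" "norm u \<le> 1"
proof -
  show "blinfun_apply u (a *\<^sub>C v) = a *\<^sub>C blinfun_apply u v"
    "cinner (blinfun_apply u v) (blinfun_apply u w) = cinner v w" for w
    using assms by (auto simp: unitary_op_def complex_linear_def)
  then show n: "norm (blinfun_apply u v) = norm v" for v
    using norm_eq_sqrt_cinner assms by (metis unitary_op_def)
  show "norm u \<le> 1"
    by (rule norm_blinfun_bound) (simp_all add: n)
qed

lemma blinfun_compose_simps:
  "(a + b) o\<^sub>L c = (a o\<^sub>L c) + (b o\<^sub>L c)" "a o\<^sub>L (b + c) = (a o\<^sub>L b) + (a o\<^sub>L c)"
  "(a - b) o\<^sub>L c = (a o\<^sub>L c) - (b o\<^sub>L c)" "a o\<^sub>L (b - c) = (a o\<^sub>L b) - (a o\<^sub>L c)"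
  "(r *\<^sub>R a) o\<^sub>L c = r *\<^sub>R (a o\<^sub>L c)" "a o\<^sub>L (r *\<^sub>R c) = r *\<^sub>R (a o\<^sub>L c)"
  "(- a) o\<^sub>L c = - (a o\<^sub>L c)" "a o\<^sub>L (- c) = - (a o\<^sub>L c)"
  "a o\<^sub>L id_blinfun = a" "id_blinfun o\<^sub>L c = c" "(a o\<^sub>L b) o\<^sub>L d = a o\<^sub>L (b o\<^sub>L d)"
  by (auto intro!: blinfun_eqI simp: blinfun.bilinear_simps)

lemma inverse_op_eqI:
  assumes "X o\<^sub>L Y = id_blinfun" "Y o\<^sub>L X = id_blinfun"
  shows "inverse_op X = Y"
  unfolding inverse_op_def
proof (rule the_equality)
  show "X o\<^sub>L Y = id_blinfun \<and> Y o\<^sub>L X = id_blinfun" using assms ..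
  show "Z = Y" if "X o\<^sub>L Z = id_blinfun \<and> Z o\<^sub>L X = id_blinfun" for Z
    using that assms by (metis blinfun_compose_simps(9-11))
qed

lemma inverse_op:
  assumes "invertible_op X"
  shows "X o\<^sub>L inverse_op X = id_blinfun" "inverse_op X o\<^sub>L X = id_blinfun"
proof -
  obtain Y where Y: "X o\<^sub>L Y = id_blinfun" "Y o\<^sub>L X = id_blinfun"
    using assms by (auto simp: invertible_op_def)
  from inverse_op_eqI[OF this] Y show "X o\<^sub>L inverse_op X = id_blinfun" "inverse_op X o\<^sub>L X = id_blinfun"
    by simp_all
qed

text \<open>The inverse of a small perturbation \<open>X'\<close> of \<open>X\<close> is a fixed point of the contraction
  \<open>Y \<mapsto> X\<^sup>-\<^sup>1 + X\<^sup>-\<^sup>1 (X - X') Y\<close>.\<close>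

lemma invertible_op_perturbation:
  fixes X X' :: "'h::banach \<Rightarrow>\<^sub>L 'h"
  assumes X: "invertible_op X" and small: "norm (inverse_op X) * norm (X - X') \<le> 1 / 2"
  shows "invertible_op X'"
proof -
  let ?R = "inverse_op X"
  note R = inverse_op[OF X]
  let ?E = "X - X'"
  have "\<exists>!Y. ?R + (?R o\<^sub>L (?E o\<^sub>L Y)) = Y"
  proof (rule banach_fix_type[of "1/2"])
    show "\<forall>Y Z. dist (?R + (?R o\<^sub>L (?E o\<^sub>L Y))) (?R + (?R o\<^sub>L (?E o\<^sub>L Z))) \<le> 1 / 2 * dist Y Z"
    proof (intro allI)
      fix Y Z
      have "dist (?R + (?R o\<^sub>L (?E o\<^sub>L Y))) (?R + (?R o\<^sub>L (?E o\<^sub>L Z))) = norm (?R o\<^sub>L (?E o\<^sub>L (Y - Z)))"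
        by (simp add: dist_norm blinfun_compose_simps(4))
      also have "\<dots> \<le> norm ?R * (norm ?E * norm (Y - Z))"
        by (intro order_trans[OF norm_blinfun_compose] mult_left_mono norm_blinfun_compose) auto
      also have "\<dots> \<le> 1 / 2 * norm (Y - Z)"
        using mult_right_mono[OF small norm_ge_zero[of "Y - Z"]] by (simp add: mult.assoc)
      finally show "dist (?R + (?R o\<^sub>L (?E o\<^sub>L Y))) (?R + (?R o\<^sub>L (?E o\<^sub>L Z))) \<le> 1 / 2 * dist Y Z"
        by (simp add: dist_norm)
    qed
  qed auto
  then obtain Y where Y: "?R + (?R o\<^sub>L (?E o\<^sub>L Y)) = Y" by metis
  have "X o\<^sub>L Y = X o\<^sub>L (?R + (?R o\<^sub>L (?E o\<^sub>L Y)))" using Y by simp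
  also have "\<dots> = id_blinfun + (X o\<^sub>L Y) - (X' o\<^sub>L Y)"
    using R(1) by (simp add: blinfun_compose_simps(2,3,10) blinfun_compose_simps(11)[symmetric])
  finally have XY: "X' o\<^sub>L Y = id_blinfun" by (simp add: algebra_simps)
  \<comment> \<open>The first fixed point is only a right inverse, which need not be two-sided in
    infinite dimension. The mirrored equation yields a left inverse, and the two then
    coincide.\<close>
  have "\<exists>!Y. ?R + ((Y o\<^sub>L ?E) o\<^sub>L ?R) = Y"
  proof (rule banach_fix_type[of "1/2"])
    show "\<forall>Y Z. dist (?R + ((Y o\<^sub>L ?E) o\<^sub>L ?R)) (?R + ((Z o\<^sub>L ?E) o\<^sub>L ?R)) \<le> 1 / 2 * dist Y Z"
    proof (intro allI)
      fix Y Z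
      have "dist (?R + ((Y o\<^sub>L ?E) o\<^sub>L ?R)) (?R + ((Z o\<^sub>L ?E) o\<^sub>L ?R)) = norm (((Y - Z) o\<^sub>L ?E) o\<^sub>L ?R)"
        by (simp add: dist_norm blinfun_compose_simps(3))
      also have "\<dots> \<le> (norm (Y - Z) * norm ?E) * norm ?R"
        by (intro order_trans[OF norm_blinfun_compose] mult_right_mono norm_blinfun_compose) auto
      also have "\<dots> \<le> 1 / 2 * norm (Y - Z)"
        using mult_right_mono[OF small norm_ge_zero[of "Y - Z"]] by (simp add: mult_ac)
      finally show "dist (?R + ((Y o\<^sub>L ?E) o\<^sub>L ?R)) (?R + ((Z o\<^sub>L ?E) o\<^sub>L ?R)) \<le> 1 / 2 * dist Y Z"
        by (simp add: dist_norm)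
    qed
  qed auto
  then obtain Z where Z: "?R + ((Z o\<^sub>L ?E) o\<^sub>L ?R) = Z" by metis
  have "Z o\<^sub>L X = (?R + ((Z o\<^sub>L ?E) o\<^sub>L ?R)) o\<^sub>L X" using Z by simp
  also have "\<dots> = id_blinfun + (Z o\<^sub>L X) - (Z o\<^sub>L X')"
    using R(2) by (simp add: blinfun_compose_simps)
  finally have ZX: "Z o\<^sub>L X' = id_blinfun" by (simp add: algebra_simps)
  have "Y = Z" using XY ZX by (metis blinfun_compose_simps(9-11))
  then show ?thesis using XY ZX by (auto simp: invertible_op_def)
qed

text \<open>The resolvent identity; it gives both the continuity of inversion and its
  derivative.\<close>

lemma inverse_op_diff:
  assumes "invertible_op X" "invertible_op X'"
  shows "inverse_op X' - inverse_op X = - (inverse_op X' o\<^sub>L ((X' - X) o\<^sub>L inverse_op X))"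
proof -
  have "inverse_op X' o\<^sub>L (X' o\<^sub>L inverse_op X) = inverse_op X"
    using inverse_op(2)[OF assms(2)] by (simp add: blinfun_compose_simps(10) blinfun_compose_simps(11)[symmetric])
  then show ?thesis
    using inverse_op(1)[OF assms(1)] by (simp add: blinfun_compose_simps(3,4,9))
qed

lemma tendsto_inverse_op:
  fixes X :: "'h::banach \<Rightarrow>\<^sub>L 'h"
  assumes "(f \<longlongrightarrow> X) F" "invertible_op X"
  shows "eventually (\<lambda>t. invertible_op (f t)) F" "((\<lambda>t. inverse_op (f t)) \<longlongrightarrow> inverse_op X) F"
proof -
  let ?R = "inverse_op X"
  have 0: "((\<lambda>t. norm ?R * norm (X - f t)) \<longlongrightarrow> norm ?R * norm (X - X)) F"
    by (intro tendsto_intros assms(1))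
  then have "eventually (\<lambda>t. norm ?R * norm (X - f t) < 1 / 2) F"
    by (rule order_tendstoD) simp
  then have small: "eventually (\<lambda>t. norm ?R * norm (X - f t) \<le> 1 / 2) F"
    by eventually_elim simp
  then show inv: "eventually (\<lambda>t. invertible_op (f t)) F"
    by eventually_elim (rule invertible_op_perturbation[OF assms(2)])
  have "eventually (\<lambda>t. norm (inverse_op (f t) - ?R) \<le> 2 * norm ?R * (norm ?R * norm (X - f t))) F"
    using small inv
  proof eventually_elim
    fix t assume s: "norm ?R * norm (X - f t) \<le> 1 / 2" and i: "invertible_op (f t)"
    let ?R' = "inverse_op (f t)"
    let ?m = "norm ?R * norm (X - f t)"
    have le: "norm (?R' - ?R) \<le> norm ?R' * ?m"
    proof -
      have "norm (?R' - ?R) = norm (?R' o\<^sub>L ((f t - X) o\<^sub>L ?R))"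
        unfolding inverse_op_diff[OF assms(2) i] by simp
      also have "\<dots> \<le> norm ?R' * (norm (f t - X) * norm ?R)"
        by (intro order_trans[OF norm_blinfun_compose] mult_left_mono norm_blinfun_compose) auto
      finally show ?thesis by (simp add: norm_minus_commute mult_ac)
    qed
    \<comment> \<open>The factor 1/2 lets the term with \<open>norm ?R'\<close> be absorbed on the
      left, so the inverses stay bounded near \<open>X\<close>; the resolvent identity then gives
      convergence.\<close>
    have "norm ?R' \<le> norm ?R + norm (?R' - ?R)"
      using norm_triangle_sub by blast
    also have "\<dots> \<le> norm ?R + norm ?R' * (1 / 2)"
      using le mult_left_mono[OF s norm_ge_zero[of ?R']] by linarith
    finally have "norm ?R' \<le> 2 * norm ?R" by simp
    from order_trans[OF le mult_right_mono[OF this]] show "norm (?R' - ?R) \<le> 2 * norm ?R * ?m"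
      by simp
  qed
  moreover have "((\<lambda>t. 2 * norm ?R * (norm ?R * norm (X - f t))) \<longlongrightarrow> 0) F"
    using tendsto_mult_left[OF 0, of "2 * norm ?R"] by simp
  ultimately have "((\<lambda>t. inverse_op (f t) - ?R) \<longlongrightarrow> 0) F"
    by (rule Lim_null_comparison)
  then show "((\<lambda>t. inverse_op (f t)) \<longlongrightarrow> ?R) F"
    by (simp add: LIM_zero_iff)
qed

text \<open>The derivative of the inverse \<open>R\<close> of \<open>\<Phi>\<close> is
  \<open>- R \<Phi>' R\<close>, again built from \<open>R\<close>. So n-fold differentiability of
  \<open>R\<close>, together with that of \<open>\<Phi>'\<close>, yields one order more.\<close>

lemma smooth_family_inverse_op:
  fixes \<Phi> :: "'e::locally_convex_space \<Rightarrow> (nat \<Rightarrow> 'e) \<Rightarrow> ('h::banach \<Rightarrow>\<^sub>L 'h)"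
  assumes U: "open U" and inv: "\<And>x h. x \<in> U \<Longrightarrow> invertible_op (\<Phi> x h)"
  shows "smooth_family n U \<Phi> \<Longrightarrow> smooth_family n U (\<lambda>x h. inverse_op (\<Phi> x h))"
proof (induction n)
  have cont: "continuous_on (U \<times> UNIV) (\<lambda>p. inverse_op (\<Phi> (fst p) (snd p)))" if "smooth_family n U \<Phi>" for n
    using smooth_family_continuous[OF that] inv
    by (auto simp: continuous_on_def intro!: tendsto_inverse_op(2))
  {
    case 0
    show ?case using cont[OF 0] by simp
  next
    case (Suc n)
    let ?R = "\<lambda>x h. inverse_op (\<Phi> x h)"
    show ?case
    proof (rule smooth_family_SucI)
      fix j
      obtain \<Phi>' where \<Phi>': "smooth_family n U \<Phi>'" "\<And>h x. x \<in> U \<Longrightarrow> has_dir_deriv (\<lambda>x. \<Phi> x h) x (h j) (\<Phi>' x h)"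
        using smooth_family_derivative[OF Suc.prems, of j] by blast
      let ?R' = "\<lambda>x h. - (?R x h o\<^sub>L (\<Phi>' x h o\<^sub>L ?R x h))"
      have R: "smooth_family n U ?R"
        by (rule Suc.IH[OF smooth_family_Suc_imp[OF Suc.prems]])
      have "smooth_family n U ?R'"
        by (rule smooth_family_continuous_linear[where L = uminus])
          (auto intro!: continuous_intros linearI smooth_family_bilinear[OF bounded_bilinear_blinfun_compose] R \<Phi>')
      moreover have "has_dir_deriv (\<lambda>x. ?R x h) x (h j) (?R' x h)" if x: "x \<in> U" for x h
      proof -
        note d = \<Phi>'(2)[OF x, of h, unfolded has_dir_deriv_def]
        have "((\<lambda>t. \<Phi> (x + t *\<^sub>R h j) h) \<longlongrightarrow> \<Phi> x h) (at 0)"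
          by (rule tendsto_base_of_difference_quotient[OF d])
        then have "((\<lambda>t. ?R (x + t *\<^sub>R h j) h) \<longlongrightarrow> ?R x h) (at 0)"
          by (rule tendsto_inverse_op(2)[OF _ inv[OF x]])
        from tendsto_minus[OF bounded_bilinear.tendsto[OF bounded_bilinear_blinfun_compose this
              bounded_bilinear.tendsto[OF bounded_bilinear_blinfun_compose d tendsto_const[of "?R x h"]]]]
        show ?thesis
          unfolding has_dir_deriv_def
        proof (rule Lim_transform_eventually)
          show "eventually (\<lambda>t. - (?R (x + t *\<^sub>R h j) h o\<^sub>L ((\<Phi> (x + t *\<^sub>R h j) h - \<Phi> x h) /\<^sub>R t o\<^sub>L ?R x h))
            = (?R (x + t *\<^sub>R h j) h - ?R x h) /\<^sub>R t) (at 0)"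
            using eventually_line_in_open[OF U x, of "h j"]
            by eventually_elim (simp add: inverse_op_diff[OF inv[OF x] inv] blinfun_compose_simps(5,6))
        qed
      qed
      ultimately show "\<exists>\<Psi>. smooth_family n U \<Psi> \<and> (\<forall>h. \<forall>x\<in>U. has_dir_deriv (\<lambda>x. ?R x h) x (h j) (\<Psi> x h))"
        by (intro exI[of _ ?R'] conjI allI ballI)
    qed (rule cont[OF Suc.prems])
  }
qed

section \<open>Cayley charts\<close>

lemma Cayley_skew:
  assumes u: "unitary_op u" and g: "unitary_op g" and inv: "invertible_op (u + g)"
  defines "X \<equiv> inverse_op (u + g) o\<^sub>L (u - g)"
  shows "complex_linear X" "cinner (blinfun_apply X v) w = - cinner v (blinfun_apply X w)"
    "(u + g) o\<^sub>L X = u - g"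
proof -
  show eq: "(u + g) o\<^sub>L X = u - g"
    using inverse_op(1)[OF inv] by (simp add: X_def blinfun_compose_simps(10) blinfun_compose_simps(11)[symmetric])
  have eq': "u (X v) + g (X v) = u v - g v" for v
    using arg_cong[OF eq, of "\<lambda>Z. blinfun_apply Z v"] by (simp add: blinfun.bilinear_simps)
  \<comment> \<open>\<open>inverse_op\<close> is an inverse among real-linear operators, so complex
    linearity of \<open>X\<close> is not automatic. It follows by cancelling the injective,
    complex-linear \<open>u + g\<close>.\<close>
  have inj: "v = w" if "u v + g v = u w + g w" for v w
  proof -
    have "(u + g) v = (u + g) w" using that by (simp add: blinfun.bilinear_simps)
    then have "(inverse_op (u + g) o\<^sub>L (u + g)) v = (inverse_op (u + g) o\<^sub>L (u + g)) w" by simp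
    then show ?thesis using inverse_op(2)[OF inv] by simp
  qed
  show "complex_linear X"
    unfolding complex_linear_def
  proof (intro allI)
    fix a v
    have "u (X (a *\<^sub>C v)) + g (X (a *\<^sub>C v)) = a *\<^sub>C (u v - g v)"
      by (simp add: eq' unitary_opD(1)[OF u] unitary_opD(1)[OF g] skew_aux)
    also have "\<dots> = u (a *\<^sub>C X v) + g (a *\<^sub>C X v)"
      by (simp add: unitary_opD(1)[OF u] unitary_opD(1)[OF g] flip: eq' scaleC_add_right)
    finally show "X (a *\<^sub>C v) = a *\<^sub>C X v" by (rule inj)
  qed
  show "cinner (X v) w = - cinner v (X w)"
  proof -
    \<comment> \<open>Both \<open>u\<close> and \<open>g\<close> preserve inner products, so the
      vectors \<open>z - X z\<close> and \<open>z + X z\<close> have the same mutual inner products;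
      comparing the cross terms gives skewness.\<close>
    have *: "u (z - X z) = g (z + X z)" for z
      using eq'[of z] by (simp add: blinfun.bilinear_simps algebra_simps)
    have "cinner (v - X v) (w - X w) = cinner (u (v - X v)) (u (w - X w))"
      by (simp add: unitary_opD(2)[OF u])
    also have "\<dots> = cinner (v + X v) (w + X w)"
      unfolding * by (simp add: unitary_opD(2)[OF g])
    finally have "2 * (cinner (X v) w + cinner v (X w)) = 0"
      by (simp add: skew_aux cinner_add_left algebra_simps)
    then have "cinner (X v) w + cinner v (X w) = 0" unfolding mult_eq_0_iff by simp
    then show ?thesis by (simp only: eq_neg_iff_add_eq_0)
  qed
qed

lemma skew_apply_Skew_Cayley:
  assumes "unitary_op u" "unitary_op g" "invertible_op (u + g)"
  shows "skew_apply (Skew (inverse_op (u + g) o\<^sub>L (u - g))) = inverse_op (u + g) o\<^sub>L (u - g)"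
  using Cayley_skew[OF assms] by (intro Skew_inverse) auto

section \<open>Skew-hermitian operators as a closed subspace\<close>

lemma bounded_linear_skew_apply: "bounded_linear skew_apply"
  by (rule bounded_linear_intro[where K = 1])
    (auto simp: plus_skew_op.rep_eq scaleR_skew_op.rep_eq norm_skew_op.rep_eq)

text \<open>Closedness keeps limits of difference quotients skew-hermitian, so that a derivative
  computed among all operators can be pulled back through \<open>skew_apply\<close>.\<close>

lemma closed_range_skew_apply: "closed (range (skew_apply :: 'h::complex_hilbert_space skew_op \<Rightarrow> _))"
proof -
  have "range (skew_apply :: 'h skew_op \<Rightarrow> _) = {X. complex_linear X \<and> (\<forall>v w. cinner (blinfun_apply X v) w = - cinner v (blinfun_apply X w))}"
    by (rule type_definition.Rep_range[OF type_definition_skew_op])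
  also have "\<dots> = (\<Inter>a. \<Inter>v. {X. blinfun_apply X (a *\<^sub>C v) = a *\<^sub>C blinfun_apply X v}) \<inter>
      (\<Inter>v. \<Inter>w. {X. cinner (blinfun_apply X v) w = - cinner v (blinfun_apply X w)})"
    by (auto simp: complex_linear_def)
  also have "closed \<dots>"
    by (intro closed_Int closed_INT ballI closed_Collect_eq continuous_intros
        bounded_linear.continuous_on[OF bounded_linear_scaleC]
        bounded_bilinear.continuous_on[OF bounded_bilinear_cinner])
  finally show ?thesis .
qed

lemma smooth_family_skew_op:
  fixes X :: "'e::locally_convex_space \<Rightarrow> (nat \<Rightarrow> 'e) \<Rightarrow> 'h::complex_hilbert_space skew_op"
  assumes U: "open U"
  shows "smooth_family n U (\<lambda>x h. skew_apply (X x h)) \<Longrightarrow> smooth_family n U X"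
proof (induction n arbitrary: X)
  have dist: "dist A B = dist (skew_apply A) (skew_apply B)" for A B :: "'h skew_op"
    by (simp add: dist_norm norm_skew_op.rep_eq minus_skew_op.rep_eq)
  have limR: "(f \<longlongrightarrow> A) F \<longleftrightarrow> ((\<lambda>t. skew_apply (f t)) \<longlongrightarrow> skew_apply A) F" for f and A :: "'h skew_op" and F :: "real filter"
    by (simp add: tendsto_iff dist)
  have cont: "continuous_on (U \<times> UNIV) (\<lambda>p. X (fst p) (snd p))"
    if "smooth_family n U (\<lambda>x h. skew_apply (X x h))" for n and X :: "'e \<Rightarrow> (nat \<Rightarrow> 'e) \<Rightarrow> 'h skew_op"
    using smooth_family_continuous[OF that] by (simp add: continuous_on_def tendsto_iff dist)
  {
    case 0
    show ?case using cont[OF 0] by simp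
  next
    case (Suc n)
    show ?case
    proof (rule smooth_family_SucI)
      fix j
      obtain \<Psi> where \<Psi>: "smooth_family n U \<Psi>" "\<And>h x. x \<in> U \<Longrightarrow> has_dir_deriv (\<lambda>x. skew_apply (X x h)) x (h j) (\<Psi> x h)"
        using smooth_family_derivative[OF Suc.prems, of j] by blast
      \<comment> \<open>The preimage is meaningful only for \<open>x\<close> in \<open>U\<close>,
        where \<open>\<Psi> x h\<close> is a limit of skew-hermitian quotients; elsewhere
        \<open>Y\<close> is arbitrary.\<close>
      define Y where "Y x h = Hilbert_Choice.inv skew_apply (\<Psi> x h)" for x h
      have quot: "(skew_apply A - skew_apply B) /\<^sub>R t = skew_apply ((A - B) /\<^sub>R t)" for A B :: "'h skew_op" and t
        by (simp add: scaleR_skew_op.rep_eq minus_skew_op.rep_eq)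
      have Y: "skew_apply (Y x h) = \<Psi> x h" if x: "x \<in> U" for x h
      proof -
        have "\<Psi> x h \<in> range skew_apply"
          using \<Psi>(2)[OF x, unfolded has_dir_deriv_def]
          by (rule Lim_in_closed_set[OF closed_range_skew_apply, rotated 2]) (auto simp: quot)
        then show ?thesis by (simp add: Y_def f_inv_into_f)
      qed
      have "smooth_family n U (\<lambda>x h. skew_apply (Y x h))"
        by (rule smooth_family_cong[OF U _ \<Psi>(1)]) (simp add: Y)
      then have "smooth_family n U Y" by (rule Suc.IH)
      moreover have "has_dir_deriv (\<lambda>x. X x h) x (h j) (Y x h)" if "x \<in> U" for x h
        using \<Psi>(2)[OF that, of h] by (simp add: has_dir_deriv_def quot limR Y[OF that])
      ultimately show "\<exists>\<Psi>. smooth_family n U \<Psi> \<and> (\<forall>h. \<forall>x\<in>U. has_dir_deriv (\<lambda>x. X x h) x (h j) (\<Psi> x h))"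
        by (intro exI[of _ Y] conjI allI ballI)
    qed (rule cont[OF Suc.prems])
  }
qed

section \<open>Charts\<close>

lemma chart_inv_map:
  assumes "is_chart T c" "p \<in> chart_dom c"
  shows "chart_inv c (chart_map c p) = p"
proof -
  have "inj_on (chart_map c) (chart_dom c)"
  proof -
    have "homeomorphic_map (subtopology T (chart_dom c)) (top_of_set (chart_map c ` chart_dom c)) (chart_map c)"
      and "openin T (chart_dom c)"
      using assms(1) by (auto simp: is_chart_def)
    then show ?thesis
      by (metis homeomorphic_imp_injective_map topspace_subtopology_subset openin_subset)
  qed
  then show ?thesis using assms(2) by (simp add: chart_inv_def inv_into_f_f)
qed

lemma openin_chart_preimage:
  assumes c: "is_chart T c" and W: "open W"
  shows "openin T {p \<in> chart_dom c. chart_map c p \<in> W}"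
proof -
  have dom: "openin T (chart_dom c)" and sub: "chart_dom c \<subseteq> topspace T"
    using c openin_subset by (auto simp: is_chart_def)
  have "continuous_map (subtopology T (chart_dom c)) (top_of_set (chart_map c ` chart_dom c)) (chart_map c)"
    using c homeomorphic_imp_continuous_map by (auto simp: is_chart_def)
  then have "continuous_map (subtopology T (chart_dom c)) euclidean (chart_map c)"
    by (simp add: continuous_map_in_subtopology)
  from openin_continuous_map_preimage[OF this, of W] W
  have "openin (subtopology T (chart_dom c)) {p \<in> chart_dom c. chart_map c p \<in> W}"
    using sub by (simp add: Int_absorb1)
  then show ?thesis by (rule openin_trans_full[OF _ dom])
qed

lemma open_chart_image:
  assumes c: "is_chart T c" and P: "openin T P" "P \<subseteq> chart_dom c"
  shows "open (chart_map c ` P)"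
proof -
  have hom: "homeomorphic_map (subtopology T (chart_dom c)) (top_of_set (chart_map c ` chart_dom c)) (chart_map c)"
    and o: "open (chart_map c ` chart_dom c)"
    using c by (auto simp: is_chart_def)
  have "openin (subtopology T (chart_dom c)) P"
    unfolding openin_subtopology using P by (intro exI[of _ P]) auto
  with homeomorphic_imp_open_map[OF hom]
  have "openin (top_of_set (chart_map c ` chart_dom c)) (chart_map c ` P)"
    unfolding open_map_def by blast
  then show ?thesis using o by (simp add: openin_open_eq)
qed

section \<open>The derived representation\<close>

locale smooth_representation = lie_group G T A
  for G :: "('g, 'b) monoid_scheme" (structure) and T :: "'g topology"
    and A :: "('g, 'e::locally_convex_space) chart set" +
  fixes c :: "('g, 'e) chart" and expG :: "'e \<Rightarrow> 'g"
    and \<pi> :: "'g \<Rightarrow> ('h::complex_hilbert_space \<Rightarrow>\<^sub>L 'h)"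
  assumes exponential: "smooth_exponential G T A c expG"
    and representation: "smooth_unitary_rep G T A \<pi>"
begin

abbreviation (input) "D \<equiv> smooth_vectors T A \<pi>"

lemma c: "c \<in> A" "\<one> \<in> chart_dom c"
  using exponential by (auto simp: smooth_exponential_def)

lemma dom_subset: "d \<in> A \<Longrightarrow> p \<in> chart_dom d \<Longrightarrow> p \<in> carrier G"
  using charts_cover topspace_carrier by blast

lemma exists_chart:
  assumes "p \<in> carrier G"
  obtains d where "d \<in> A" "p \<in> chart_dom d"
  using assms charts_cover topspace_carrier by blast

lemma continuous_map_exp: "continuous_map euclidean T expG"
  using exponential by (auto simp: smooth_exponential_def smooth_map_def)

lemma exp_carrier: "expG x \<in> carrier G"
  using continuous_map_exp topspace_carrier by (auto simp: continuous_map_def Pi_iff)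

lemma exp_0: "expG 0 = \<one>"
proof -
  have "\<forall>x s t. expG ((s + t) *\<^sub>R x) = expG (s *\<^sub>R x) \<otimes> expG (t *\<^sub>R x)"
    using exponential by (simp add: smooth_exponential_def)
  from this[rule_format, of 0 0 0] have "expG 0 = expG 0 \<otimes> expG 0" by simp
  then show ?thesis using exp_carrier[of 0] by (metis l_cancel_one r_one one_closed)
qed

lemma unitary: "p \<in> carrier G \<Longrightarrow> unitary_op (\<pi> p)"
  and \<pi>_mult: "p \<in> carrier G \<Longrightarrow> q \<in> carrier G \<Longrightarrow> \<pi> (p \<otimes> q) = \<pi> p o\<^sub>L \<pi> q"
  using representation by (auto simp: smooth_unitary_rep_def unitary_rep_def unitary_group_def hom_def)

text \<open>Membership in \<open>hom\<close> speaks of products only. The value at the identity is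
  an idempotent isometry, and injectivity makes it the identity operator.\<close>

lemma \<pi>_one: "\<pi> \<one> = id_blinfun"
proof (rule blinfun_eqI)
  fix v
  have "\<pi> \<one> (\<pi> \<one> v) = \<pi> \<one> v"
    using \<pi>_mult[of \<one> \<one>] by (metis blinfun_apply_blinfun_compose one_closed r_one)
  then have "\<pi> \<one> (\<pi> \<one> v - v) = 0" by (simp add: blinfun.bilinear_simps)
  then have "norm (\<pi> \<one> v - v) = 0" using unitary_opD(3)[OF unitary[OF one_closed]] by (metis norm_zero)
  then show "\<pi> \<one> v = id_blinfun v" by simp
qed

lemma dense: "closure D = UNIV"
  using representation by (simp add: smooth_unitary_rep_def)

abbreviation "e0 \<equiv> chart_map c \<one>"

lemma exp_curve_derivative: "((\<lambda>t. (chart_map c (expG (t *\<^sub>R x)) - e0) /\<^sub>R t) \<longlongrightarrow> x) (at 0)"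
  using exponential by (simp add: smooth_exponential_def)

lemma eventually_exp_in:
  assumes "openin T P" "\<one> \<in> P"
  shows "eventually (\<lambda>t. expG (t *\<^sub>R x) \<in> P) (at (0::real))"
proof -
  have "open {x. expG x \<in> P}"
    using openin_continuous_map_preimage[OF continuous_map_exp assms(1)] by simp
  from eventually_line_in_open[OF this, of 0 x] show ?thesis
    using assms(2) exp_0 by simp
qed

section \<open>Skew-symmetry and the momentum map on a line\<close>

text \<open>The function \<open>cinner (\<pi> (expG (t *\<^sub>R x)) v) (\<pi> (expG (t *\<^sub>R
  x)) w)\<close> is constant in \<open>t\<close>; its product rule at 0 is the claim.\<close>

lemma derived_cinner:
  assumes "((\<lambda>t. \<pi> (expG (t *\<^sub>R x)) v) has_vector_derivative d) (at 0)"
    and "((\<lambda>t. \<pi> (expG (t *\<^sub>R x)) w) has_vector_derivative e) (at 0)"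
  shows "cinner d w = - cinner v e"
proof -
  have "((\<lambda>t. cinner (\<pi> (expG (t *\<^sub>R x)) v) (\<pi> (expG (t *\<^sub>R x)) w)) has_vector_derivative
      cinner (\<pi> (expG (0 *\<^sub>R x)) v) e + cinner d (\<pi> (expG (0 *\<^sub>R x)) w)) (at 0)"
    by (rule bounded_bilinear.has_vector_derivative[OF bounded_bilinear_cinner assms])
  then have "((\<lambda>t. cinner v w) has_vector_derivative cinner v e + cinner d w) (at 0)"
    by (simp add: unitary_opD(2)[OF unitary[OF exp_carrier]] exp_0 \<pi>_one)
  from vector_derivative_unique_at[OF this has_vector_derivative_const]
  show ?thesis by (simp add: eq_neg_iff_add_eq_0 add.commute)
qed

text \<open>The definite description ranges over a whole complex line. It is resolved because
  scaling \<open>v\<close> by \<open>a\<close> multiplies numerator and denominator by the same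
  factor \<open>a * cnj a\<close>, and because skewness makes the numerator purely imaginary, so
  that division by \<open>\<i>\<close> gives a real number.\<close>

lemma momentum_map_eq:
  assumes d: "((\<lambda>t. \<pi> (expG (t *\<^sub>R x)) v) has_vector_derivative d) (at 0)" and v: "v \<noteq> 0"
  shows "momentum_map expG \<pi> (complex_line v) x = Im (cinner d v) / (norm v)\<^sup>2"
proof -
  have "cinner d v = - cnj (cinner d v)"
    using derived_cinner[OF d d] cinner_commute[of v d] by simp
  then have "Re (cinner d v) = 0" by (metis add.inverse_inverse cnj.sel(1) equal_neg_zero uminus_complex.sel(1))
  then have dv: "cinner d v = \<i> * complex_of_real (Im (cinner d v))"
    by (simp add: complex_eq_iff)
  let ?r = "Im (cinner d v) / (norm v)\<^sup>2"
  have derived: "derived_rep expG \<pi> x (a *\<^sub>C v) = a *\<^sub>C d" for a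
    unfolding derived_rep_def unitary_opD(1)[OF unitary[OF exp_carrier]]
    by (rule vector_derivative_at) (rule bounded_linear.has_vector_derivative[OF bounded_linear_scaleC d])
  have quotient: "(1 / \<i>) * (cinner (derived_rep expG \<pi> x (a *\<^sub>C v)) (a *\<^sub>C v) / cinner (a *\<^sub>C v) (a *\<^sub>C v))
      = complex_of_real ?r" if "a \<noteq> 0" for a
  proof -
    have "cinner (derived_rep expG \<pi> x (a *\<^sub>C v)) (a *\<^sub>C v) / cinner (a *\<^sub>C v) (a *\<^sub>C v) = cinner d v / cinner v v"
      using that by (simp add: derived cinner_scaleC_left cinner_scaleC_right)
    also have "\<dots> = \<i> * complex_of_real ?r"
      by (subst dv) (simp add: cinner_self)
    finally show ?thesis by simp
  qed
  have line: "w \<in> complex_line v - {0} \<longleftrightarrow> (\<exists>a. a \<noteq> 0 \<and> w = a *\<^sub>C v)" for w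
  proof -
    have "a *\<^sub>C v = 0 \<longleftrightarrow> a = 0" for a
      using v norm_scaleC[of a v] by (metis mult_eq_0_iff norm_eq_zero)
    then show ?thesis by (auto simp: complex_line_def)
  qed
  show ?thesis
    unfolding momentum_map_def
  proof (rule the_equality)
    show "\<forall>w\<in>complex_line v - {0}. complex_of_real ?r = (1 / \<i>) * (cinner (derived_rep expG \<pi> x w) w / cinner w w)"
      using quotient line by metis
    fix r assume "\<forall>w\<in>complex_line v - {0}. complex_of_real r = (1 / \<i>) * (cinner (derived_rep expG \<pi> x w) w / cinner w w)"
    then have "complex_of_real r = complex_of_real ?r"
      using quotient[of 1] line by (metis zero_neq_one)
    then show "r = ?r" by (simp only: of_real_eq_iff)
  qed
qed

section \<open>Smooth homomorphisms have equicontinuous momentum sets\<close>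

lemma invertible_op_double: "invertible_op (id_blinfun + id_blinfun :: 'h \<Rightarrow>\<^sub>L 'h)"
  unfolding invertible_op_def
  by (rule exI[of _ "(1 / 2) *\<^sub>R id_blinfun"])
    (auto intro!: blinfun_eqI simp: blinfun.bilinear_simps simp flip: scaleR_left_distrib)

lemma unitary_id: "unitary_op (id_blinfun :: 'h \<Rightarrow>\<^sub>L 'h)"
  by (auto simp: unitary_op_def complex_linear_def surj_def)

lemma equicontinuous_of_morphism:
  assumes "lie_group_morphism G T A unitary_group unitary_topology unitary_atlas \<pi>"
  shows "equicontinuous_functionals (momentum_set T A expG \<pi>)"
proof -
  let ?k = "cayley_chart (id_blinfun :: 'h \<Rightarrow>\<^sub>L 'h)"
  have smooth: "smooth_map T A unitary_topology unitary_atlas \<pi>"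
    using assms by (simp add: lie_group_morphism_def)
  have k: "?k \<in> unitary_atlas" by (simp add: unitary_atlas_def unitary_id)
  define F where "F = chart_map ?k \<circ> \<pi> \<circ> chart_inv c"
  define W where "W = chart_map c ` {p \<in> chart_dom c. \<pi> p \<in> chart_dom ?k}"
  have F: "mb_smooth_on W F"
    using smooth c(1) k by (auto simp: smooth_map_def F_def W_def)
  have dom_k: "u \<in> chart_dom ?k \<longleftrightarrow> unitary_op u \<and> invertible_op (u + id_blinfun)" for u
    by (simp add: cayley_chart_def)
  have one_k: "\<pi> \<one> \<in> chart_dom ?k"
    by (simp add: dom_k \<pi>_one unitary_id invertible_op_double)
  have e0: "e0 \<in> W" unfolding W_def using c(2) one_k by auto
  have apply_k: "skew_apply (chart_map ?k u) = inverse_op (u + id_blinfun) o\<^sub>L (u - id_blinfun)"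
    if "u \<in> chart_dom ?k" for u
    using that skew_apply_Skew_Cayley[OF _ unitary_id, of u] by (simp add: dom_k) (simp add: cayley_chart_def)
  have F_e0: "skew_apply (F e0) = 0"
    using apply_k[OF one_k] by (simp add: F_def chart_inv_map[OF charts[OF c(1)] c(2)] \<pi>_one)
  have cont: "continuous_map T euclidean \<pi>"
    using smooth by (simp add: smooth_map_def unitary_topology_def continuous_map_in_subtopology)
  \<comment> \<open>Openness of \<open>W\<close> is part of smoothness of \<open>F\<close>. Carried
    back to the group, it provides a neighbourhood of the identity that contains exp(tx) for small
    t.\<close>
  have open_k: "openin T {p \<in> chart_dom c. \<pi> p \<in> chart_dom ?k}"
  proof -
    have "W \<subseteq> chart_map c ` chart_dom c" by (auto simp: W_def)
    moreover have "{p \<in> chart_dom c. \<pi> p \<in> chart_dom ?k} = {p \<in> chart_dom c. chart_map c p \<in> W}"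
      unfolding W_def using chart_inv_map[OF charts[OF c(1)]] by (auto simp: image_iff) metis
    ultimately show ?thesis
      using openin_chart_preimage[OF charts[OF c(1)] mb_smooth_onD(1)[OF F]] by simp
  qed
  define Z where "Z x = dir_deriv F e0 x" for x
  have derivative: "((\<lambda>t. \<pi> (expG (t *\<^sub>R x)) v) has_vector_derivative 2 *\<^sub>R skew_apply (Z x) v) (at 0)" for x v
  proof -
    let ?u = "\<lambda>t. \<pi> (expG (t *\<^sub>R x))" and ?X = "\<lambda>t. chart_map c (expG (t *\<^sub>R x))"
    have "((\<lambda>t. (F (?X t) - F e0) /\<^sub>R t) \<longlongrightarrow> Z x) (at 0)"
      unfolding Z_def by (rule mb_smooth_on_curve_derivative[OF F e0 exp_curve_derivative])
    then have 1: "((\<lambda>t. skew_apply ((F (?X t) - F e0) /\<^sub>R t)) \<longlongrightarrow> skew_apply (Z x)) (at 0)"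
      by (rule bounded_linear.tendsto[OF bounded_linear_skew_apply])
    have "continuous_map euclidean euclidean (\<lambda>x. \<pi> (expG x))"
      using continuous_map_compose[OF continuous_map_exp cont] by (simp add: o_def)
    then have c\<pi>: "continuous_on UNIV (\<lambda>x. \<pi> (expG x))" by (simp add: continuous_map_iff_continuous2)
    have "((\<lambda>x. \<pi> (expG x)) \<longlongrightarrow> \<pi> (expG 0)) (nhds 0)"
      by (rule continuous_on_open_tendsto_nhds[OF c\<pi>]) auto
    moreover have "((\<lambda>t. t *\<^sub>R x) \<longlongrightarrow> 0 *\<^sub>R x) (at (0::real))"
      by (intro tendsto_scaleR_lcs tendsto_const tendsto_ident_at)
    ultimately have 2: "((\<lambda>t. ?u t) \<longlongrightarrow> \<pi> (expG 0)) (at 0)"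
      by (auto intro: filterlim_compose)
    \<comment> \<open>Norm continuity of \<open>\<pi>\<close> along the curve makes
      \<open>?u t + id_blinfun\<close> tend to twice the identity, the source of the factor
      2.\<close>
    have lim: "((\<lambda>t. ((?u t + id_blinfun) o\<^sub>L skew_apply ((F (?X t) - F e0) /\<^sub>R t)) v)
       \<longlongrightarrow> ((\<pi> (expG 0) + id_blinfun) o\<^sub>L skew_apply (Z x)) v) (at 0)"
      by (intro blinfun.tendsto bounded_bilinear.tendsto[OF bounded_bilinear_blinfun_compose] tendsto_add 1 2 tendsto_const)
    have val: "((\<pi> (expG 0) + id_blinfun) o\<^sub>L skew_apply (Z x)) v = 2 *\<^sub>R skew_apply (Z x) v"
      by (simp add: exp_0 \<pi>_one blinfun.bilinear_simps scaleR_2)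
    have ev: "eventually (\<lambda>t. ((?u t + id_blinfun) o\<^sub>L skew_apply ((F (?X t) - F e0) /\<^sub>R t)) v = (?u t v - v) /\<^sub>R t) (at 0)"
    proof (rule eventually_mono[OF eventually_exp_in[OF open_k, of x]])
      show "\<one> \<in> {p \<in> chart_dom c. \<pi> p \<in> chart_dom ?k}" using c(2) one_k by simp
    next
      fix t assume t: "expG (t *\<^sub>R x) \<in> {p \<in> chart_dom c. \<pi> p \<in> chart_dom ?k}"
      then have "(?u t + id_blinfun) o\<^sub>L skew_apply (F (?X t)) = ?u t - id_blinfun"
        using Cayley_skew(3)[OF _ unitary_id, of "?u t"]
        by (simp add: F_def chart_inv_map[OF charts[OF c(1)]] apply_k) (simp add: dom_k)
      then have "(?u t + id_blinfun) o\<^sub>L skew_apply ((F (?X t) - F e0) /\<^sub>R t) = (?u t - id_blinfun) /\<^sub>R t"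
        by (simp add: scaleR_skew_op.rep_eq minus_skew_op.rep_eq F_e0 blinfun_compose_simps(6))
      then show "((?u t + id_blinfun) o\<^sub>L skew_apply ((F (?X t) - F e0) /\<^sub>R t)) v = (?u t v - v) /\<^sub>R t"
        by (simp only:) (simp add: blinfun.bilinear_simps)
    qed
    have "((\<lambda>t. (?u t v - v) /\<^sub>R t) \<longlongrightarrow> 2 *\<^sub>R skew_apply (Z x) v) (at 0)"
      by (rule Lim_transform_eventually[OF lim[unfolded val] ev])
    then show ?thesis
      by (simp add: has_vector_derivative_at_iff_difference_quotient exp_0 \<pi>_one)
  qed
  have lin_Z: "linear Z" unfolding Z_def by (rule linear_dir_deriv[OF F e0])
  have cont_Z: "continuous_on UNIV Z"
  proof -
    \<comment> \<open>Continuity of derivatives is stated on sequences of directions; constant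
      sequences reduce it to a single direction.\<close>
    have "continuous_on UNIV (\<lambda>x. (e0, \<lambda>i::nat. x))"
      by (intro continuous_on_Pair continuous_intros continuous_on_coordinatewise_then_product)
    from continuous_on_compose2[OF mb_smooth_onD(3)[OF F, of 1] this] e0 show ?thesis
      by (simp add: Z_def[abs_def] image_subset_iff)
  qed
  define U where "U = {x. norm (Z x) < 1}"
  have U: "open U" "0 \<in> U"
    using open_Collect_less[OF continuous_on_norm[OF cont_Z] continuous_on_const[of UNIV "1::real"]]
    by (auto simp: U_def linear_0[OF lin_Z])
  \<comment> \<open>A weak-* closed convex set, so it contains the hull once it contains the
    momentum image. The constant 2 comes from d\<pi>(x) being twice \<open>Z x\<close>, with
    \<open>norm (Z x) < 1\<close> on \<open>U\<close>.\<close>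
  define C where "C = {\<alpha> \<in> topological_dual. \<forall>x\<in>U. \<bar>\<alpha> x\<bar> \<le> 2}"
  have "momentum_set T A expG \<pi> \<subseteq> C"
    unfolding momentum_set_def
  proof (rule hull_minimal)
    show "closedin weak_star_topology C \<and> convex_functionals C"
    proof
      have "C = topological_dual \<inter> (\<Inter>x\<in>U. {\<alpha>. \<bar>\<alpha> x\<bar> \<le> 2})"
        by (auto simp: C_def)
      moreover have "closed (\<Inter>x\<in>U. {\<alpha> :: 'e \<Rightarrow> real. \<bar>\<alpha> x\<bar> \<le> 2})"
        by (intro closed_INT ballI closed_Collect_le continuous_intros continuous_on_product_coordinates)
      ultimately show "closedin weak_star_topology C"
        by (auto simp: weak_star_topology_def closedin_closed)
      show "convex_functionals C"
        unfolding convex_functionals_def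
      proof (intro ballI allI impI)
        fix \<alpha> \<beta> :: "'e \<Rightarrow> real" and s t :: real
        assume \<alpha>: "\<alpha> \<in> C" and \<beta>: "\<beta> \<in> C" and st: "0 \<le> s" "0 \<le> t" "s + t = 1"
        have "linear (\<lambda>x. s * \<alpha> x + t * \<beta> x)" "continuous_on UNIV (\<lambda>x. s * \<alpha> x + t * \<beta> x)"
          using \<alpha> \<beta> by (auto simp: C_def topological_dual_def linear_iff algebra_simps intro!: continuous_intros)
        moreover have "\<bar>s * \<alpha> x + t * \<beta> x\<bar> \<le> 2" if "x \<in> U" for x
        proof -
          have "\<bar>\<alpha> x\<bar> \<le> 2" "\<bar>\<beta> x\<bar> \<le> 2" using \<alpha> \<beta> that by (auto simp: C_def)
          then have "\<bar>s * \<alpha> x + t * \<beta> x\<bar> \<le> s * 2 + t * 2"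
            using st by (intro order_trans[OF abs_triangle_ineq] add_mono) (auto simp: abs_mult mult_left_mono)
          then show ?thesis using st(3) by simp
        qed
        ultimately show "(\<lambda>x. s * \<alpha> x + t * \<beta> x) \<in> C"
          by (simp add: C_def topological_dual_def)
      qed
    qed
    show "momentum_map expG \<pi> ` projective_space D \<subseteq> C"
    proof
      fix \<alpha> assume "\<alpha> \<in> momentum_map expG \<pi> ` projective_space D"
      then obtain v where v: "v \<noteq> 0" and \<alpha>: "\<alpha> = momentum_map expG \<pi> (complex_line v)"
        by (auto simp: projective_space_def)
      have \<alpha>_eq: "\<alpha> x = Im (cinner (2 *\<^sub>R skew_apply (Z x) v) v) / (norm v)\<^sup>2" for x
        unfolding \<alpha> by (rule momentum_map_eq[OF derivative v])
      have "linear \<alpha>"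
        by (rule linearI)
          (auto simp: \<alpha>_eq linear_add[OF lin_Z] linear_scale[OF lin_Z] plus_skew_op.rep_eq scaleR_skew_op.rep_eq
            blinfun.bilinear_simps cinner_add_left skew_aux scaleR_add_right add_divide_distrib)
      moreover have "continuous_on UNIV \<alpha>"
        unfolding \<alpha>_eq[abs_def]
        by (intro continuous_on_divide continuous_on_Im bounded_bilinear.continuous_on[OF bounded_bilinear_cinner]
            continuous_on_scaleR continuous_on_const blinfun.continuous_on
            bounded_linear.continuous_on[OF bounded_linear_skew_apply] cont_Z) (use v in auto)
      moreover have "\<bar>\<alpha> x\<bar> \<le> 2" if "x \<in> U" for x
      proof -
        have "\<bar>Im (cinner (2 *\<^sub>R skew_apply (Z x) v) v)\<bar> \<le> norm (2 *\<^sub>R skew_apply (Z x) v) * norm v"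
          using abs_Im_le_cmod norm_cinner_le order_trans by blast
        also have "\<dots> \<le> (2 * norm v) * norm v"
        proof (rule mult_right_mono)
          have "norm (skew_apply (Z x) v) \<le> norm (skew_apply (Z x)) * norm v" by (rule norm_blinfun)
          also have "\<dots> \<le> 1 * norm v"
            using that by (intro mult_right_mono) (auto simp: U_def norm_skew_op.rep_eq)
          finally show "norm (2 *\<^sub>R skew_apply (Z x) v) \<le> 2 * norm v" by simp
        qed simp
        finally show ?thesis using v by (simp add: \<alpha>_eq power2_eq_square field_simps)
      qed
      ultimately show "\<alpha> \<in> C" by (simp add: C_def topological_dual_def)
    qed
  qed
  then show ?thesis
    unfolding equicontinuous_functionals_def using U by (intro exI[of _ U] exI[of _ 2]) (auto simp: C_def)
qed

end

section \<open>From strong derivatives to derivatives in operator norm\<close>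

text \<open>
  The mean value estimates are uniform in \<open>v\<close> on the unit ball of the dense set \<open>D\<close>, so they carry over
  to the operator norm.
\<close>

lemma operator_derivative_of_dense:
  fixes P :: "'e::locally_convex_space \<Rightarrow> ('h::real_normed_vector \<Rightarrow>\<^sub>L 'k::real_normed_vector)"
    and Q :: "'e \<Rightarrow> 'e \<Rightarrow> ('h \<Rightarrow>\<^sub>L 'h)"
  assumes D: "closure D = UNIV" and W: "open W"
    and der: "\<And>x h v. x \<in> W \<Longrightarrow> v \<in> D \<Longrightarrow> has_dir_deriv (\<lambda>y. P y v) x h (P x (Q x h v))"
    and bound: "\<And>x. x \<in> W \<Longrightarrow> norm (P x) \<le> 1"
    and Q: "continuous_on (W \<times> UNIV) (\<lambda>(x, h). Q x h)" and Q0: "\<And>x. x \<in> W \<Longrightarrow> Q x 0 = 0"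
  shows "continuous_on W P" "x \<in> W \<Longrightarrow> has_dir_deriv P x h (P x o\<^sub>L Q x h)"
proof -
  have Q_lim: "((\<lambda>(x, h). Q x h) \<longlongrightarrow> Q x h) (nhds (x, h))" if "x \<in> W" for x h
    using continuous_on_open_tendsto_nhds[OF Q, of "(x, h)"] W that by (simp add: open_Times)
  show cont: "continuous_on W P"
    unfolding continuous_on_def
  proof (intro ballI tendstoI)
    fix x and e :: real assume x: "x \<in> W" and e: "e > 0"
    \<comment> \<open>Since \<open>Q x 0 = 0\<close>, joint continuity makes \<open>Q\<close> small
      for base points near \<open>x\<close> and directions near 0. The segment from \<open>x\<close>
      to \<open>y\<close> has direction \<open>y - x\<close>, so the velocity of the orbit along it
      is small compared with \<open>norm v\<close>.\<close>
    have "eventually (\<lambda>p. dist (case p of (x, h) \<Rightarrow> Q x h) (Q x 0) < e / 2) (nhds (x, 0))"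
      using e by (intro tendstoD[OF Q_lim[OF x]]) auto
    then obtain S where S: "open S" "(x, 0) \<in> S"
      "\<And>p. p \<in> S \<Longrightarrow> dist (case p of (x, h) \<Rightarrow> Q x h) (Q x 0) < e / 2"
      unfolding eventually_nhds by blast
    have S3: "norm (Q y h) < e / 2" if "(y, h) \<in> S" for y h
      using S(3)[OF that] Q0[OF x] by simp
    obtain V N where VN: "open V" "open N" "(x, 0) \<in> V \<times> N" "V \<times> N \<subseteq> S"
      using open_prod_elim[OF S(1,2)] .
    have "open ((\<lambda>y. y + x) -` (W \<inter> V))"
      using W VN(1) by (intro open_vimage open_Int continuous_intros)
    then obtain K where K: "open K" "0 \<in> K" "K \<subseteq> (\<lambda>y. y + x) -` (W \<inter> V)" "convex K"
      using convex_nhds_zero[of "(\<lambda>y. y + x) -` (W \<inter> V)"] x VN(3) by auto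
    have "((\<lambda>y. y - x) \<longlongrightarrow> x - x) (at x within W)"
      by (intro tendsto_diff tendsto_const tendsto_ident_at)
    then have "eventually (\<lambda>y. y - x \<in> K \<inter> N) (at x within W)"
      using K VN by (auto dest!: topological_tendstoD[where S = "K \<inter> N"])
    then show "eventually (\<lambda>y. dist (P y) (P x) < e) (at x within W)"
    proof eventually_elim
      fix y assume y: "y - x \<in> K \<inter> N"
      have in_WV: "x + s *\<^sub>R (y - x) \<in> W \<inter> V" if "s \<in> closed_segment 0 1" for s
      proof -
        have "0 \<le> s" "s \<le> 1" using that by (auto simp: closed_segment_eq_real_ivl)
        then have "s *\<^sub>R (y - x) \<in> K"
          using convexD[OF K(4) K(2), of "y - x" "1 - s" s] y by simp
        then show ?thesis using K(3) by (auto simp: add.commute)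
      qed
      have "norm (P y - P x) \<le> e / 2"
      proof (rule norm_blinfun_le_dense[OF D])
        fix v assume v: "v \<in> D"
        let ?g = "\<lambda>s. P (x + s *\<^sub>R (y - x)) v"
        have "norm (?g 1 - ?g 0 - 1 *\<^sub>R 0) \<le> e / 2 * norm v * \<bar>1\<bar>"
        proof (rule increment_bound)
          fix s :: real assume s: "s \<in> closed_segment 0 1"
          let ?z = "x + s *\<^sub>R (y - x)"
          show "(?g has_vector_derivative P ?z (Q ?z (y - x) v)) (at s)"
            using in_WV[OF s] by (intro has_vector_derivative_along_line der v) auto
          have "norm (P ?z (Q ?z (y - x) v)) \<le> norm (P ?z) * norm (Q ?z (y - x) v)"
            by (rule norm_blinfun)
          also have "\<dots> \<le> 1 * norm (Q ?z (y - x) v)"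
            using in_WV[OF s] by (intro mult_right_mono bound) auto
          also have "\<dots> \<le> norm (Q ?z (y - x)) * norm v"
            using norm_blinfun[of "Q ?z (y - x)" v] by simp
          also have "\<dots> \<le> e / 2 * norm v"
            using in_WV[OF s] y VN(4) S3[of ?z "y - x"] by (intro mult_right_mono) force+
          finally show "norm (P ?z (Q ?z (y - x) v) - 0) \<le> e / 2 * norm v" by simp
        qed
        then show "norm ((P y - P x) v) \<le> e / 2 * norm v"
          by (simp add: blinfun.bilinear_simps)
      qed (use e in simp)
      then show "dist (P y) (P x) < e" using e by (simp add: dist_norm)
    qed
  qed
  assume x: "x \<in> W"
  \<comment> \<open>The norm continuity of \<open>P\<close> obtained in the first part makes this
    velocity converge in operator norm, hence uniformly for \<open>v\<close> in the unit
    ball.\<close>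
  let ?R = "\<lambda>s. P (x + s *\<^sub>R h) o\<^sub>L Q (x + s *\<^sub>R h) h"
  have line: "((\<lambda>s. x + s *\<^sub>R h) \<longlongrightarrow> x + 0 *\<^sub>R h) (at (0::real))"
    by (intro tendsto_add tendsto_const tendsto_scaleR_lcs tendsto_ident_at)
  then have line': "((\<lambda>s. x + s *\<^sub>R h) \<longlongrightarrow> x) (at (0::real))" by simp
  have "((\<lambda>s. P (x + s *\<^sub>R h)) \<longlongrightarrow> P x) (at 0)"
    by (rule filterlim_compose[OF continuous_on_open_tendsto_nhds[OF cont W x] line'])
  moreover have "((\<lambda>s. Q (x + s *\<^sub>R h) h) \<longlongrightarrow> Q x h) (at 0)"
    using filterlim_compose[OF Q_lim[OF x] tendsto_Pair[OF line' tendsto_const[of h]]] by simp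
  ultimately have R: "(?R \<longlongrightarrow> P x o\<^sub>L Q x h) (at 0)"
    by (rule bounded_bilinear.tendsto[OF bounded_bilinear_blinfun_compose])
  show "has_dir_deriv P x h (P x o\<^sub>L Q x h)"
    unfolding has_dir_deriv_def
  proof (rule tendstoI)
    fix e :: real assume e: "e > 0"
    have "eventually (\<lambda>s. dist (?R s) (P x o\<^sub>L Q x h) < e / 2 \<and> x + s *\<^sub>R h \<in> W) (at 0)"
      using e by (intro eventually_conj tendstoD[OF R] eventually_line_in_open[OF W x]) auto
    then obtain r where r: "r > 0"
      "\<And>s. s \<noteq> 0 \<Longrightarrow> \<bar>s\<bar> < r \<Longrightarrow> norm (?R s - (P x o\<^sub>L Q x h)) < e / 2 \<and> x + s *\<^sub>R h \<in> W"
      unfolding eventually_at by (auto simp: dist_norm)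
    have r': "norm (?R s - (P x o\<^sub>L Q x h)) \<le> e / 2" "x + s *\<^sub>R h \<in> W" if "\<bar>s\<bar> < r" for s
      using r(2)[of s] that e x by (cases "s = 0"; auto)+
    have "eventually (\<lambda>t::real. \<bar>t\<bar> < r \<and> t \<noteq> 0) (at 0)"
      using r(1) by (auto simp: eventually_at intro!: exI[of _ r])
    then show "eventually (\<lambda>t. dist ((P (x + t *\<^sub>R h) - P x) /\<^sub>R t) (P x o\<^sub>L Q x h) < e) (at 0)"
    proof eventually_elim
      fix t :: real assume t: "\<bar>t\<bar> < r \<and> t \<noteq> 0"
      have "norm (P (x + t *\<^sub>R h) - P x - t *\<^sub>R (P x o\<^sub>L Q x h)) \<le> e / 2 * \<bar>t\<bar>"
      proof (rule norm_blinfun_le_dense[OF D])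
        fix v assume v: "v \<in> D"
        let ?g = "\<lambda>s. P (x + s *\<^sub>R h) v"
        have "norm (?g t - ?g 0 - t *\<^sub>R (P x o\<^sub>L Q x h) v) \<le> e / 2 * norm v * \<bar>t\<bar>"
        proof (rule increment_bound)
          fix s assume "s \<in> closed_segment 0 t"
          then have s: "\<bar>s\<bar> < r" using t by (auto simp: closed_segment_eq_real_ivl split: if_splits)
          show "(?g has_vector_derivative ?R s v) (at s)"
            using r'(2)[OF s] v has_vector_derivative_along_line[OF der] by auto
          have "norm ((?R s - (P x o\<^sub>L Q x h)) v) \<le> norm (?R s - (P x o\<^sub>L Q x h)) * norm v"
            by (rule norm_blinfun)
          also have "\<dots> \<le> e / 2 * norm v" using r'(1)[OF s] by (intro mult_right_mono) auto
          finally show "norm (?R s v - (P x o\<^sub>L Q x h) v) \<le> e / 2 * norm v"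
            by (simp only: blinfun.diff_left)
        qed
        then show "norm ((P (x + t *\<^sub>R h) - P x - t *\<^sub>R (P x o\<^sub>L Q x h)) v) \<le> e / 2 * \<bar>t\<bar> * norm v"
          by (simp add: blinfun.bilinear_simps mult_ac)
      qed (use e in simp)
      moreover have "(P (x + t *\<^sub>R h) - P x) /\<^sub>R t - (P x o\<^sub>L Q x h) = (P (x + t *\<^sub>R h) - P x - t *\<^sub>R (P x o\<^sub>L Q x h)) /\<^sub>R t"
        using t by (simp add: scaleR_diff_right)
      ultimately have "dist ((P (x + t *\<^sub>R h) - P x) /\<^sub>R t) (P x o\<^sub>L Q x h) \<le> e / 2"
        using t unfolding dist_norm by (simp add: divide_le_eq inverse_eq_divide)
      then show "dist ((P (x + t *\<^sub>R h) - P x) /\<^sub>R t) (P x o\<^sub>L Q x h) < e" using e by simp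
    qed
  qed
qed

section \<open>Bounded representations are smooth homomorphisms\<close>

context smooth_representation
begin

lemma smooth_vector_iff:
  "v \<in> D \<longleftrightarrow> continuous_map T euclidean (\<lambda>g. \<pi> g v) \<and>
    (\<forall>d\<in>A. mb_smooth_on (chart_map d ` chart_dom d) (\<lambda>y. \<pi> (chart_inv d y) v))"
  by (simp add: smooth_vectors_def smooth_map_def space_atlas_def o_def)

lemma subspace_smooth_vectors: "subspace D"
proof (rule subspaceI)
  have o: "open (chart_map d ` chart_dom d)" if "d \<in> A" for d
    using charts[OF that] by (simp add: is_chart_def)
  show "0 \<in> D"
    using o by (auto simp: smooth_vector_iff mb_smooth_on_iff_smooth_family smooth_family_const)
  show "v + w \<in> D" if "v \<in> D" "w \<in> D" for v w
    using that unfolding smooth_vector_iff mb_smooth_on_iff_smooth_family blinfun.add_right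
    by (auto intro!: smooth_family_add continuous_map_add)
  show "r *\<^sub>R v \<in> D" if v: "v \<in> D" for r v
  proof -
    have "smooth_family n (chart_map d ` chart_dom d) (\<lambda>y h. r *\<^sub>R \<pi> (chart_inv d y) v)" if "d \<in> A" for d n
      using v that unfolding smooth_vector_iff mb_smooth_on_iff_smooth_family
      by (intro smooth_family_continuous_linear[where L = "\<lambda>w. r *\<^sub>R w"])
        (auto intro!: linearI continuous_intros simp: scaleR_add_right)
    moreover have "continuous_map T euclidean (\<lambda>g. r *\<^sub>R \<pi> g v)"
    proof -
      have "continuous_on UNIV (\<lambda>w :: 'h. r *\<^sub>R w)" by (intro continuous_intros)
      then show ?thesis
        using v continuous_map_compose[of T euclidean "\<lambda>g. \<pi> g v" euclidean "\<lambda>w. r *\<^sub>R w"]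
        by (simp add: smooth_vector_iff continuous_map_iff_continuous2 o_def)
    qed
    ultimately show ?thesis
      using o by (simp add: smooth_vector_iff mb_smooth_on_iff_smooth_family blinfun.scaleR_right)
  qed
qed

section \<open>The differential of the orbit map at the identity\<close>

text \<open>Taken in the chart \<open>c\<close> instead of along exponential curves, so that
  linearity in \<open>x\<close> is that of a directional derivative.\<close>

definition derived :: "'e \<Rightarrow> 'h \<Rightarrow> 'h" where
  "derived x v = dir_deriv (\<lambda>y. \<pi> (chart_inv c y) v) e0 x"

text \<open>Arbitrary curves through the identity are allowed because two kinds occur: exponential
  curves, and the chart curves of products \<open>inv p q\<close> with \<open>p\<close> fixed and
  \<open>q\<close> moving.\<close>

lemma orbit_curve_derivative:
  assumes v: "v \<in> D" and X: "((\<lambda>t. (X t - e0) /\<^sub>R t) \<longlongrightarrow> x) (at 0)"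
  shows "((\<lambda>t. (\<pi> (chart_inv c (X t)) v - v) /\<^sub>R t) \<longlongrightarrow> derived x v) (at 0)"
proof -
  have "mb_smooth_on (chart_map c ` chart_dom c) (\<lambda>y. \<pi> (chart_inv c y) v)"
    using v c(1) by (simp add: smooth_vector_iff)
  from mb_smooth_on_curve_derivative[OF this _ X] show ?thesis
    using c by (simp add: derived_def chart_inv_map[OF charts] \<pi>_one)
qed

lemma derived:
  assumes v: "v \<in> D"
  shows "((\<lambda>t. \<pi> (expG (t *\<^sub>R x)) v) has_vector_derivative derived x v) (at 0)"
proof -
  have "eventually (\<lambda>t. (\<pi> (chart_inv c (chart_map c (expG (t *\<^sub>R x)))) v - v) /\<^sub>R t
      = (\<pi> (expG (t *\<^sub>R x)) v - v) /\<^sub>R t) (at 0)"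
    by (rule eventually_mono[OF eventually_exp_in[of "chart_dom c" x]])
      (use charts[OF c(1)] c in \<open>auto simp: is_chart_def chart_inv_map[OF charts]\<close>)
  from Lim_transform_eventually[OF orbit_curve_derivative[OF v exp_curve_derivative] this]
  show ?thesis
    by (simp add: has_vector_derivative_at_iff_difference_quotient exp_0 \<pi>_one)
qed

lemma derived_unique:
  assumes "v \<in> D" "((\<lambda>t. \<pi> (expG (t *\<^sub>R x)) v) has_vector_derivative w) (at 0)"
  shows "derived x v = w"
  using derived[OF assms(1)] assms(2) by (rule vector_derivative_unique_at)

lemma derived_add: "v \<in> D \<Longrightarrow> w \<in> D \<Longrightarrow> derived x (v + w) = derived x v + derived x w"
  by (rule derived_unique)
    (auto simp: subspace_add[OF subspace_smooth_vectors] blinfun.add_right intro!: has_vector_derivative_add derived)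

lemma derived_scaleR: "v \<in> D \<Longrightarrow> derived x (r *\<^sub>R v) = r *\<^sub>R derived x v"
  by (rule derived_unique)
    (auto simp: subspace_scale[OF subspace_smooth_vectors] blinfun.scaleR_right
      intro!: bounded_linear.has_vector_derivative[OF bounded_linear_scaleR_right] derived)

lemma linear_derived: "v \<in> D \<Longrightarrow> linear (\<lambda>x. derived x v)"
  unfolding derived_def using c by (intro linear_dir_deriv) (auto simp: smooth_vector_iff)

lemma derived_operator:
  assumes "equicontinuous_functionals (momentum_set T A expG \<pi>)"
  shows "\<exists>B :: 'e \<Rightarrow> ('h \<Rightarrow>\<^sub>L 'h). linear B \<and> continuous_on UNIV B \<and> (\<forall>x. \<forall>v\<in>D. blinfun_apply (B x) v = derived x v)"
proof -
  obtain U M where U: "open U" "0 \<in> U" and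
    M: "\<And>x \<alpha>. x \<in> U \<Longrightarrow> \<alpha> \<in> momentum_set T A expG \<pi> \<Longrightarrow> \<bar>\<alpha> x\<bar> \<le> M"
    using assms by (auto simp: equicontinuous_functionals_def)
  have bound: "norm (derived x v) \<le> M * norm v" if x: "x \<in> U" and v: "v \<in> D" for x v
  proof (rule norm_le_of_numerical_range[OF subspace_smooth_vectors dense _ _ _ _ v])
    show "cinner (derived x v) w = - cinner v (derived x w)" if "v \<in> D" "w \<in> D" for v w
      using that by (intro derived_cinner[where x = x] derived)
    show "\<bar>Im (cinner (derived x v) v)\<bar> \<le> M * (norm v)\<^sup>2" if "v \<in> D" for v
    proof (cases "v = 0")
      case False
      have "momentum_map expG \<pi> ` projective_space D \<subseteq> momentum_set T A expG \<pi>"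
        unfolding momentum_set_def by (rule hull_subset)
      then have "momentum_map expG \<pi> (complex_line v) \<in> momentum_set T A expG \<pi>"
        using False that by (auto simp: projective_space_def)
      from M[OF x this] have "\<bar>Im (cinner (derived x v) v) / (norm v)\<^sup>2\<bar> \<le> M"
        by (simp add: momentum_map_eq[OF derived[OF that] False])
      then show ?thesis using False by (simp add: divide_le_eq)
    qed (simp add: skew_aux)
  qed (auto simp: derived_add derived_scaleR)
  have "\<exists>B :: 'h \<Rightarrow>\<^sub>L 'h. \<forall>v\<in>D. B v = derived x v" for x
  proof -
    \<comment> \<open>Zero-neighbourhoods are absorbing: an arbitrary \<open>x\<close> is scaled
      into \<open>U\<close>, at the price of a bound that depends on \<open>x\<close>. The uniform
      bound on \<open>U\<close> is used afterwards for continuity.\<close>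
    have "eventually (\<lambda>t. 0 + t *\<^sub>R x \<in> U) (at (0::real))"
      by (rule eventually_line_in_open[OF U])
    then have "eventually (\<lambda>t. t *\<^sub>R x \<in> U \<and> t \<noteq> 0) (at (0::real))"
      by (auto simp: eventually_at_filter)
    then obtain t :: real where t: "t *\<^sub>R x \<in> U" "t \<noteq> 0"
      using eventually_happens by fastforce
    have "norm (derived x v) \<le> (M / \<bar>t\<bar>) * norm v" if "v \<in> D" for v
      using bound[OF t(1) that] t(2) linear_scale[OF linear_derived[OF that], of t x]
      by (simp add: field_simps)
    then show ?thesis
      by (intro bounded_linear_dense_extension[OF subspace_smooth_vectors dense, where C = "M / \<bar>t\<bar>"])
        (auto simp: derived_add derived_scaleR)
  qed
  then obtain B :: "'e \<Rightarrow> ('h \<Rightarrow>\<^sub>L 'h)" where B: "\<And>x v. v \<in> D \<Longrightarrow> blinfun_apply (B x) v = derived x v"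
    by metis
  \<comment> \<open>Operators agreeing on the dense space coincide, so the pointwise choice of
    \<open>B x\<close> is automatically linear in \<open>x\<close>.\<close>
  have eq: "X = Y" if "\<And>v. v \<in> D \<Longrightarrow> blinfun_apply X v = blinfun_apply Y v" for X Y :: "'h \<Rightarrow>\<^sub>L 'h"
    by (rule blinfun_eqI, rule closure_UNIV_induct[OF dense _ that])
      (auto intro!: closed_Collect_eq continuous_intros)
  have lin: "linear B"
    by (rule linearI)
      (auto intro!: eq simp: B blinfun.bilinear_simps linear_add[OF linear_derived] linear_scale[OF linear_derived])
  \<comment> \<open>\<open>M\<close> can be negative if the momentum set is empty, as it is for the
    zero Hilbert space.\<close>
  have "norm (B x) \<le> max M 0" if x: "x \<in> U" for x
  proof (rule norm_blinfun_le_dense[OF dense])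
    fix v assume v: "v \<in> D"
    have "norm (B x v) \<le> M * norm v" using bound[OF x v] by (simp add: B[OF v])
    also have "\<dots> \<le> max M 0 * norm v" by (intro mult_right_mono) auto
    finally show "norm (B x v) \<le> max M 0 * norm v" .
  qed simp
  with lin B linear_continuous_of_bounded_nhd[OF lin U] show ?thesis by blast
qed

text \<open>
  Here \<open>\<iota>\<close> and \<open>\<mu>\<close> are inversion and multiplication in charts, and \<open>Q y h = B (\<kappa> y h)\<close> for the left
  logarithmic derivative \<open>\<kappa>\<close> of the parametrization \<open>chart_inv d\<close>.
\<close>

lemma local_smooth:
  fixes B :: "'e \<Rightarrow> ('h \<Rightarrow>\<^sub>L 'h)"
  assumes B: "linear B" "continuous_on UNIV B" "\<And>x v. v \<in> D \<Longrightarrow> blinfun_apply (B x) v = derived x v"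
    and d: "d \<in> A" and p: "p \<in> chart_dom d"
  shows "\<exists>W. chart_map d p \<in> W \<and> mb_smooth_on W (\<lambda>y. \<pi> (chart_inv d y))"
proof -
  let ?p = "chart_inv d"
  obtain d' where d': "d' \<in> A" "inv p \<in> chart_dom d'"
    using exists_chart[OF inv_closed[OF dom_subset[OF d p]]] .
  define W where "W = chart_map d ` {q \<in> chart_dom d. inv q \<in> chart_dom d'}"
  define \<iota> where "\<iota> = chart_map d' \<circ> (\<lambda>q. inv q) \<circ> ?p"
  have \<iota>: "mb_smooth_on W \<iota>"
    using smooth_inv d d'(1) by (auto simp: smooth_map_def W_def \<iota>_def)
  note W = mb_smooth_onD(1)[OF \<iota>]
  have inW: "?p y \<in> chart_dom d" "inv (?p y) \<in> chart_dom d'" "?p y \<in> carrier G"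
    "y = chart_map d (?p y)" if "y \<in> W" for y
    using that dom_subset[OF d] by (auto simp: W_def chart_inv_map[OF charts[OF d]])
  define e where "e = (chart_dom d' \<times> chart_dom d, map_prod (chart_map d') (chart_map d))"
  have e: "e \<in> prod_atlas A A"
    unfolding e_def prod_atlas_def using d d'(1) by (intro CollectI exI[of _ d'] exI[of _ d] conjI refl)
  have e_inv: "chart_inv e (chart_map d' q', chart_map d q) = (q', q)"
    if "q' \<in> chart_dom d'" "q \<in> chart_dom d" for q q'
  proof -
    have "inj_on (map_prod (chart_map d') (chart_map d)) (chart_dom d' \<times> chart_dom d)"
      by (intro map_prod_inj_on inj_on_inverseI[of _ "chart_inv d'"] inj_on_inverseI[of _ "chart_inv d"])
        (simp_all add: chart_inv_map[OF charts] d d'(1))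
    from inv_into_f_f[OF this, of "(q', q)"] that show ?thesis
      by (simp add: chart_inv_def e_def)
  qed
  define \<mu> where "\<mu> = chart_map c \<circ> (\<lambda>(x, y). x \<otimes> y) \<circ> chart_inv e"
  define V where "V = chart_map e ` {q \<in> chart_dom e. (\<lambda>(x, y). x \<otimes> y) q \<in> chart_dom c}"
  have \<mu>: "mb_smooth_on V \<mu>"
    using smooth_mult e c(1) by (auto simp: smooth_map_def \<mu>_def V_def)
  have \<mu>_eq: "\<mu> (chart_map d' q', chart_map d q) = chart_map c (q' \<otimes> q)"
    if "q' \<in> chart_dom d'" "q \<in> chart_dom d" for q q'
    by (simp add: \<mu>_def e_inv[OF that])
  have inV: "(\<iota> y, y) \<in> V" if y: "y \<in> W" for y
  proof -
    have mem: "(inv (?p y), ?p y) \<in> {q \<in> chart_dom e. (\<lambda>(x, y). x \<otimes> y) q \<in> chart_dom c}"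
      using inW[OF y] c(2) by (simp add: e_def)
    have eq: "chart_map e (inv (?p y), ?p y) = (\<iota> y, y)"
      using inW(4)[OF y] by (simp add: e_def \<iota>_def)
    show ?thesis unfolding V_def by (rule image_eqI[OF _ mem]) (rule eq[symmetric])
  qed
  \<comment> \<open>Composition with \<open>B\<close> brings the values into a normed space, as
    \<open>smooth_family_compose\<close> demands. Being linear and continuous, \<open>B\<close>
    commutes with directional derivatives, so \<open>Q\<close> is still a derivative of this
    composite.\<close>
  have B\<mu>: "mb_smooth_on V (\<lambda>z. B (\<mu> z))"
    using \<mu> by (simp add: mb_smooth_on_iff_smooth_family smooth_family_continuous_linear[OF B(1,2)])
  define Q where "Q y h = B (dir_deriv \<mu> (\<iota> y, y) (0, h))" for y h
  have Q_eq: "Q y h = dir_deriv (\<lambda>z. B (\<mu> z)) (\<iota> y, y) (0, h)" if "y \<in> W" for y h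
    unfolding Q_def
    by (rule dir_deriv_eqI[symmetric])
      (rule has_dir_deriv_continuous_linear[OF B(1,2) mb_smooth_on_dir_deriv[OF \<mu> inV[OF that]]])
  have Q_family: "smooth_family n W (\<lambda>y h. Q y (h j))" for n j
  proof (rule smooth_family_cong[OF W])
    show "smooth_family n W (\<lambda>y h. iter_dir_deriv 1 (\<lambda>z. B (\<mu> z)) (\<lambda>i. (0, h j)) (\<iota> y, y))"
      using \<iota> inV by (intro smooth_family_compose[OF B\<mu>] smooth_family_Pair smooth_family_base
          smooth_family_const smooth_family_direction) (auto simp: mb_smooth_on_iff_smooth_family)
  qed (simp add: Q_eq)
  have Q_cont: "continuous_on (W \<times> UNIV) (\<lambda>(y, h). Q y h)"
  proof -
    have "continuous_on (W \<times> UNIV) (\<lambda>p. (fst p, \<lambda>i::nat. snd p))"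
      by (intro continuous_on_Pair continuous_on_coordinatewise_then_product continuous_intros)
    from continuous_on_compose2[OF smooth_family_continuous[OF Q_family[of 0 0]] this] show ?thesis
      by (simp add: image_subset_iff case_prod_unfold)
  qed
  have Q_0: "Q y 0 = 0" if "y \<in> W" for y
    using linear_0[OF linear_dir_deriv[OF B\<mu> inV[OF that]]] by (simp add: Q_eq[OF that] zero_prod_def)
  have der: "has_dir_deriv (\<lambda>y. \<pi> (?p y) v) y h (\<pi> (?p y) (Q y h v))" if y: "y \<in> W" and v: "v \<in> D" for y h v
  proof -
    \<comment> \<open>Writing the moving group element as
      \<open>?p y \<otimes> (inv (?p y) \<otimes> ?p (y + t *\<^sub>R h))\<close> moves the
      derivative to the identity: \<open>?X\<close> is the second factor in the chart
      \<open>c\<close>, a curve through \<open>e0\<close>.\<close>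
    let ?X = "\<lambda>t. \<mu> (\<iota> y, y + t *\<^sub>R h)"
    have \<iota>y: "\<iota> y = chart_map d' (inv (?p y))" by (simp add: \<iota>_def)
    have "\<mu> (\<iota> y, y) = \<mu> (chart_map d' (inv (?p y)), chart_map d (?p y))"
      using inW(4)[OF y] by (simp add: \<iota>y)
    also have "\<dots> = e0" using inW(1-3)[OF y] by (simp add: \<mu>_eq)
    finally have "\<mu> (\<iota> y, y) = e0" .
    then have "((\<lambda>t. (?X t - e0) /\<^sub>R t) \<longlongrightarrow> dir_deriv \<mu> (\<iota> y, y) (0, h)) (at 0)"
      using mb_smooth_on_dir_deriv[OF \<mu> inV[OF y], of "(0, h)"] by (simp add: has_dir_deriv_def)
    from orbit_curve_derivative[OF v this]
    have "((\<lambda>t. (\<pi> (chart_inv c (?X t)) v - v) /\<^sub>R t) \<longlongrightarrow> Q y h v) (at 0)"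
      by (simp add: Q_def B(3)[OF v])
    then have lim: "((\<lambda>t. \<pi> (?p y) ((\<pi> (chart_inv c (?X t)) v - v) /\<^sub>R t)) \<longlongrightarrow> \<pi> (?p y) (Q y h v)) (at 0)"
      by (intro blinfun.tendsto tendsto_const)
    have "open {z. (\<iota> y, z) \<in> V}"
      using open_vimage[OF mb_smooth_onD(1)[OF \<mu>], of "\<lambda>z. (\<iota> y, z)"]
      by (simp add: vimage_def continuous_on_Pair continuous_on_id)
    from eventually_line_in_open[OF this, of y h] inV[OF y]
    have "eventually (\<lambda>t. (\<iota> y, y + t *\<^sub>R h) \<in> V) (at 0)" by simp
    then have "eventually (\<lambda>t. \<pi> (?p y) ((\<pi> (chart_inv c (?X t)) v - v) /\<^sub>R t)
        = (\<pi> (?p (y + t *\<^sub>R h)) v - \<pi> (?p y) v) /\<^sub>R t) (at 0)"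
    proof eventually_elim
      fix t assume t: "(\<iota> y, y + t *\<^sub>R h) \<in> V"
      then obtain q' q where q: "q' \<in> chart_dom d'" "q \<in> chart_dom d" "q' \<otimes> q \<in> chart_dom c"
        "\<iota> y = chart_map d' q'" "y + t *\<^sub>R h = chart_map d q"
        by (auto simp: V_def e_def)
      have q': "q' = inv (?p y)"
        using q(1,4) \<iota>y inW(2)[OF y] chart_inv_map[OF charts[OF d'(1)]] by metis
      have pq: "?p (y + t *\<^sub>R h) = q"
        using q(2,5) chart_inv_map[OF charts[OF d]] by simp
      have "chart_inv c (?X t) = q' \<otimes> q"
        using q by (simp add: \<mu>_eq chart_inv_map[OF charts[OF c(1)]])
      moreover have "?p y \<otimes> (q' \<otimes> q) = q"
        using inW(3)[OF y] dom_subset[OF d q(2)] by (simp add: q' m_assoc[symmetric])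
      then have "\<pi> (?p y) o\<^sub>L \<pi> (q' \<otimes> q) = \<pi> q"
        using \<pi>_mult[of "?p y" "q' \<otimes> q"] inW(3)[OF y] dom_subset[OF d q(2)] by (simp add: q')
      ultimately show "\<pi> (?p y) ((\<pi> (chart_inv c (?X t)) v - v) /\<^sub>R t)
        = (\<pi> (?p (y + t *\<^sub>R h)) v - \<pi> (?p y) v) /\<^sub>R t"
        by (simp add: pq blinfun.bilinear_simps flip: blinfun_apply_blinfun_compose)
    qed
    from Lim_transform_eventually[OF lim this] show ?thesis by (simp add: has_dir_deriv_def)
  qed
  have bound: "norm (\<pi> (?p y)) \<le> 1" if "y \<in> W" for y
    by (rule unitary_opD(4)[OF unitary[OF inW(3)[OF that]]])
  note deriv = operator_derivative_of_dense[where P = "\<lambda>y. \<pi> (?p y)", OF dense W der bound Q_cont Q_0]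
  have "smooth_family n W (\<lambda>y h. \<pi> (?p y))" for n
  proof (induction n)
    case 0
    show ?case using continuous_on_compose2[OF deriv(1) continuous_on_fst[OF continuous_on_id], of "W \<times> UNIV"] by auto
  next
    case (Suc n)
    show ?case
    proof (rule smooth_family_SucI[OF smooth_family_continuous[OF Suc]])
      fix j
      have "smooth_family n W (\<lambda>y h. \<pi> (?p y) o\<^sub>L Q y (h j))"
        by (rule smooth_family_bilinear[OF bounded_bilinear_blinfun_compose Suc Q_family])
      then show "\<exists>\<Psi>. smooth_family n W \<Psi> \<and> (\<forall>h. \<forall>y\<in>W. has_dir_deriv (\<lambda>y. \<pi> (?p y)) y (h j) (\<Psi> y h))"
        by (intro exI[of _ "\<lambda>y h. \<pi> (?p y) o\<^sub>L Q y (h j)"] conjI allI ballI deriv(2))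
    qed
  qed
  then have "mb_smooth_on W (\<lambda>y. \<pi> (?p y))" using W by (simp add: mb_smooth_on_iff_smooth_family)
  moreover have "chart_map d p \<in> W" unfolding W_def using p d'(2) by auto
  ultimately show ?thesis by blast
qed

lemma morphism_of_equicontinuous:
  assumes "equicontinuous_functionals (momentum_set T A expG \<pi>)"
  shows "lie_group_morphism G T A unitary_group unitary_topology unitary_atlas \<pi>"
proof -
  obtain B :: "'e \<Rightarrow> ('h \<Rightarrow>\<^sub>L 'h)" where B: "linear B" "continuous_on UNIV B" "\<And>x v. v \<in> D \<Longrightarrow> blinfun_apply (B x) v = derived x v"
    using derived_operator[OF assms] by blast
  have smooth: "mb_smooth_on (chart_map d ` chart_dom d) (\<lambda>y. \<pi> (chart_inv d y))" if d: "d \<in> A" for d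
    by (rule mb_smooth_on_local) (use local_smooth[OF B d] charts[OF d] in \<open>auto simp: is_chart_def\<close>)
  have preimage: "openin T {p \<in> chart_dom d. \<pi> p \<in> S}" if d: "d \<in> A" and S: "open S" for d S
  proof -
    have "continuous_on (chart_map d ` chart_dom d) (\<lambda>y. \<pi> (chart_inv d y))"
    proof -
      have 1: "continuous_on (chart_map d ` chart_dom d \<times> (UNIV :: (nat \<Rightarrow> 'e) set)) (\<lambda>p. \<pi> (chart_inv d (fst p)))"
        by (rule smooth_family_continuous[where n = 0 and \<Phi> = "\<lambda>y h. \<pi> (chart_inv d y)"])
          (use smooth[OF d] in \<open>simp only: mb_smooth_on_iff_smooth_family\<close>)
      \<comment> \<open>The family ignores its directions, so a dummy sequence recovers continuity
        in the base point alone.\<close>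
      have 2: "continuous_on (chart_map d ` chart_dom d) (\<lambda>y. (y, \<lambda>i::nat. 0 :: 'e))"
        by (intro continuous_on_Pair continuous_on_id continuous_on_const)
      show ?thesis
        using continuous_on_compose2[OF 1 2] by (simp add: image_subset_iff)
    qed
    then have "open {y \<in> chart_map d ` chart_dom d. \<pi> (chart_inv d y) \<in> S}"
      using S by (simp add: continuous_on_open_vimage[OF mb_smooth_onD(1)[OF smooth[OF d]]]
          vimage_def Int_def conj_commute)
    from openin_chart_preimage[OF charts[OF d] this] show ?thesis
      by (simp add: chart_inv_map[OF charts[OF d]] cong: conj_cong)
  qed
  have cont: "continuous_map T euclidean \<pi>"
    unfolding continuous_map_def
  proof (intro conjI allI impI)
    fix S :: "('h \<Rightarrow>\<^sub>L 'h) set" assume "openin euclidean S"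
    then have "openin T (\<Union>d\<in>A. {p \<in> chart_dom d. \<pi> p \<in> S})"
      using preimage by (intro openin_Union) auto
    also have "(\<Union>d\<in>A. {p \<in> chart_dom d. \<pi> p \<in> S}) = {p \<in> topspace T. \<pi> p \<in> S}"
      unfolding charts_cover[symmetric] by auto
    finally show "openin T {p \<in> topspace T. \<pi> p \<in> S}" .
  qed simp
  have "smooth_map T A unitary_topology unitary_atlas \<pi>"
    unfolding smooth_map_def
  proof (intro conjI ballI)
    show "continuous_map T unitary_topology \<pi>"
      using cont unitary topspace_carrier
      by (auto simp: unitary_topology_def continuous_map_in_subtopology)
    fix d and k :: "('h \<Rightarrow>\<^sub>L 'h, 'h skew_op) chart"
    assume d: "d \<in> A" and "k \<in> unitary_atlas"
    then obtain g :: "'h \<Rightarrow>\<^sub>L 'h" where g: "unitary_op g" "k = cayley_chart g" by (auto simp: unitary_atlas_def)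
    let ?P = "\<lambda>y. \<pi> (chart_inv d y)"
    let ?S = "chart_map d ` {p \<in> chart_dom d. \<pi> p \<in> chart_dom k}"
    have S: "y \<in> chart_map d ` chart_dom d" "unitary_op (?P y)" "invertible_op (?P y + g)" if "y \<in> ?S" for y
      using that g by (auto simp: chart_inv_map[OF charts[OF d]] cayley_chart_def)
    \<comment> \<open>Values of \<open>\<pi>\<close> on the group are unitary anyway, so the domain
      of the Cayley chart pulls back to the preimage of this open set of operators.\<close>
    have "open {X :: 'h \<Rightarrow>\<^sub>L 'h. invertible_op (X + g)}"
    proof (subst open_subopen, safe)
      fix X :: "'h \<Rightarrow>\<^sub>L 'h" assume X: "invertible_op (X + g)"
      have "eventually (\<lambda>Y. invertible_op (Y + g)) (nhds X)"
        by (rule tendsto_inverse_op(1)[OF _ X]) (intro tendsto_add tendsto_const filterlim_ident)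
      then show "\<exists>N. open N \<and> X \<in> N \<and> N \<subseteq> {X. invertible_op (X + g)}"
        unfolding eventually_nhds by blast
    qed
    from preimage[OF d this]
    have "openin T {p \<in> chart_dom d. \<pi> p \<in> chart_dom k}"
      by (rule back_subst[where P = "openin T"])
        (use unitary dom_subset[OF d] g in \<open>auto simp: cayley_chart_def\<close>)
    then have openS: "open ?S" by (rule open_chart_image[OF charts[OF d]]) auto
    have P: "smooth_family n ?S (\<lambda>y h. ?P y)" for n
      by (rule smooth_family_subset[of n "chart_map d ` chart_dom d"])
        (use smooth[OF d] in \<open>auto simp: mb_smooth_on_iff_smooth_family\<close>)
    have "smooth_family n ?S (\<lambda>y h. inverse_op (?P y + g) o\<^sub>L (?P y + (- g)))" for n
      by (intro smooth_family_bilinear[OF bounded_bilinear_blinfun_compose] smooth_family_inverse_op[OF openS]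
          smooth_family_add P smooth_family_const S(3))
    then have "smooth_family n ?S (\<lambda>y h. skew_apply (Skew (inverse_op (?P y + g) o\<^sub>L (?P y - g))))" for n
      by (rule smooth_family_cong[OF openS, rotated]) (simp add: skew_apply_Skew_Cayley S(2,3) g(1))
    then have "smooth_family n ?S (\<lambda>y h. Skew (inverse_op (?P y + g) o\<^sub>L (?P y - g)))" for n
      by (rule smooth_family_skew_op[OF openS])
    then show "mb_smooth_on ?S (chart_map k \<circ> \<pi> \<circ> chart_inv d)"
      using openS by (simp add: mb_smooth_on_iff_smooth_family g(2) cayley_chart_def o_def)
  qed
  then show ?thesis
    using representation by (simp add: lie_group_morphism_def smooth_unitary_rep_def unitary_rep_def)
qed

end

theorem theorem3p1:
  fixes G :: "('g, 'b) monoid_scheme"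
    and T :: "'g topology"
    and A :: "('g, 'e::locally_convex_space) chart set"
    and c :: "('g, 'e) chart"
    and expG :: "'e \<Rightarrow> 'g"
    and \<pi> :: "'g \<Rightarrow> ('h::complex_hilbert_space \<Rightarrow>\<^sub>L 'h)"
  assumes "lie_group G T A"
    and "smooth_exponential G T A c expG"
    and "smooth_unitary_rep G T A \<pi>"
  shows "equicontinuous_functionals (momentum_set T A expG \<pi>) \<longleftrightarrow>
    lie_group_morphism G T A unitary_group unitary_topology unitary_atlas \<pi>"
proof -
  interpret smooth_representation G T A c expG \<pi>
    using assms by (intro smooth_representation.intro smooth_representation_axioms.intro)
  show ?thesis
    using equicontinuous_of_morphism morphism_of_equicontinuous by blast
qed

end
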